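(* Let $\mathcal{K}$ be a 2-category with comma objects and pullbacks, and let $B\in\mathcal{K}$. (1) The 2-monad $\Phi_{\mathcal{K},B}$ on $\mathcal{K}/B$ is the result of applying $\mathbf{P}_{\mathcal{K}}$ to a colax idempotent 2-monad in $\mathbf{Poly}_{\mathcal{K}}$ whose underlying endomorphism of $B$ is the polynomial $$B\xleftarrow{d_0}B^{[1]}\xrightarrow{1}B^{[1]}\xrightarrow{d_1}B.$$ (2) The 2-monad $\Psi_{\mathcal{K},B}$ on $\mathcal{K}/B$ is the result of applying $\mathbf{P}_{\mathcal{K}}$ to a lax idempotent 2-monad in $\mathbf{Poly}_{\mathcal{K}}$ whose underlying endomorphism of $B$ is the polynomial $$B\xleftarrow{d_1}B^{[1]}\xrightarrow{1}B^{[1]}\xrightarrow{d_0}B.$$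
   Context: All limits in the 2-category $\mathcal{K}$ have their 2-dimensional universal property. $B^{[1]}$ is the cotensor of $B$ with the category $[1]=\{0<1\}$; it is the comma object of $1_B$ with itself, with universal 2-cell $d_1\Rightarrow d_0$ (so $d_1$ is the "domain" and $d_0$ the "codomain" projection $B^{[1]}\to B$). The fibration 2-monads. For $f:A\to B$, let $1_B\downarrow f$ be the comma object with projections $\Phi(f):1_B\downarrow f\to B$, $q_f:1_B\downarrow f\to A$ and universal 2-cell $\lambda_f:\Phi(f)\Rightarrow fq_f$. The assignment $f\mapsto\Phi(f)$ is the object map of a 2-monad $\Phi_{\mathcal{K},B}$ on the slice 2-category $\mathcal{K}/B$. Its unit $\eta_f:A\to 1_B\downarrow f$ is unique with $\Phi(f)\eta_f=f$, $q_f\eta_f=1_A$, $\lambda_f\eta_f=\mathrm{id}$, and its multiplication $\mu_f$ is unique with $\Phi(f)\mu_f=\Phi^2(f)$, $q_f\mu_f=q_fq_{\Phi(f)}$, $\lambda_f\mu_f=(\lambda_fq_{\Phi(f)})\lambda_{\Phi(f)}$ (composite of 2-cells, $\lambda_{\Phi(f)}$ first). Dually $\Psi_{\mathcal{K},B}$ sends $f$ to the projection $\Psi(f):f\downarrow 1_B\to B$ of the comma object with universal 2-cell $\lambda'_f:fp_f\Rightarrow\Psi(f)$, $p_f:f\downarrow 1_B\to A$, with unit and multiplication described dually. Polynomials. For $f:X\to Y$, $\Sigma_f:\mathcal{K}/X\to\mathcal{K}/Y$ is composition with $f$, $\Delta_f$ is its right 2-adjoint (pullback), and $f$ is exponentiable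 if $\Delta_f$ has a right 2-adjoint $\Pi_f$. A polynomial $p:X\to Y$ is a diagram $X\xleftarrow{p_1}A\xrightarrow{p_2}C\xrightarrow{p_3}Y$ with $p_2$ exponentiable. $\mathbf{Poly}_{\mathcal{K}}(X,Y)$ is the 2-category of such polynomials: an arrow $f:p\to q$, where $q$ is $X\xleftarrow{q_1}A'\xrightarrow{q_2}C'\xrightarrow{q_3}Y$, is a pair $f_0:A\to A'$, $f_1:C\to C'$ with $q_1f_0=p_1$, $q_3f_1=p_3$ and $q_2f_0=f_1p_2$ a pullback square; a 2-cell $f\to g$ is a pair of 2-cells $\phi_0:f_0\to g_0$, $\phi_1:f_1\to g_1$ with $q_1\phi_0=\mathrm{id}$, $q_2\phi_0=\phi_1p_2$, $q_3\phi_1=\mathrm{id}$. Polynomials compose bicategorically; in particular polynomials whose middle map is an identity are spans and their composition (of 1-cells and 2-cells) is the usual composition of spans by pullback. $\mathbf{P}_{\mathcal{K}}$ is the homomorphism sending $X$ to $\mathcal{K}/X$, $p$ to $\Sigma_{p_3}\Pi_{p_2}\Delta_{p_1}$, and an arrow $f:p\to q$ to the composite $\Sigma_{p_3}\Pi_{p_2}\Delta_{p_1}\cong\Sigma_{p_3}\Pi_{p_2}\Delta_{f_0}\Delta_{q_1}\cong\Sigma_{p_3}\Delta_{f_1}\Pi_{q_2}\Delta_{q_1}\to\Sigma_{q_3}\Pi_{q_2}\Delta_{q_1}$ (Beck–Chevalley isomorphism, then the mate of $\Sigma_{p_3}=\Sigma_{q_3}\Sigma_{f_1}$). For spans this is simply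 $\Sigma_{p_3}\Delta_{p_1}$ and the evident transformations. "The result of applying $\mathbf{P}_{\mathcal{K}}$" is understood up to isomorphism of 2-monads on $\mathcal{K}/B$. A 2-monad on $B$ in $\mathbf{Poly}_{\mathcal{K}}$ is an endomorphism $M:B\to B$ with unit $u:1_B\to M$ and multiplication $m:M\circ M\to M$ satisfying the monad axioms, i.e. a monoid in $\mathbf{Poly}_{\mathcal{K}}(B,B)$ with $\otimes=\circ$. It is colax idempotent if $u\circ M\dashv m\dashv M\circ u$, and lax idempotent if $M\circ u\dashv m\dashv u\circ M$, these adjunctions being in the 2-category $\mathbf{Poly}_{\mathcal{K}}(B,B)$. *)

theory Defs
  imports Main
begin

section \<open>Strict 2-categories\<close>

text \<open>
  A 2-category has explicit carriers of objects, arrows and 2-cells; the operations are only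
  meaningful on composable arguments from the carriers.  Composition is written in
  applicative order: \<open>g \<cdot> f\<close> is \<open>f\<close> followed by \<open>g\<close>, and \<open>\<beta> \<bullet> \<alpha>\<close> is the vertical composite in which
  \<open>\<alpha>\<close> comes first.
\<close>

record ('o, 'a, 'c) two_cat =
  Obj  :: "'o set"
  Arr  :: "'a set"
  Cell :: "'c set"
  Dom  :: "'a \<Rightarrow> 'o"
  Cod  :: "'a \<Rightarrow> 'o"
  Src  :: "'c \<Rightarrow> 'a"
  Tgt  :: "'c \<Rightarrow> 'a"
  Id1  :: "'o \<Rightarrow> 'a"
  Comp :: "'a \<Rightarrow> 'a \<Rightarrow> 'a"  (infixr "\<cdot>\<index>" 70)
  Id2  :: "'a \<Rightarrow> 'c"
  VComp :: "'c \<Rightarrow> 'c \<Rightarrow> 'c"  (infixr "\<bullet>\<index>" 65)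
  HComp :: "'c \<Rightarrow> 'c \<Rightarrow> 'c"  (infixr "\<star>\<index>" 70)

definition arr :: "('o, 'a, 'c) two_cat \<Rightarrow> 'a \<Rightarrow> 'o \<Rightarrow> 'o \<Rightarrow> bool" where
  "arr K f A B \<longleftrightarrow> f \<in> Arr K \<and> Dom K f = A \<and> Cod K f = B"

definition cell :: "('o, 'a, 'c) two_cat \<Rightarrow> 'c \<Rightarrow> 'a \<Rightarrow> 'a \<Rightarrow> bool" where
  "cell K \<alpha> f g \<longleftrightarrow> \<alpha> \<in> Cell K \<and> Src K \<alpha> = f \<and> Tgt K \<alpha> = g"

definition lwhisk :: "('o, 'a, 'c) two_cat \<Rightarrow> 'a \<Rightarrow> 'c \<Rightarrow> 'c"  (infixr "\<rhd>\<index>" 70) where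
  "g \<rhd>\<^bsub>K\<^esub> \<alpha> = Id2 K g \<star>\<^bsub>K\<^esub> \<alpha>"

definition rwhisk :: "('o, 'a, 'c) two_cat \<Rightarrow> 'c \<Rightarrow> 'a \<Rightarrow> 'c"  (infixl "\<lhd>\<index>" 70) where
  "\<alpha> \<lhd>\<^bsub>K\<^esub> f = \<alpha> \<star>\<^bsub>K\<^esub> Id2 K f"

locale two_category =
  fixes K :: "('o, 'a, 'c) two_cat" (structure)
  assumes Dom_Obj: "f \<in> Arr K \<Longrightarrow> Dom K f \<in> Obj K"
    and Cod_Obj: "f \<in> Arr K \<Longrightarrow> Cod K f \<in> Obj K"
    and Src_Arr: "\<alpha> \<in> Cell K \<Longrightarrow> Src K \<alpha> \<in> Arr K"
    and Tgt_Arr: "\<alpha> \<in> Cell K \<Longrightarrow> Tgt K \<alpha> \<in> Arr K"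
    and Dom_parallel: "\<alpha> \<in> Cell K \<Longrightarrow> Dom K (Tgt K \<alpha>) = Dom K (Src K \<alpha>)"
    and Cod_parallel: "\<alpha> \<in> Cell K \<Longrightarrow> Cod K (Tgt K \<alpha>) = Cod K (Src K \<alpha>)"
    and Id1_arr: "A \<in> Obj K \<Longrightarrow> arr K (Id1 K A) A A"
    and Comp_arr: "\<lbrakk>arr K f A B; arr K g B C\<rbrakk> \<Longrightarrow> arr K (g \<cdot> f) A C"
    and Comp_Id1_left: "arr K f A B \<Longrightarrow> Id1 K B \<cdot> f = f"
    and Comp_Id1_right: "arr K f A B \<Longrightarrow> f \<cdot> Id1 K A = f"
    and Comp_assoc:
      "\<lbrakk>arr K f A B; arr K g B C; arr K h C D\<rbrakk> \<Longrightarrow> (h \<cdot> g) \<cdot> f = h \<cdot> (g \<cdot> f)"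
    and Id2_cell: "f \<in> Arr K \<Longrightarrow> cell K (Id2 K f) f f"
    and VComp_cell: "\<lbrakk>cell K \<alpha> f g; cell K \<beta> g h\<rbrakk> \<Longrightarrow> cell K (\<beta> \<bullet> \<alpha>) f h"
    and VComp_Id2_left: "cell K \<alpha> f g \<Longrightarrow> Id2 K g \<bullet> \<alpha> = \<alpha>"
    and VComp_Id2_right: "cell K \<alpha> f g \<Longrightarrow> \<alpha> \<bullet> Id2 K f = \<alpha>"
    and VComp_assoc:
      "\<lbrakk>cell K \<alpha> f g; cell K \<beta> g h; cell K \<gamma> h k\<rbrakk> \<Longrightarrow> (\<gamma> \<bullet> \<beta>) \<bullet> \<alpha> = \<gamma> \<bullet> (\<beta> \<bullet> \<alpha>)"
    and HComp_cell:
      "\<lbrakk>cell K \<alpha> f f'; cell K \<beta> g g'; arr K f A B; arr K g B C\<rbrakk>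
        \<Longrightarrow> cell K (\<beta> \<star> \<alpha>) (g \<cdot> f) (g' \<cdot> f')"
    and HComp_Id_left: "\<lbrakk>cell K \<alpha> f g; arr K f A B\<rbrakk> \<Longrightarrow> Id2 K (Id1 K B) \<star> \<alpha> = \<alpha>"
    and HComp_Id_right: "\<lbrakk>cell K \<alpha> f g; arr K f A B\<rbrakk> \<Longrightarrow> \<alpha> \<star> Id2 K (Id1 K A) = \<alpha>"
    and HComp_assoc:
      "\<lbrakk>cell K \<alpha> f f'; cell K \<beta> g g'; cell K \<gamma> h h'; arr K f A B; arr K g B C; arr K h C D\<rbrakk>
        \<Longrightarrow> (\<gamma> \<star> \<beta>) \<star> \<alpha> = \<gamma> \<star> (\<beta> \<star> \<alpha>)"
    and HComp_Id2: "\<lbrakk>arr K f A B; arr K g B C\<rbrakk> \<Longrightarrow> Id2 K g \<star> Id2 K f = Id2 K (g \<cdot> f)"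
    and interchange:
      "\<lbrakk>cell K \<alpha> f f'; cell K \<alpha>' f' f''; cell K \<beta> g g'; cell K \<beta>' g' g'';
        arr K f A B; arr K g B C\<rbrakk>
        \<Longrightarrow> (\<beta>' \<bullet> \<beta>) \<star> (\<alpha>' \<bullet> \<alpha>) = (\<beta>' \<star> \<alpha>') \<bullet> (\<beta> \<star> \<alpha>)"

definition inverse_arrs :: "('o, 'a, 'c) two_cat \<Rightarrow> 'a \<Rightarrow> 'a \<Rightarrow> bool" where
  "inverse_arrs K f g \<longleftrightarrow> arr K g (Cod K f) (Dom K f) \<and>
     g \<cdot>\<^bsub>K\<^esub> f = Id1 K (Dom K f) \<and> f \<cdot>\<^bsub>K\<^esub> g = Id1 K (Cod K f)"

definition inv_arr :: "('o, 'a, 'c) two_cat \<Rightarrow> 'a \<Rightarrow> 'a" where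
  "inv_arr K f = (THE g. inverse_arrs K f g)"

definition adjoint_arrs :: "('o, 'a, 'c) two_cat \<Rightarrow> 'a \<Rightarrow> 'a \<Rightarrow> bool" where
  \<comment> \<open>\<open>f\<close> is left adjoint to \<open>g\<close>\<close>
  "adjoint_arrs K f g \<longleftrightarrow>
     f \<in> Arr K \<and> arr K g (Cod K f) (Dom K f) \<and>
     (\<exists>\<eta> \<epsilon>. cell K \<eta> (Id1 K (Dom K f)) (g \<cdot>\<^bsub>K\<^esub> f) \<and>
            cell K \<epsilon> (f \<cdot>\<^bsub>K\<^esub> g) (Id1 K (Cod K f)) \<and>
            (\<epsilon> \<lhd>\<^bsub>K\<^esub> f) \<bullet>\<^bsub>K\<^esub> (f \<rhd>\<^bsub>K\<^esub> \<eta>) = Id2 K f \<and>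
            (g \<rhd>\<^bsub>K\<^esub> \<epsilon>) \<bullet>\<^bsub>K\<^esub> (\<eta> \<lhd>\<^bsub>K\<^esub> g) = Id2 K g)"


section \<open>2-functors, 2-natural transformations, 2-monads\<close>

record ('o, 'a, 'c, 'p, 'b, 'd) two_fun =
  onO :: "'o \<Rightarrow> 'p"
  onA :: "'a \<Rightarrow> 'b"
  onC :: "'c \<Rightarrow> 'd"

definition two_functor ::
  "('o, 'a, 'c) two_cat \<Rightarrow> ('p, 'b, 'd) two_cat \<Rightarrow> ('o, 'a, 'c, 'p, 'b, 'd) two_fun \<Rightarrow> bool" where
  "two_functor K L F \<longleftrightarrow>
     (\<forall>A \<in> Obj K. onO F A \<in> Obj L) \<and>
     (\<forall>f A B. arr K f A B \<longrightarrow> arr L (onA F f) (onO F A) (onO F B)) \<and>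
     (\<forall>\<alpha> f g. cell K \<alpha> f g \<longrightarrow> cell L (onC F \<alpha>) (onA F f) (onA F g)) \<and>
     (\<forall>A \<in> Obj K. onA F (Id1 K A) = Id1 L (onO F A)) \<and>
     (\<forall>f g A B C. arr K f A B \<and> arr K g B C \<longrightarrow>
        onA F (g \<cdot>\<^bsub>K\<^esub> f) = onA F g \<cdot>\<^bsub>L\<^esub> onA F f) \<and>
     (\<forall>f \<in> Arr K. onC F (Id2 K f) = Id2 L (onA F f)) \<and>
     (\<forall>\<alpha> \<beta> f g h. cell K \<alpha> f g \<and> cell K \<beta> g h \<longrightarrow>
        onC F (\<beta> \<bullet>\<^bsub>K\<^esub> \<alpha>) = onC F \<beta> \<bullet>\<^bsub>L\<^esub> onC F \<alpha>) \<and>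
     (\<forall>\<alpha> \<beta> f f' g g' A B C. cell K \<alpha> f f' \<and> cell K \<beta> g g' \<and> arr K f A B \<and> arr K g B C \<longrightarrow>
        onC F (\<beta> \<star>\<^bsub>K\<^esub> \<alpha>) = onC F \<beta> \<star>\<^bsub>L\<^esub> onC F \<alpha>)"

definition id_fun :: "('o, 'a, 'c, 'o, 'a, 'c) two_fun" where
  "id_fun = \<lparr>onO = (\<lambda>A. A), onA = (\<lambda>f. f), onC = (\<lambda>\<alpha>. \<alpha>)\<rparr>"

definition comp_fun ::
  "('p, 'b, 'd, 'q, 'e, 'f) two_fun \<Rightarrow> ('o, 'a, 'c, 'p, 'b, 'd) two_fun
    \<Rightarrow> ('o, 'a, 'c, 'q, 'e, 'f) two_fun"  (infixr "\<circ>\<^sub>F" 70) where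
  "G \<circ>\<^sub>F F = \<lparr>onO = onO G \<circ> onO F, onA = onA G \<circ> onA F, onC = onC G \<circ> onC F\<rparr>"

definition two_nat ::
  "('o, 'a, 'c) two_cat \<Rightarrow> ('p, 'b, 'd) two_cat \<Rightarrow> ('o, 'a, 'c, 'p, 'b, 'd) two_fun
    \<Rightarrow> ('o, 'a, 'c, 'p, 'b, 'd) two_fun \<Rightarrow> ('o \<Rightarrow> 'b) \<Rightarrow> bool" where
  "two_nat K L F G \<tau> \<longleftrightarrow>
     (\<forall>A \<in> Obj K. arr L (\<tau> A) (onO F A) (onO G A)) \<and>
     (\<forall>f A B. arr K f A B \<longrightarrow> \<tau> B \<cdot>\<^bsub>L\<^esub> onA F f = onA G f \<cdot>\<^bsub>L\<^esub> \<tau> A) \<and>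
     (\<forall>\<alpha> f g A B. cell K \<alpha> f g \<and> arr K f A B \<longrightarrow>
        \<tau> B \<rhd>\<^bsub>L\<^esub> onC F \<alpha> = onC G \<alpha> \<lhd>\<^bsub>L\<^esub> \<tau> A)"

definition has_right_2_adjoint ::
  "('o, 'a, 'c) two_cat \<Rightarrow> ('p, 'b, 'd) two_cat \<Rightarrow> ('o, 'a, 'c, 'p, 'b, 'd) two_fun \<Rightarrow> bool" where
  "has_right_2_adjoint K L F \<longleftrightarrow>
     (\<exists>G \<eta> \<epsilon>. two_functor K L F \<and> two_functor L K G \<and>
        two_nat K K id_fun (G \<circ>\<^sub>F F) \<eta> \<and> two_nat L L (F \<circ>\<^sub>F G) id_fun \<epsilon> \<and>
        (\<forall>A \<in> Obj K. \<epsilon> (onO F A) \<cdot>\<^bsub>L\<^esub> onA F (\<eta> A) = Id1 L (onO F A)) \<and>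
        (\<forall>X \<in> Obj L. onA G (\<epsilon> X) \<cdot>\<^bsub>K\<^esub> \<eta> (onO G X) = Id1 K (onO G X)))"

record ('o, 'a, 'c) two_monad =
  Fun  :: "('o, 'a, 'c, 'o, 'a, 'c) two_fun"
  Unit :: "'o \<Rightarrow> 'a"
  Mult :: "'o \<Rightarrow> 'a"

definition is_two_monad :: "('o, 'a, 'c) two_cat \<Rightarrow> ('o, 'a, 'c) two_monad \<Rightarrow> bool" where
  "is_two_monad K T \<longleftrightarrow>
     two_functor K K (Fun T) \<and>
     two_nat K K id_fun (Fun T) (Unit T) \<and>
     two_nat K K (Fun T \<circ>\<^sub>F Fun T) (Fun T) (Mult T) \<and>
     (\<forall>A \<in> Obj K.
        Mult T A \<cdot>\<^bsub>K\<^esub> Unit T (onO (Fun T) A) = Id1 K (onO (Fun T) A) \<and>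
        Mult T A \<cdot>\<^bsub>K\<^esub> onA (Fun T) (Unit T A) = Id1 K (onO (Fun T) A) \<and>
        Mult T A \<cdot>\<^bsub>K\<^esub> Mult T (onO (Fun T) A) = Mult T A \<cdot>\<^bsub>K\<^esub> onA (Fun T) (Mult T A))"

text \<open>Isomorphism of 2-monads: an invertible 2-natural transformation compatible with the units
  and the multiplications.\<close>

definition two_monads_iso ::
  "('o, 'a, 'c) two_cat \<Rightarrow> ('o, 'a, 'c) two_monad \<Rightarrow> ('o, 'a, 'c) two_monad \<Rightarrow> bool" where
  "two_monads_iso K S T \<longleftrightarrow>
     is_two_monad K S \<and> is_two_monad K T \<and>
     (\<exists>\<theta>. two_nat K K (Fun S) (Fun T) \<theta> \<and>
        (\<forall>A \<in> Obj K. (\<exists>g. inverse_arrs K (\<theta> A) g) \<and>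
           \<theta> A \<cdot>\<^bsub>K\<^esub> Unit S A = Unit T A \<and>
           \<theta> A \<cdot>\<^bsub>K\<^esub> Mult S A =
             Mult T A \<cdot>\<^bsub>K\<^esub> (\<theta> (onO (Fun T) A) \<cdot>\<^bsub>K\<^esub> onA (Fun S) (\<theta> A))))"


section \<open>Pullbacks and comma objects\<close>

text \<open>Both come with their 2-dimensional universal property.  The comma object of \<open>f\<close> and \<open>g\<close>
  has projections \<open>p\<close>, \<open>q\<close> and universal 2-cell \<open>\<lambda> : f \<cdot> p \<Rightarrow> g \<cdot> q\<close>.\<close>

definition is_pullback :: "('o, 'a, 'c) two_cat \<Rightarrow> 'a \<Rightarrow> 'a \<Rightarrow> 'a \<times> 'a \<Rightarrow> bool" where
  "is_pullback K f g = (\<lambda>(p, q).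
     f \<in> Arr K \<and> g \<in> Arr K \<and> p \<in> Arr K \<and> q \<in> Arr K \<and>
     Cod K f = Cod K g \<and> Dom K p = Dom K q \<and> Cod K p = Dom K f \<and> Cod K q = Dom K g \<and>
     f \<cdot>\<^bsub>K\<^esub> p = g \<cdot>\<^bsub>K\<^esub> q \<and>
     (\<forall>X u v. arr K u X (Dom K f) \<and> arr K v X (Dom K g) \<and> f \<cdot>\<^bsub>K\<^esub> u = g \<cdot>\<^bsub>K\<^esub> v \<longrightarrow>
        (\<exists>!w. arr K w X (Dom K p) \<and> p \<cdot>\<^bsub>K\<^esub> w = u \<and> q \<cdot>\<^bsub>K\<^esub> w = v)) \<and>
     (\<forall>X h k \<alpha> \<beta>. arr K h X (Dom K p) \<and> arr K k X (Dom K p) \<and>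
        cell K \<alpha> (p \<cdot>\<^bsub>K\<^esub> h) (p \<cdot>\<^bsub>K\<^esub> k) \<and> cell K \<beta> (q \<cdot>\<^bsub>K\<^esub> h) (q \<cdot>\<^bsub>K\<^esub> k) \<and>
        f \<rhd>\<^bsub>K\<^esub> \<alpha> = g \<rhd>\<^bsub>K\<^esub> \<beta> \<longrightarrow>
        (\<exists>!\<gamma>. cell K \<gamma> h k \<and> p \<rhd>\<^bsub>K\<^esub> \<gamma> = \<alpha> \<and> q \<rhd>\<^bsub>K\<^esub> \<gamma> = \<beta>)))"

definition is_comma :: "('o, 'a, 'c) two_cat \<Rightarrow> 'a \<Rightarrow> 'a \<Rightarrow> 'a \<times> 'a \<times> 'c \<Rightarrow> bool" where
  "is_comma K f g = (\<lambda>(p, q, l).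
     f \<in> Arr K \<and> g \<in> Arr K \<and> p \<in> Arr K \<and> q \<in> Arr K \<and>
     Cod K f = Cod K g \<and> Dom K p = Dom K q \<and> Cod K p = Dom K f \<and> Cod K q = Dom K g \<and>
     cell K l (f \<cdot>\<^bsub>K\<^esub> p) (g \<cdot>\<^bsub>K\<^esub> q) \<and>
     (\<forall>X u v \<sigma>. arr K u X (Dom K f) \<and> arr K v X (Dom K g) \<and>
        cell K \<sigma> (f \<cdot>\<^bsub>K\<^esub> u) (g \<cdot>\<^bsub>K\<^esub> v) \<longrightarrow>
        (\<exists>!w. arr K w X (Dom K p) \<and> p \<cdot>\<^bsub>K\<^esub> w = u \<and> q \<cdot>\<^bsub>K\<^esub> w = v \<and> l \<lhd>\<^bsub>K\<^esub> w = \<sigma>)) \<and>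
     (\<forall>X h k \<alpha> \<beta>. arr K h X (Dom K p) \<and> arr K k X (Dom K p) \<and>
        cell K \<alpha> (p \<cdot>\<^bsub>K\<^esub> h) (p \<cdot>\<^bsub>K\<^esub> k) \<and> cell K \<beta> (q \<cdot>\<^bsub>K\<^esub> h) (q \<cdot>\<^bsub>K\<^esub> k) \<and>
        (g \<rhd>\<^bsub>K\<^esub> \<beta>) \<bullet>\<^bsub>K\<^esub> (l \<lhd>\<^bsub>K\<^esub> h) = (l \<lhd>\<^bsub>K\<^esub> k) \<bullet>\<^bsub>K\<^esub> (f \<rhd>\<^bsub>K\<^esub> \<alpha>) \<longrightarrow>
        (\<exists>!\<gamma>. cell K \<gamma> h k \<and> p \<rhd>\<^bsub>K\<^esub> \<gamma> = \<alpha> \<and> q \<rhd>\<^bsub>K\<^esub> \<gamma> = \<beta>)))"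

definition chosen_pullbacks :: "('o, 'a, 'c) two_cat \<Rightarrow> ('a \<Rightarrow> 'a \<Rightarrow> 'a \<times> 'a) \<Rightarrow> bool" where
  "chosen_pullbacks K pb \<longleftrightarrow>
     (\<forall>f \<in> Arr K. \<forall>g \<in> Arr K. Cod K f = Cod K g \<longrightarrow> is_pullback K f g (pb f g))"

definition chosen_commas :: "('o, 'a, 'c) two_cat \<Rightarrow> ('a \<Rightarrow> 'a \<Rightarrow> 'a \<times> 'a \<times> 'c) \<Rightarrow> bool" where
  "chosen_commas K cm \<longleftrightarrow>
     (\<forall>f \<in> Arr K. \<forall>g \<in> Arr K. Cod K f = Cod K g \<longrightarrow> is_comma K f g (cm f g))"

text \<open>The cotensor of \<open>B\<close> with the category \<open>[1]\<close>, as the comma object of the identity of \<open>B\<close>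
  with itself; \<open>d1\<close> is the domain and \<open>d0\<close> the codomain projection.\<close>

definition is_arrow_cotensor ::
  "('o, 'a, 'c) two_cat \<Rightarrow> 'o \<Rightarrow> 'o \<Rightarrow> 'a \<Rightarrow> 'a \<Rightarrow> 'c \<Rightarrow> bool" where
  "is_arrow_cotensor K B E d1 d0 l \<longleftrightarrow>
     is_comma K (Id1 K B) (Id1 K B) (d1, d0, l) \<and> Dom K d1 = E"

text \<open>The arrows and 2-cells induced by the universal properties.\<close>

definition pb_arr :: "('o, 'a, 'c) two_cat \<Rightarrow> 'a \<times> 'a \<Rightarrow> 'a \<Rightarrow> 'a \<Rightarrow> 'a" where
  "pb_arr K = (\<lambda>(p, q) u v.
     THE w. arr K w (Dom K u) (Dom K p) \<and> p \<cdot>\<^bsub>K\<^esub> w = u \<and> q \<cdot>\<^bsub>K\<^esub> w = v)"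

definition pb_cell :: "('o, 'a, 'c) two_cat \<Rightarrow> 'a \<times> 'a \<Rightarrow> 'a \<Rightarrow> 'a \<Rightarrow> 'c \<Rightarrow> 'c \<Rightarrow> 'c" where
  "pb_cell K = (\<lambda>(p, q) h k \<alpha> \<beta>.
     THE \<gamma>. cell K \<gamma> h k \<and> p \<rhd>\<^bsub>K\<^esub> \<gamma> = \<alpha> \<and> q \<rhd>\<^bsub>K\<^esub> \<gamma> = \<beta>)"

definition cm_arr :: "('o, 'a, 'c) two_cat \<Rightarrow> 'a \<times> 'a \<times> 'c \<Rightarrow> 'a \<Rightarrow> 'a \<Rightarrow> 'c \<Rightarrow> 'a" where
  "cm_arr K = (\<lambda>(p, q, l) u v \<sigma>.
     THE w. arr K w (Dom K u) (Dom K p) \<and> p \<cdot>\<^bsub>K\<^esub> w = u \<and> q \<cdot>\<^bsub>K\<^esub> w = v \<and> l \<lhd>\<^bsub>K\<^esub> w = \<sigma>)"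

definition cm_cell :: "('o, 'a, 'c) two_cat \<Rightarrow> 'a \<times> 'a \<times> 'c \<Rightarrow> 'a \<Rightarrow> 'a \<Rightarrow> 'c \<Rightarrow> 'c \<Rightarrow> 'c" where
  "cm_cell K = (\<lambda>(p, q, l) h k \<alpha> \<beta>.
     THE \<gamma>. cell K \<gamma> h k \<and> p \<rhd>\<^bsub>K\<^esub> \<gamma> = \<alpha> \<and> q \<rhd>\<^bsub>K\<^esub> \<gamma> = \<beta>)"


section \<open>Slice 2-categories\<close>

text \<open>An arrow \<open>(f, h, g)\<close> of the slice is \<open>h\<close> regarded as an arrow from \<open>f\<close> to \<open>g\<close>; similarly
  for 2-cells.\<close>

definition slice :: "('o, 'a, 'c) two_cat \<Rightarrow> 'o \<Rightarrow> ('a, 'a \<times> 'a \<times> 'a, 'a \<times> 'c \<times> 'a) two_cat" where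
  "slice K B = \<lparr>
     Obj = {f \<in> Arr K. Cod K f = B},
     Arr = {(f, h, g). f \<in> Arr K \<and> Cod K f = B \<and> g \<in> Arr K \<and> Cod K g = B \<and>
                       arr K h (Dom K f) (Dom K g) \<and> g \<cdot>\<^bsub>K\<^esub> h = f},
     Cell = {(f, \<alpha>, g). f \<in> Arr K \<and> Cod K f = B \<and> g \<in> Arr K \<and> Cod K g = B \<and>
                       \<alpha> \<in> Cell K \<and> arr K (Src K \<alpha>) (Dom K f) (Dom K g) \<and>
                       g \<cdot>\<^bsub>K\<^esub> Src K \<alpha> = f \<and> g \<cdot>\<^bsub>K\<^esub> Tgt K \<alpha> = f \<and> g \<rhd>\<^bsub>K\<^esub> \<alpha> = Id2 K f},
     Dom = (\<lambda>(f, h, g). f),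
     Cod = (\<lambda>(f, h, g). g),
     Src = (\<lambda>(f, \<alpha>, g). (f, Src K \<alpha>, g)),
     Tgt = (\<lambda>(f, \<alpha>, g). (f, Tgt K \<alpha>, g)),
     Id1 = (\<lambda>f. (f, Id1 K (Dom K f), f)),
     Comp = (\<lambda>(g, k, e) (f, h, g'). (f, k \<cdot>\<^bsub>K\<^esub> h, e)),
     Id2 = (\<lambda>(f, h, g). (f, Id2 K h, g)),
     VComp = (\<lambda>(f', \<beta>, g') (f, \<alpha>, g). (f, \<beta> \<bullet>\<^bsub>K\<^esub> \<alpha>, g)),
     HComp = (\<lambda>(g, \<beta>, e) (f, \<alpha>, g'). (f, \<beta> \<star>\<^bsub>K\<^esub> \<alpha>, e)) \<rparr>"

type_synonym ('a, 'c) slice_fun =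
  "('a, 'a \<times> 'a \<times> 'a, 'a \<times> 'c \<times> 'a, 'a, 'a \<times> 'a \<times> 'a, 'a \<times> 'c \<times> 'a) two_fun"

type_synonym ('a, 'c) slice_monad = "('a, 'a \<times> 'a \<times> 'a, 'a \<times> 'c \<times> 'a) two_monad"

definition Sigma_fun :: "('o, 'a, 'c) two_cat \<Rightarrow> 'a \<Rightarrow> ('a, 'c) slice_fun" where
  "Sigma_fun K f = \<lparr>
     onO = (\<lambda>h. f \<cdot>\<^bsub>K\<^esub> h),
     onA = (\<lambda>(h, k, h'). (f \<cdot>\<^bsub>K\<^esub> h, k, f \<cdot>\<^bsub>K\<^esub> h')),
     onC = (\<lambda>(h, \<alpha>, h'). (f \<cdot>\<^bsub>K\<^esub> h, \<alpha>, f \<cdot>\<^bsub>K\<^esub> h')) \<rparr>"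

text \<open>The value of \<open>\<Delta>\<^sub>f\<close> at \<open>h\<close> is the first projection of the chosen pullback of \<open>f\<close> and \<open>h\<close>.\<close>

definition Delta_arr ::
  "('o, 'a, 'c) two_cat \<Rightarrow> ('a \<Rightarrow> 'a \<Rightarrow> 'a \<times> 'a) \<Rightarrow> 'a \<Rightarrow> 'a \<Rightarrow> 'a \<Rightarrow> 'a \<Rightarrow> 'a" where
  "Delta_arr K pb f h k h' =
     pb_arr K (pb f h') (fst (pb f h)) (k \<cdot>\<^bsub>K\<^esub> snd (pb f h))"

definition Delta_fun ::
  "('o, 'a, 'c) two_cat \<Rightarrow> ('a \<Rightarrow> 'a \<Rightarrow> 'a \<times> 'a) \<Rightarrow> 'a \<Rightarrow> ('a, 'c) slice_fun" where
  "Delta_fun K pb f = \<lparr>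
     onO = (\<lambda>h. fst (pb f h)),
     onA = (\<lambda>(h, k, h'). (fst (pb f h), Delta_arr K pb f h k h', fst (pb f h'))),
     onC = (\<lambda>(h, \<alpha>, h').
       (fst (pb f h),
        pb_cell K (pb f h') (Delta_arr K pb f h (Src K \<alpha>) h') (Delta_arr K pb f h (Tgt K \<alpha>) h')
          (Id2 K (fst (pb f h))) (\<alpha> \<lhd>\<^bsub>K\<^esub> snd (pb f h)),
        fst (pb f h'))) \<rparr>"

definition exponentiable ::
  "('o, 'a, 'c) two_cat \<Rightarrow> ('a \<Rightarrow> 'a \<Rightarrow> 'a \<times> 'a) \<Rightarrow> 'a \<Rightarrow> bool" where
  "exponentiable K pb f \<longleftrightarrow>
     f \<in> Arr K \<and> has_right_2_adjoint (slice K (Cod K f)) (slice K (Dom K f)) (Delta_fun K pb f)"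


section \<open>The fibration 2-monads\<close>

text \<open>For \<open>cm (Id1 K B) f = (\<Phi> f, q\<^sub>f, \<lambda>\<^sub>f)\<close>.\<close>

definition Phi_ob :: "('o, 'a, 'c) two_cat \<Rightarrow> ('a \<Rightarrow> 'a \<Rightarrow> 'a \<times> 'a \<times> 'c) \<Rightarrow> 'o \<Rightarrow> 'a \<Rightarrow> 'a" where
  "Phi_ob K cm B f = fst (cm (Id1 K B) f)"

definition Phi_q :: "('o, 'a, 'c) two_cat \<Rightarrow> ('a \<Rightarrow> 'a \<Rightarrow> 'a \<times> 'a \<times> 'c) \<Rightarrow> 'o \<Rightarrow> 'a \<Rightarrow> 'a" where
  "Phi_q K cm B f = fst (snd (cm (Id1 K B) f))"

definition Phi_lam :: "('o, 'a, 'c) two_cat \<Rightarrow> ('a \<Rightarrow> 'a \<Rightarrow> 'a \<times> 'a \<times> 'c) \<Rightarrow> 'o \<Rightarrow> 'a \<Rightarrow> 'c" where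
  "Phi_lam K cm B f = snd (snd (cm (Id1 K B) f))"

definition Phi_arr ::
  "('o, 'a, 'c) two_cat \<Rightarrow> ('a \<Rightarrow> 'a \<Rightarrow> 'a \<times> 'a \<times> 'c) \<Rightarrow> 'o \<Rightarrow> 'a \<Rightarrow> 'a \<Rightarrow> 'a \<Rightarrow> 'a" where
  "Phi_arr K cm B f h g =
     cm_arr K (cm (Id1 K B) g) (Phi_ob K cm B f) (h \<cdot>\<^bsub>K\<^esub> Phi_q K cm B f) (Phi_lam K cm B f)"

definition Phi_monad ::
  "('o, 'a, 'c) two_cat \<Rightarrow> ('a \<Rightarrow> 'a \<Rightarrow> 'a \<times> 'a \<times> 'c) \<Rightarrow> 'o \<Rightarrow> ('a, 'c) slice_monad" where
  "Phi_monad K cm B = \<lparr>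
     Fun = \<lparr>
       onO = Phi_ob K cm B,
       onA = (\<lambda>(f, h, g). (Phi_ob K cm B f, Phi_arr K cm B f h g, Phi_ob K cm B g)),
       onC = (\<lambda>(f, \<alpha>, g).
         (Phi_ob K cm B f,
          cm_cell K (cm (Id1 K B) g) (Phi_arr K cm B f (Src K \<alpha>) g) (Phi_arr K cm B f (Tgt K \<alpha>) g)
            (Id2 K (Phi_ob K cm B f)) (\<alpha> \<lhd>\<^bsub>K\<^esub> Phi_q K cm B f),
          Phi_ob K cm B g)) \<rparr>,
     Unit = (\<lambda>f. (f, cm_arr K (cm (Id1 K B) f) f (Id1 K (Dom K f)) (Id2 K f), Phi_ob K cm B f)),
     Mult = (\<lambda>f. let g = Phi_ob K cm B f in
       (Phi_ob K cm B g,
        cm_arr K (cm (Id1 K B) f) (Phi_ob K cm B g) (Phi_q K cm B f \<cdot>\<^bsub>K\<^esub> Phi_q K cm B g)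
          ((Phi_lam K cm B f \<lhd>\<^bsub>K\<^esub> Phi_q K cm B g) \<bullet>\<^bsub>K\<^esub> Phi_lam K cm B g),
        g)) \<rparr>"

text \<open>For \<open>cm f (Id1 K B) = (p\<^sub>f, \<Psi> f, \<lambda>'\<^sub>f)\<close>.\<close>

definition Psi_ob :: "('o, 'a, 'c) two_cat \<Rightarrow> ('a \<Rightarrow> 'a \<Rightarrow> 'a \<times> 'a \<times> 'c) \<Rightarrow> 'o \<Rightarrow> 'a \<Rightarrow> 'a" where
  "Psi_ob K cm B f = fst (snd (cm f (Id1 K B)))"

definition Psi_p :: "('o, 'a, 'c) two_cat \<Rightarrow> ('a \<Rightarrow> 'a \<Rightarrow> 'a \<times> 'a \<times> 'c) \<Rightarrow> 'o \<Rightarrow> 'a \<Rightarrow> 'a" where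
  "Psi_p K cm B f = fst (cm f (Id1 K B))"

definition Psi_lam :: "('o, 'a, 'c) two_cat \<Rightarrow> ('a \<Rightarrow> 'a \<Rightarrow> 'a \<times> 'a \<times> 'c) \<Rightarrow> 'o \<Rightarrow> 'a \<Rightarrow> 'c" where
  "Psi_lam K cm B f = snd (snd (cm f (Id1 K B)))"

definition Psi_arr ::
  "('o, 'a, 'c) two_cat \<Rightarrow> ('a \<Rightarrow> 'a \<Rightarrow> 'a \<times> 'a \<times> 'c) \<Rightarrow> 'o \<Rightarrow> 'a \<Rightarrow> 'a \<Rightarrow> 'a \<Rightarrow> 'a" where
  "Psi_arr K cm B f h g =
     cm_arr K (cm g (Id1 K B)) (h \<cdot>\<^bsub>K\<^esub> Psi_p K cm B f) (Psi_ob K cm B f) (Psi_lam K cm B f)"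

definition Psi_monad ::
  "('o, 'a, 'c) two_cat \<Rightarrow> ('a \<Rightarrow> 'a \<Rightarrow> 'a \<times> 'a \<times> 'c) \<Rightarrow> 'o \<Rightarrow> ('a, 'c) slice_monad" where
  "Psi_monad K cm B = \<lparr>
     Fun = \<lparr>
       onO = Psi_ob K cm B,
       onA = (\<lambda>(f, h, g). (Psi_ob K cm B f, Psi_arr K cm B f h g, Psi_ob K cm B g)),
       onC = (\<lambda>(f, \<alpha>, g).
         (Psi_ob K cm B f,
          cm_cell K (cm g (Id1 K B)) (Psi_arr K cm B f (Src K \<alpha>) g) (Psi_arr K cm B f (Tgt K \<alpha>) g)
            (\<alpha> \<lhd>\<^bsub>K\<^esub> Psi_p K cm B f) (Id2 K (Psi_ob K cm B f)),
          Psi_ob K cm B g)) \<rparr>,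
     Unit = (\<lambda>f. (f, cm_arr K (cm f (Id1 K B)) (Id1 K (Dom K f)) f (Id2 K f), Psi_ob K cm B f)),
     Mult = (\<lambda>f. let g = Psi_ob K cm B f in
       (Psi_ob K cm B g,
        cm_arr K (cm f (Id1 K B)) (Psi_p K cm B f \<cdot>\<^bsub>K\<^esub> Psi_p K cm B g) (Psi_ob K cm B g)
          (Psi_lam K cm B g \<bullet>\<^bsub>K\<^esub> (Psi_lam K cm B f \<lhd>\<^bsub>K\<^esub> Psi_p K cm B g)),
        g)) \<rparr>"


section \<open>Polynomials\<close>

datatype 'a poly = Poly (p1: 'a) (p2: 'a) (p3: 'a)

definition is_poly ::
  "('o, 'a, 'c) two_cat \<Rightarrow> ('a \<Rightarrow> 'a \<Rightarrow> 'a \<times> 'a) \<Rightarrow> 'o \<Rightarrow> 'o \<Rightarrow> 'a poly \<Rightarrow> bool" where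
  "is_poly K pb X Y p \<longleftrightarrow>
     p1 p \<in> Arr K \<and> p2 p \<in> Arr K \<and> p3 p \<in> Arr K \<and>
     Cod K (p1 p) = X \<and> Dom K (p1 p) = Dom K (p2 p) \<and>
     Cod K (p2 p) = Dom K (p3 p) \<and> Cod K (p3 p) = Y \<and> exponentiable K pb (p2 p)"

definition is_poly_arr :: "('o, 'a, 'c) two_cat \<Rightarrow> 'a poly \<Rightarrow> 'a \<times> 'a \<Rightarrow> 'a poly \<Rightarrow> bool" where
  "is_poly_arr K p = (\<lambda>(f0, f1) q.
     arr K f0 (Dom K (p2 p)) (Dom K (p2 q)) \<and> arr K f1 (Cod K (p2 p)) (Cod K (p2 q)) \<and>
     p1 q \<cdot>\<^bsub>K\<^esub> f0 = p1 p \<and> p3 q \<cdot>\<^bsub>K\<^esub> f1 = p3 p \<and> is_pullback K (p2 q) f1 (f0, p2 p))"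

type_synonym 'a poly_arr = "'a poly \<times> ('a \<times> 'a) \<times> 'a poly"
type_synonym ('a, 'c) poly_cell = "'a poly \<times> ('c \<times> 'c) \<times> 'a poly"

definition PolyHom ::
  "('o, 'a, 'c) two_cat \<Rightarrow> ('a \<Rightarrow> 'a \<Rightarrow> 'a \<times> 'a) \<Rightarrow> 'o \<Rightarrow> 'o
    \<Rightarrow> ('a poly, 'a poly_arr, ('a, 'c) poly_cell) two_cat" where
  "PolyHom K pb X Y = \<lparr>
     Obj = {p. is_poly K pb X Y p},
     Arr = {(p, f, q). is_poly K pb X Y p \<and> is_poly K pb X Y q \<and> is_poly_arr K p f q},
     Cell = {(p, (\<phi>0, \<phi>1), q). is_poly K pb X Y p \<and> is_poly K pb X Y q \<and>
               \<phi>0 \<in> Cell K \<and> \<phi>1 \<in> Cell K \<and>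
               is_poly_arr K p (Src K \<phi>0, Src K \<phi>1) q \<and> is_poly_arr K p (Tgt K \<phi>0, Tgt K \<phi>1) q \<and>
               p1 q \<rhd>\<^bsub>K\<^esub> \<phi>0 = Id2 K (p1 p) \<and>
               p2 q \<rhd>\<^bsub>K\<^esub> \<phi>0 = \<phi>1 \<lhd>\<^bsub>K\<^esub> p2 p \<and>
               p3 q \<rhd>\<^bsub>K\<^esub> \<phi>1 = Id2 K (p3 p)},
     Dom = (\<lambda>(p, f, q). p),
     Cod = (\<lambda>(p, f, q). q),
     Src = (\<lambda>(p, (\<phi>0, \<phi>1), q). (p, (Src K \<phi>0, Src K \<phi>1), q)),
     Tgt = (\<lambda>(p, (\<phi>0, \<phi>1), q). (p, (Tgt K \<phi>0, Tgt K \<phi>1), q)),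
     Id1 = (\<lambda>p. (p, (Id1 K (Dom K (p2 p)), Id1 K (Cod K (p2 p))), p)),
     Comp = (\<lambda>(q, (g0, g1), r) (p, (f0, f1), q'). (p, (g0 \<cdot>\<^bsub>K\<^esub> f0, g1 \<cdot>\<^bsub>K\<^esub> f1), r)),
     Id2 = (\<lambda>(p, (f0, f1), q). (p, (Id2 K f0, Id2 K f1), q)),
     VComp = (\<lambda>(p', (\<psi>0, \<psi>1), q') (p, (\<phi>0, \<phi>1), q). (p, (\<psi>0 \<bullet>\<^bsub>K\<^esub> \<phi>0, \<psi>1 \<bullet>\<^bsub>K\<^esub> \<phi>1), q)),
     HComp = (\<lambda>(q, (\<psi>0, \<psi>1), r) (p, (\<phi>0, \<phi>1), q'). (p, (\<psi>0 \<star>\<^bsub>K\<^esub> \<phi>0, \<psi>1 \<star>\<^bsub>K\<^esub> \<phi>1), r)) \<rparr>"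

text \<open>
  Spans are the polynomials whose middle map is an identity.  The bicategorical composition is
  written out for them: \<open>span_comp K pb q p\<close> is \<open>q \<circ> p\<close>, i.e. \<open>p\<close> followed by \<open>q\<close>, with apex the
  chosen pullback of the last leg of \<open>p\<close> and the first leg of \<open>q\<close>.  Arrows between spans have both
  components equal, and the common component is used below.
\<close>

definition is_span :: "('o, 'a, 'c) two_cat \<Rightarrow> 'a poly \<Rightarrow> bool" where
  "is_span K p \<longleftrightarrow> p2 p = Id1 K (Dom K (p1 p))"

definition id_span :: "('o, 'a, 'c) two_cat \<Rightarrow> 'o \<Rightarrow> 'a poly" where
  "id_span K B = Poly (Id1 K B) (Id1 K B) (Id1 K B)"

definition span_pb :: "('a \<Rightarrow> 'a \<Rightarrow> 'a \<times> 'a) \<Rightarrow> 'a poly \<Rightarrow> 'a poly \<Rightarrow> 'a \<times> 'a" where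
  "span_pb pb q p = pb (p3 p) (p1 q)"

definition span_comp ::
  "('o, 'a, 'c) two_cat \<Rightarrow> ('a \<Rightarrow> 'a \<Rightarrow> 'a \<times> 'a) \<Rightarrow> 'a poly \<Rightarrow> 'a poly \<Rightarrow> 'a poly" where
  "span_comp K pb q p = (case span_pb pb q p of (a, b) \<Rightarrow>
     Poly (p1 p \<cdot>\<^bsub>K\<^esub> a) (Id1 K (Dom K a)) (p3 q \<cdot>\<^bsub>K\<^esub> b))"

definition span_hcomp ::
  "('o, 'a, 'c) two_cat \<Rightarrow> ('a \<Rightarrow> 'a \<Rightarrow> 'a \<times> 'a) \<Rightarrow> 'a poly_arr \<Rightarrow> 'a poly_arr \<Rightarrow> 'a poly_arr" where
  "span_hcomp K pb = (\<lambda>(q, (g0, g1), q') (p, (f0, f1), p').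
     let w = pb_arr K (span_pb pb q' p')
               (f0 \<cdot>\<^bsub>K\<^esub> fst (span_pb pb q p)) (g0 \<cdot>\<^bsub>K\<^esub> snd (span_pb pb q p))
     in (span_comp K pb q p, (w, w), span_comp K pb q' p'))"

text \<open>The unitors \<open>1 \<circ> p \<cong> p\<close>, \<open>p \<circ> 1 \<cong> p\<close> and the associator \<open>(r \<circ> q) \<circ> p \<cong> r \<circ> (q \<circ> p)\<close>.\<close>

definition span_lunit ::
  "('o, 'a, 'c) two_cat \<Rightarrow> ('a \<Rightarrow> 'a \<Rightarrow> 'a \<times> 'a) \<Rightarrow> 'a poly \<Rightarrow> 'a poly_arr" where
  "span_lunit K pb p =
     (let i = id_span K (Cod K (p3 p)); w = fst (span_pb pb i p)
      in (span_comp K pb i p, (w, w), p))"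

definition span_runit ::
  "('o, 'a, 'c) two_cat \<Rightarrow> ('a \<Rightarrow> 'a \<Rightarrow> 'a \<times> 'a) \<Rightarrow> 'a poly \<Rightarrow> 'a poly_arr" where
  "span_runit K pb p =
     (let i = id_span K (Cod K (p1 p)); w = snd (span_pb pb p i)
      in (span_comp K pb p i, (w, w), p))"

definition span_assoc ::
  "('o, 'a, 'c) two_cat \<Rightarrow> ('a \<Rightarrow> 'a \<Rightarrow> 'a \<times> 'a)
    \<Rightarrow> 'a poly \<Rightarrow> 'a poly \<Rightarrow> 'a poly \<Rightarrow> 'a poly_arr" where
  "span_assoc K pb r q p =
     (let rq = span_comp K pb r q; qp = span_comp K pb q p;
          a = fst (span_pb pb rq p);
          b = fst (span_pb pb r q) \<cdot>\<^bsub>K\<^esub> snd (span_pb pb rq p);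
          c = snd (span_pb pb r q) \<cdot>\<^bsub>K\<^esub> snd (span_pb pb rq p);
          w = pb_arr K (span_pb pb r qp) (pb_arr K (span_pb pb q p) a b) c
      in (span_comp K pb rq p, (w, w), span_comp K pb r qp))"


section \<open>2-monads in the bicategory of polynomials\<close>

text \<open>A monad is a monoid in the endo-hom 2-category; \<open>is_span\<close> is required because the composition
  above is the one of spans.  Whiskerings \<open>u \<circ> M\<close> and \<open>M \<circ> u\<close> of \<open>u : 1 \<rightarrow> M\<close>, with domain \<open>1 \<circ> M\<close> resp. \<open>M \<circ> 1\<close>
  (the idempotency conditions precompose them with the inverse unitors).\<close>

definition unit_left ::
  "('o, 'a, 'c) two_cat \<Rightarrow> ('a \<Rightarrow> 'a \<Rightarrow> 'a \<times> 'a) \<Rightarrow> 'o \<Rightarrow> 'a poly \<Rightarrow> 'a poly_arr \<Rightarrow> 'a poly_arr" where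
  "unit_left K pb B M u = span_hcomp K pb u (Id1 (PolyHom K pb B B) M)"

definition unit_right ::
  "('o, 'a, 'c) two_cat \<Rightarrow> ('a \<Rightarrow> 'a \<Rightarrow> 'a \<times> 'a) \<Rightarrow> 'o \<Rightarrow> 'a poly \<Rightarrow> 'a poly_arr \<Rightarrow> 'a poly_arr" where
  "unit_right K pb B M u = span_hcomp K pb (Id1 (PolyHom K pb B B) M) u"

definition is_poly_monad ::
  "('o, 'a, 'c) two_cat \<Rightarrow> ('a \<Rightarrow> 'a \<Rightarrow> 'a \<times> 'a) \<Rightarrow> 'o \<Rightarrow> 'a poly
    \<Rightarrow> 'a poly_arr \<Rightarrow> 'a poly_arr \<Rightarrow> bool" where
  "is_poly_monad K pb B M u m \<longleftrightarrow>
     (let H = PolyHom K pb B B; MM = span_comp K pb M M; i = Id1 H M in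
      M \<in> Obj H \<and> is_span K M \<and>
      arr H u (id_span K B) M \<and> arr H m MM M \<and>
      m \<cdot>\<^bsub>H\<^esub> unit_left K pb B M u = span_lunit K pb M \<and>
      m \<cdot>\<^bsub>H\<^esub> unit_right K pb B M u = span_runit K pb M \<and>
      m \<cdot>\<^bsub>H\<^esub> span_hcomp K pb m i =
        m \<cdot>\<^bsub>H\<^esub> (span_hcomp K pb i m \<cdot>\<^bsub>H\<^esub> span_assoc K pb M M M))"

definition colax_idempotent ::
  "('o, 'a, 'c) two_cat \<Rightarrow> ('a \<Rightarrow> 'a \<Rightarrow> 'a \<times> 'a) \<Rightarrow> 'o \<Rightarrow> 'a poly
    \<Rightarrow> 'a poly_arr \<Rightarrow> 'a poly_arr \<Rightarrow> bool" where
  \<comment> \<open>\<open>u \<circ> M \<stileturn> m \<stileturn> M \<circ> u\<close>\<close>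
  "colax_idempotent K pb B M u m \<longleftrightarrow>
     (let H = PolyHom K pb B B in
      adjoint_arrs H (unit_left K pb B M u \<cdot>\<^bsub>H\<^esub> inv_arr H (span_lunit K pb M)) m \<and>
      adjoint_arrs H m (unit_right K pb B M u \<cdot>\<^bsub>H\<^esub> inv_arr H (span_runit K pb M)))"

definition lax_idempotent ::
  "('o, 'a, 'c) two_cat \<Rightarrow> ('a \<Rightarrow> 'a \<Rightarrow> 'a \<times> 'a) \<Rightarrow> 'o \<Rightarrow> 'a poly
    \<Rightarrow> 'a poly_arr \<Rightarrow> 'a poly_arr \<Rightarrow> bool" where
  \<comment> \<open>\<open>M \<circ> u \<stileturn> m \<stileturn> u \<circ> M\<close>\<close>
  "lax_idempotent K pb B M u m \<longleftrightarrow>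
     (let H = PolyHom K pb B B in
      adjoint_arrs H (unit_right K pb B M u \<cdot>\<^bsub>H\<^esub> inv_arr H (span_runit K pb M)) m \<and>
      adjoint_arrs H m (unit_left K pb B M u \<cdot>\<^bsub>H\<^esub> inv_arr H (span_lunit K pb M)))"


section \<open>The homomorphism from polynomials to slices\<close>

text \<open>
  On a span \<open>p\<close> the polynomial 2-functor is \<open>\<Sigma>\<^bsub>p3\<^esub> \<Delta>\<^bsub>p1\<^esub>\<close>.  The component at \<open>h\<close> of the
  transformation of an arrow \<open>p \<rightarrow> q\<close> is the arrow from the pullback of \<open>h\<close> along \<open>p1\<close> to the
  pullback of \<open>h\<close> along \<open>q1\<close> which lies over that arrow and is the identity on the domain of \<open>h\<close>.
\<close>

definition P_fun ::
  "('o, 'a, 'c) two_cat \<Rightarrow> ('a \<Rightarrow> 'a \<Rightarrow> 'a \<times> 'a) \<Rightarrow> 'a poly \<Rightarrow> ('a, 'c) slice_fun" where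
  "P_fun K pb p = Sigma_fun K (p3 p) \<circ>\<^sub>F Delta_fun K pb (p1 p)"

definition P_nat ::
  "('o, 'a, 'c) two_cat \<Rightarrow> ('a \<Rightarrow> 'a \<Rightarrow> 'a \<times> 'a) \<Rightarrow> 'a poly_arr \<Rightarrow> 'a \<Rightarrow> 'a \<times> 'a \<times> 'a" where
  "P_nat K pb = (\<lambda>(p, (f0, f1), q) h.
     (onO (P_fun K pb p) h,
      pb_arr K (pb (p1 q) h) (f0 \<cdot>\<^bsub>K\<^esub> fst (pb (p1 p) h)) (snd (pb (p1 p) h)),
      onO (P_fun K pb q) h))"

text \<open>The coherence isomorphisms, from the identity 2-functor to the value at the identity span of
  \<open>B\<close>, and from the composite of the values at \<open>q\<close> and \<open>p\<close> to the value at \<open>q \<circ> p\<close>.\<close>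

definition P_unit ::
  "('o, 'a, 'c) two_cat \<Rightarrow> ('a \<Rightarrow> 'a \<Rightarrow> 'a \<times> 'a) \<Rightarrow> 'o \<Rightarrow> 'a \<Rightarrow> 'a \<times> 'a \<times> 'a" where
  "P_unit K pb B h =
     (h, pb_arr K (pb (Id1 K B) h) h (Id1 K (Dom K h)), onO (P_fun K pb (id_span K B)) h)"

definition P_comp ::
  "('o, 'a, 'c) two_cat \<Rightarrow> ('a \<Rightarrow> 'a \<Rightarrow> 'a \<times> 'a) \<Rightarrow> 'a poly \<Rightarrow> 'a poly \<Rightarrow> 'a \<Rightarrow> 'a \<times> 'a \<times> 'a" where
  "P_comp K pb q p h =
     (let qp = span_comp K pb q p;
          k = onO (P_fun K pb p) h;
          a = fst (pb (p1 p) h) \<cdot>\<^bsub>K\<^esub> snd (pb (p1 q) k);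
          b = fst (pb (p1 q) k);
          z = snd (pb (p1 p) h) \<cdot>\<^bsub>K\<^esub> snd (pb (p1 q) k)
      in (onO (P_fun K pb q) k,
          pb_arr K (pb (p1 qp) h) (pb_arr K (span_pb pb q p) a b) z,
          onO (P_fun K pb qp) h))"

text \<open>The result of applying the homomorphism to the 2-monad \<open>(M, u, m)\<close> on \<open>B\<close>.\<close>

definition P_monad ::
  "('o, 'a, 'c) two_cat \<Rightarrow> ('a \<Rightarrow> 'a \<Rightarrow> 'a \<times> 'a) \<Rightarrow> 'o \<Rightarrow> 'a poly
    \<Rightarrow> 'a poly_arr \<Rightarrow> 'a poly_arr \<Rightarrow> ('a, 'c) slice_monad" where
  "P_monad K pb B M u m = \<lparr>
     Fun = P_fun K pb M,
     Unit = (\<lambda>h. P_nat K pb u h \<cdot>\<^bsub>slice K B\<^esub> P_unit K pb B h),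
     Mult = (\<lambda>h. P_nat K pb m h \<cdot>\<^bsub>slice K B\<^esub> P_comp K pb M M h) \<rparr>"

end

theory Submission
  imports Defs
begin

text \<open>
  Write \<open>E\<close> for the cotensor of \<open>B\<close> with \<open>[1]\<close>.  An arrow \<open>X \<rightarrow> E\<close> is a 2-cell between arrows
  \<open>X \<rightarrow> B\<close>, so \<open>E\<close> with the projections \<open>d1\<close> and \<open>d0\<close> is the object of arrows of an internal category
  with object of objects \<open>B\<close>: the arrow \<open>u0 : B \<rightarrow> E\<close> that classifies identity 2-cells gives the
  identities, and the arrow \<open>m0 : P \<rightarrow> E\<close> from the object \<open>P\<close> of composable pairs that classifies
  vertical composites gives the composition.  An internal category is a monoid in spans, and its
  axioms are those of vertical composition, checked on the 2-cells that the arrows into \<open>E\<close> classify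
  (\<open>poly_monad\<close>).

  The monoid is colax idempotent because of comparisons that exist in every category: for \<open>\<beta>\<close>
  followed by \<open>\<alpha>\<close> there are morphisms of composable pairs \<open>(\<alpha>\<beta>, 1) \<rightarrow> (\<alpha>, \<beta>) \<rightarrow> (1, \<alpha>\<beta>)\<close>, natural
  and with identities on both ends, which are the counit of \<open>u \<circ> M \<stileturn> m\<close> and the unit of
  \<open>m \<stileturn> M \<circ> u\<close>; the other two structure 2-cells are identities, and the triangle identities say that
  the comparisons become trivial when \<open>\<beta>\<close>, respectively \<open>\<alpha>\<close>, is an identity
  (\<open>L_adjoint\<close>, \<open>R_adjoint\<close>).

  The 2-functor of the span \<open>(d0, d1)\<close> sends \<open>f\<close> to the pullback of \<open>f\<close> along \<open>d0\<close>, viewed over \<open>B\<close> by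
  \<open>d1\<close>; this is the comma object of the identity and \<open>f\<close>, with the restriction of the 2-cell of \<open>E\<close>
  (\<open>comma_of_pullback\<close>).  Every datum of \<open>\<Phi>\<close> is given by equations between composites with the
  projections of comma objects, and so are the data of the value of the monoid.  The locale
  \<open>comma_monad\<close> collects these equations.  They alone imply all laws of a 2-monad
  (\<open>two_monad\<close>), and two solutions are isomorphic through the comparison of their comma objects
  (\<open>iso\<close>).  Hence the first part: both 2-monads are solutions.

  The second part is the first one for the 2-category \<open>co K\<close> with reversed 2-cells.  There the comma
  object of \<open>f\<close> and \<open>g\<close> is the one of \<open>g\<close> and \<open>f\<close> in \<open>K\<close>, so \<open>d1\<close> and \<open>d0\<close> change places, \<open>\<Psi>\<close> takes the
  place of \<open>\<Phi>\<close>, and left and right adjoints are exchanged.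
\<close>

section \<open>Whiskering in a 2-category\<close>

context two_category
begin

lemma comp_typ [simp]:
  assumes "f \<in> Arr K" "g \<in> Arr K" "Dom K g = Cod K f"
  shows "g \<cdot> f \<in> Arr K" "Dom K (g \<cdot> f) = Dom K f" "Cod K (g \<cdot> f) = Cod K g"
  using Comp_arr[of f "Dom K f" "Cod K f" g "Cod K g"] assms by (auto simp: arr_def)

lemma comp_assoc [simp]:
  "\<lbrakk>f \<in> Arr K; g \<in> Arr K; h \<in> Arr K; Dom K g = Cod K f; Dom K h = Cod K g\<rbrakk>
    \<Longrightarrow> (h \<cdot> g) \<cdot> f = h \<cdot> (g \<cdot> f)"
  using Comp_assoc[of f "Dom K f" "Cod K f" g "Cod K g" h "Cod K h"] by (auto simp: arr_def)

lemma id1_typ [simp]: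
  assumes "A \<in> Obj K"
  shows "Id1 K A \<in> Arr K" "Dom K (Id1 K A) = A" "Cod K (Id1 K A) = A"
  using Id1_arr[OF assms] by (auto simp: arr_def)

lemma dom_cod_obj [simp]: "f \<in> Arr K \<Longrightarrow> Dom K f \<in> Obj K" "f \<in> Arr K \<Longrightarrow> Cod K f \<in> Obj K"
  by (auto simp: Dom_Obj Cod_Obj)

lemma comp_id1 [simp]:
  "f \<in> Arr K \<Longrightarrow> Cod K f = B \<Longrightarrow> Id1 K B \<cdot> f = f"
  "f \<in> Arr K \<Longrightarrow> Dom K f = A \<Longrightarrow> f \<cdot> Id1 K A = f"
  using Comp_Id1_left[of f] Comp_Id1_right[of f] by (auto simp: arr_def)

lemma src_tgt [simp]:
  assumes "\<alpha> \<in> Cell K"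
  shows "Src K \<alpha> \<in> Arr K" "Tgt K \<alpha> \<in> Arr K"
    "Dom K (Tgt K \<alpha>) = Dom K (Src K \<alpha>)" "Cod K (Tgt K \<alpha>) = Cod K (Src K \<alpha>)"
  using assms by (auto simp: Src_Arr Tgt_Arr Dom_parallel Cod_parallel)

lemma cellD:
  assumes "cell K \<alpha> f g"
  shows "\<alpha> \<in> Cell K" "Src K \<alpha> = f" "Tgt K \<alpha> = g" "f \<in> Arr K" "g \<in> Arr K"
    "Dom K g = Dom K f" "Cod K g = Cod K f"
  using assms src_tgt[of \<alpha>] by (auto simp: cell_def)

lemma id2_typ [simp]:
  assumes "f \<in> Arr K"
  shows "Id2 K f \<in> Cell K" "Src K (Id2 K f) = f" "Tgt K (Id2 K f) = f"
  using Id2_cell[OF assms] by (auto simp: cell_def)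

lemma vcomp_typ [simp]:
  assumes "\<alpha> \<in> Cell K" "\<beta> \<in> Cell K" "Src K \<beta> = Tgt K \<alpha>"
  shows "\<beta> \<bullet> \<alpha> \<in> Cell K" "Src K (\<beta> \<bullet> \<alpha>) = Src K \<alpha>" "Tgt K (\<beta> \<bullet> \<alpha>) = Tgt K \<beta>"
  using VComp_cell[of \<alpha> "Src K \<alpha>" "Tgt K \<alpha>" \<beta> "Tgt K \<beta>"] assms by (auto simp: cell_def)

lemma vcomp_id2 [simp]:
  "\<alpha> \<in> Cell K \<Longrightarrow> Tgt K \<alpha> = g \<Longrightarrow> Id2 K g \<bullet> \<alpha> = \<alpha>"
  "\<alpha> \<in> Cell K \<Longrightarrow> Src K \<alpha> = f \<Longrightarrow> \<alpha> \<bullet> Id2 K f = \<alpha>"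
  using VComp_Id2_left[of \<alpha>] VComp_Id2_right[of \<alpha>] by (auto simp: cell_def)

lemma vcomp_assoc [simp]:
  "\<lbrakk>\<alpha> \<in> Cell K; \<beta> \<in> Cell K; \<gamma> \<in> Cell K; Src K \<beta> = Tgt K \<alpha>; Src K \<gamma> = Tgt K \<beta>\<rbrakk>
    \<Longrightarrow> (\<gamma> \<bullet> \<beta>) \<bullet> \<alpha> = \<gamma> \<bullet> (\<beta> \<bullet> \<alpha>)"
  using VComp_assoc[of \<alpha> "Src K \<alpha>" "Tgt K \<alpha>" \<beta> "Tgt K \<beta>" \<gamma> "Tgt K \<gamma>"] by (auto simp: cell_def)

lemma hcomp_typ [simp]:
  assumes "\<alpha> \<in> Cell K" "\<beta> \<in> Cell K" "Dom K (Src K \<beta>) = Cod K (Src K \<alpha>)"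
  shows "\<beta> \<star> \<alpha> \<in> Cell K" "Src K (\<beta> \<star> \<alpha>) = Src K \<beta> \<cdot> Src K \<alpha>"
    "Tgt K (\<beta> \<star> \<alpha>) = Tgt K \<beta> \<cdot> Tgt K \<alpha>"
  using HComp_cell[of \<alpha> "Src K \<alpha>" "Tgt K \<alpha>" \<beta> "Src K \<beta>" "Tgt K \<beta>"
      "Dom K (Src K \<alpha>)" "Cod K (Src K \<alpha>)" "Cod K (Src K \<beta>)"] assms
  by (auto simp: cell_def arr_def)

lemma lwhisk_typ [simp]:
  assumes "\<alpha> \<in> Cell K" "g \<in> Arr K" "Dom K g = Cod K (Src K \<alpha>)"
  shows "g \<rhd> \<alpha> \<in> Cell K" "Src K (g \<rhd> \<alpha>) = g \<cdot> Src K \<alpha>" "Tgt K (g \<rhd> \<alpha>) = g \<cdot> Tgt K \<alpha>"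
  using assms by (auto simp: lwhisk_def)

lemma rwhisk_typ [simp]:
  assumes "\<alpha> \<in> Cell K" "f \<in> Arr K" "Dom K (Src K \<alpha>) = Cod K f"
  shows "\<alpha> \<lhd> f \<in> Cell K" "Src K (\<alpha> \<lhd> f) = Src K \<alpha> \<cdot> f" "Tgt K (\<alpha> \<lhd> f) = Tgt K \<alpha> \<cdot> f"
  using assms by (auto simp: rwhisk_def)

lemma hcomp_assoc:
  "\<lbrakk>\<alpha> \<in> Cell K; \<beta> \<in> Cell K; \<gamma> \<in> Cell K;
    Dom K (Src K \<beta>) = Cod K (Src K \<alpha>); Dom K (Src K \<gamma>) = Cod K (Src K \<beta>)\<rbrakk>
    \<Longrightarrow> (\<gamma> \<star> \<beta>) \<star> \<alpha> = \<gamma> \<star> (\<beta> \<star> \<alpha>)"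
  using HComp_assoc[of \<alpha> "Src K \<alpha>" "Tgt K \<alpha>" \<beta> "Src K \<beta>" "Tgt K \<beta>" \<gamma> "Src K \<gamma>" "Tgt K \<gamma>"]
  by (auto simp: cell_def arr_def)

lemma id2_hcomp_id2:
  "f \<in> Arr K \<Longrightarrow> g \<in> Arr K \<Longrightarrow> Dom K g = Cod K f \<Longrightarrow> Id2 K g \<star> Id2 K f = Id2 K (g \<cdot> f)"
  using HComp_Id2[of f "Dom K f" "Cod K f" g "Cod K g"] by (auto simp: arr_def)

lemma interchange':
  "\<lbrakk>\<alpha> \<in> Cell K; \<alpha>' \<in> Cell K; \<beta> \<in> Cell K; \<beta>' \<in> Cell K; Src K \<alpha>' = Tgt K \<alpha>; Src K \<beta>' = Tgt K \<beta>;
    Dom K (Src K \<beta>) = Cod K (Src K \<alpha>)\<rbrakk>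
    \<Longrightarrow> (\<beta>' \<bullet> \<beta>) \<star> (\<alpha>' \<bullet> \<alpha>) = (\<beta>' \<star> \<alpha>') \<bullet> (\<beta> \<star> \<alpha>)"
  using interchange[of \<alpha> "Src K \<alpha>" "Tgt K \<alpha>" \<alpha>' "Tgt K \<alpha>'" \<beta> "Src K \<beta>" "Tgt K \<beta>" \<beta>' "Tgt K \<beta>'"]
  by (auto simp: cell_def arr_def)

lemma whisk_id2 [simp]:
  "f \<in> Arr K \<Longrightarrow> g \<in> Arr K \<Longrightarrow> Dom K g = Cod K f \<Longrightarrow> g \<rhd> Id2 K f = Id2 K (g \<cdot> f)"
  "f \<in> Arr K \<Longrightarrow> g \<in> Arr K \<Longrightarrow> Dom K g = Cod K f \<Longrightarrow> Id2 K g \<lhd> f = Id2 K (g \<cdot> f)"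
  by (auto simp: lwhisk_def rwhisk_def id2_hcomp_id2)

lemma whisk_id1 [simp]:
  "\<alpha> \<in> Cell K \<Longrightarrow> Cod K (Src K \<alpha>) = B \<Longrightarrow> Id1 K B \<rhd> \<alpha> = \<alpha>"
  "\<alpha> \<in> Cell K \<Longrightarrow> Dom K (Src K \<alpha>) = A \<Longrightarrow> \<alpha> \<lhd> Id1 K A = \<alpha>"
  using HComp_Id_left[of \<alpha> "Src K \<alpha>"] HComp_Id_right[of \<alpha> "Src K \<alpha>"]
  by (auto simp: lwhisk_def rwhisk_def cell_def arr_def)

lemma lwhisk_comp:
  "\<lbrakk>\<alpha> \<in> Cell K; f \<in> Arr K; g \<in> Arr K; Dom K f = Cod K (Src K \<alpha>); Dom K g = Cod K f\<rbrakk>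
    \<Longrightarrow> (g \<cdot> f) \<rhd> \<alpha> = g \<rhd> (f \<rhd> \<alpha>)"
  by (simp add: lwhisk_def hcomp_assoc flip: id2_hcomp_id2)

lemma rwhisk_comp:
  "\<lbrakk>\<alpha> \<in> Cell K; f \<in> Arr K; g \<in> Arr K; Dom K (Src K \<alpha>) = Cod K g; Dom K g = Cod K f\<rbrakk>
    \<Longrightarrow> \<alpha> \<lhd> (g \<cdot> f) = (\<alpha> \<lhd> g) \<lhd> f"
  by (simp add: rwhisk_def hcomp_assoc flip: id2_hcomp_id2)

lemma lwhisk_rwhisk:
  "\<lbrakk>\<alpha> \<in> Cell K; f \<in> Arr K; g \<in> Arr K; Dom K (Src K \<alpha>) = Cod K f; Dom K g = Cod K (Src K \<alpha>)\<rbrakk>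
    \<Longrightarrow> g \<rhd> (\<alpha> \<lhd> f) = (g \<rhd> \<alpha>) \<lhd> f"
  by (simp add: rwhisk_def lwhisk_def hcomp_assoc)

lemma lwhisk_vcomp:
  "\<lbrakk>\<alpha> \<in> Cell K; \<beta> \<in> Cell K; Src K \<beta> = Tgt K \<alpha>; g \<in> Arr K; Dom K g = Cod K (Src K \<alpha>)\<rbrakk>
    \<Longrightarrow> g \<rhd> (\<beta> \<bullet> \<alpha>) = (g \<rhd> \<beta>) \<bullet> (g \<rhd> \<alpha>)"
  using interchange'[of \<alpha> \<beta> "Id2 K g" "Id2 K g"] by (simp add: lwhisk_def)

lemma rwhisk_vcomp:
  "\<lbrakk>\<alpha> \<in> Cell K; \<beta> \<in> Cell K; Src K \<beta> = Tgt K \<alpha>; f \<in> Arr K; Dom K (Src K \<alpha>) = Cod K f\<rbrakk>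
    \<Longrightarrow> (\<beta> \<bullet> \<alpha>) \<lhd> f = (\<beta> \<lhd> f) \<bullet> (\<alpha> \<lhd> f)"
  using interchange'[of "Id2 K f" "Id2 K f" \<alpha> \<beta>] by (simp add: rwhisk_def)

lemma lwhisk_hcomp:
  "\<lbrakk>\<alpha> \<in> Cell K; \<beta> \<in> Cell K; g \<in> Arr K; Dom K (Src K \<beta>) = Cod K (Src K \<alpha>);
    Dom K g = Cod K (Src K \<beta>)\<rbrakk> \<Longrightarrow> g \<rhd> (\<beta> \<star> \<alpha>) = (g \<rhd> \<beta>) \<star> \<alpha>"
  by (simp add: lwhisk_def hcomp_assoc)

lemma rwhisk_hcomp:
  "\<lbrakk>\<alpha> \<in> Cell K; \<beta> \<in> Cell K; f \<in> Arr K; Dom K (Src K \<beta>) = Cod K (Src K \<alpha>);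
    Dom K (Src K \<alpha>) = Cod K f\<rbrakk> \<Longrightarrow> (\<beta> \<star> \<alpha>) \<lhd> f = \<beta> \<star> (\<alpha> \<lhd> f)"
  by (simp add: rwhisk_def hcomp_assoc)

lemma hcomp_middle:
  "\<lbrakk>\<alpha> \<in> Cell K; \<beta> \<in> Cell K; f \<in> Arr K; Dom K (Src K \<beta>) = Cod K f; Dom K f = Cod K (Src K \<alpha>)\<rbrakk>
    \<Longrightarrow> (\<beta> \<lhd> f) \<star> \<alpha> = \<beta> \<star> (f \<rhd> \<alpha>)"
  by (simp add: rwhisk_def lwhisk_def hcomp_assoc)

lemma id2_hcomp: "Id2 K g \<star> \<alpha> = g \<rhd> \<alpha>"
  by (simp add: lwhisk_def)

lemma hcomp_exchange:
  assumes "\<alpha> \<in> Cell K" "\<beta> \<in> Cell K" "Dom K (Src K \<beta>) = Cod K (Src K \<alpha>)"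
  shows "(\<beta> \<lhd> Tgt K \<alpha>) \<bullet> (Src K \<beta> \<rhd> \<alpha>) = \<beta> \<star> \<alpha>"
    "(Tgt K \<beta> \<rhd> \<alpha>) \<bullet> (\<beta> \<lhd> Src K \<alpha>) = \<beta> \<star> \<alpha>"
  using interchange'[of \<alpha> "Id2 K (Tgt K \<alpha>)" "Id2 K (Src K \<beta>)" \<beta>]
    interchange'[of "Id2 K (Src K \<alpha>)" \<alpha> \<beta> "Id2 K (Tgt K \<beta>)"] assms
  by (simp_all add: lwhisk_def rwhisk_def)

end

section \<open>Universal properties\<close>

context two_category
begin

lemma commaD:
  assumes "is_comma K f g (p, q, l)"
  shows "f \<in> Arr K" "g \<in> Arr K" "p \<in> Arr K" "q \<in> Arr K" "Cod K g = Cod K f" "Dom K q = Dom K p"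
    "Cod K p = Dom K f" "Cod K q = Dom K g" "l \<in> Cell K" "Src K l = f \<cdot> p" "Tgt K l = g \<cdot> q"
  using assms by (auto simp: is_comma_def cell_def)

lemma comma_arr_ex1:
  assumes "is_comma K f g (p, q, l)" "arr K u X (Dom K f)" "arr K v X (Dom K g)"
    "cell K \<sigma> (f \<cdot> u) (g \<cdot> v)"
  shows "\<exists>!w. arr K w X (Dom K p) \<and> p \<cdot> w = u \<and> q \<cdot> w = v \<and> l \<lhd> w = \<sigma>"
  using assms unfolding is_comma_def prod.case by blast

lemma comma_cell_ex1:
  assumes "is_comma K f g (p, q, l)" "arr K h X (Dom K p)" "arr K k X (Dom K p)"
    "cell K \<alpha> (p \<cdot> h) (p \<cdot> k)" "cell K \<beta> (q \<cdot> h) (q \<cdot> k)"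
    "(g \<rhd> \<beta>) \<bullet> (l \<lhd> h) = (l \<lhd> k) \<bullet> (f \<rhd> \<alpha>)"
  shows "\<exists>!\<gamma>. cell K \<gamma> h k \<and> p \<rhd> \<gamma> = \<alpha> \<and> q \<rhd> \<gamma> = \<beta>"
  using assms unfolding is_comma_def prod.case by blast

lemma comma_arr_eqI:
  assumes "is_comma K f g (p, q, l)" "arr K w X (Dom K p)" "arr K w' X (Dom K p)"
    "p \<cdot> w = p \<cdot> w'" "q \<cdot> w = q \<cdot> w'" "l \<lhd> w = l \<lhd> w'"
  shows "w = w'"
proof -
  note D = commaD[OF assms(1)]
  have "\<exists>!x. arr K x X (Dom K p) \<and> p \<cdot> x = p \<cdot> w \<and> q \<cdot> x = q \<cdot> w \<and> l \<lhd> x = l \<lhd> w"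
    using D assms(2) by (intro comma_arr_ex1[OF assms(1)]) (auto simp: arr_def cell_def)
  then show ?thesis using assms by metis
qed

text \<open>The compatibility condition of the 2-dimensional universal property holds for every \<open>\<gamma>\<close>, since both
  sides are the horizontal composite of \<open>l\<close> and \<open>\<gamma>\<close>; the cancellation therefore needs the two
  projections only.\<close>

lemma comma_cell_eqI:
  assumes "is_comma K f g (p, q, l)" "cell K \<gamma> h k" "cell K \<gamma>' h k"
    "Cod K h = Dom K p" "p \<rhd> \<gamma> = p \<rhd> \<gamma>'" "q \<rhd> \<gamma> = q \<rhd> \<gamma>'"
  shows "\<gamma> = \<gamma>'"
proof -
  note D = commaD[OF assms(1)]
  note G = cellD[OF assms(2)]
  have "(g \<rhd> (q \<rhd> \<gamma>)) \<bullet> (l \<lhd> h) = (l \<lhd> k) \<bullet> (f \<rhd> (p \<rhd> \<gamma>))"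
    using hcomp_exchange[of \<gamma> l] D G assms(4) by (simp flip: lwhisk_comp)
  then have "\<exists>!x. cell K x h k \<and> p \<rhd> x = p \<rhd> \<gamma> \<and> q \<rhd> x = q \<rhd> \<gamma>"
    using D G assms(4)
    by (intro comma_cell_ex1[OF assms(1), where X = "Dom K h"]) (auto simp: arr_def cell_def)
  then show ?thesis using assms by metis
qed

lemma cm_arr_eq:
  assumes "is_comma K f g (p, q, l)" "arr K u X (Dom K f)" "arr K v X (Dom K g)"
    "cell K \<sigma> (f \<cdot> u) (g \<cdot> v)"
  shows "arr K (cm_arr K (p, q, l) u v \<sigma>) X (Dom K p)"
    "p \<cdot> cm_arr K (p, q, l) u v \<sigma> = u" "q \<cdot> cm_arr K (p, q, l) u v \<sigma> = v"
    "l \<lhd> cm_arr K (p, q, l) u v \<sigma> = \<sigma>"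
proof -
  have "Dom K u = X" using assms(2) by (simp add: arr_def)
  then show "arr K (cm_arr K (p, q, l) u v \<sigma>) X (Dom K p)"
    "p \<cdot> cm_arr K (p, q, l) u v \<sigma> = u" "q \<cdot> cm_arr K (p, q, l) u v \<sigma> = v"
    "l \<lhd> cm_arr K (p, q, l) u v \<sigma> = \<sigma>"
    using theI'[OF comma_arr_ex1[OF assms]] by (auto simp: cm_arr_def)
qed

lemma cm_cell_eq:
  assumes "is_comma K f g (p, q, l)" "arr K h X (Dom K p)" "arr K k X (Dom K p)"
    "cell K \<alpha> (p \<cdot> h) (p \<cdot> k)" "cell K \<beta> (q \<cdot> h) (q \<cdot> k)"
    "(g \<rhd> \<beta>) \<bullet> (l \<lhd> h) = (l \<lhd> k) \<bullet> (f \<rhd> \<alpha>)"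
  shows "cell K (cm_cell K (p, q, l) h k \<alpha> \<beta>) h k"
    "p \<rhd> cm_cell K (p, q, l) h k \<alpha> \<beta> = \<alpha>" "q \<rhd> cm_cell K (p, q, l) h k \<alpha> \<beta> = \<beta>"
  using theI'[OF comma_cell_ex1[OF assms]] by (auto simp: cm_cell_def)

lemma pullbackD:
  assumes "is_pullback K f g (p, q)"
  shows "f \<in> Arr K" "g \<in> Arr K" "p \<in> Arr K" "q \<in> Arr K" "Cod K g = Cod K f" "Dom K q = Dom K p"
    "Cod K p = Dom K f" "Cod K q = Dom K g" "f \<cdot> p = g \<cdot> q"
  using assms by (auto simp: is_pullback_def)

lemma pullback_arr_ex1:
  assumes "is_pullback K f g (p, q)" "arr K u X (Dom K f)" "arr K v X (Dom K g)" "f \<cdot> u = g \<cdot> v"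
  shows "\<exists>!w. arr K w X (Dom K p) \<and> p \<cdot> w = u \<and> q \<cdot> w = v"
  using assms unfolding is_pullback_def prod.case by blast

lemma pullback_cell_ex1:
  assumes "is_pullback K f g (p, q)" "arr K h X (Dom K p)" "arr K k X (Dom K p)"
    "cell K \<alpha> (p \<cdot> h) (p \<cdot> k)" "cell K \<beta> (q \<cdot> h) (q \<cdot> k)" "f \<rhd> \<alpha> = g \<rhd> \<beta>"
  shows "\<exists>!\<gamma>. cell K \<gamma> h k \<and> p \<rhd> \<gamma> = \<alpha> \<and> q \<rhd> \<gamma> = \<beta>"
  using assms unfolding is_pullback_def prod.case by blast

lemma pullback_arr_eqI:
  assumes "is_pullback K f g (p, q)" "arr K w X (Dom K p)" "arr K w' X (Dom K p)"
    "p \<cdot> w = p \<cdot> w'" "q \<cdot> w = q \<cdot> w'"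
  shows "w = w'"
proof -
  note D = pullbackD[OF assms(1)]
  have "f \<cdot> (p \<cdot> w) = g \<cdot> (q \<cdot> w)"
    using D assms(2) by (simp add: arr_def flip: comp_assoc)
  then have "\<exists>!x. arr K x X (Dom K p) \<and> p \<cdot> x = p \<cdot> w \<and> q \<cdot> x = q \<cdot> w"
    using D assms(2) by (intro pullback_arr_ex1[OF assms(1)]) (auto simp: arr_def)
  then show ?thesis using assms by metis
qed

lemma pullback_cell_eqI:
  assumes "is_pullback K f g (p, q)" "cell K \<gamma> h k" "cell K \<gamma>' h k"
    "Cod K h = Dom K p" "p \<rhd> \<gamma> = p \<rhd> \<gamma>'" "q \<rhd> \<gamma> = q \<rhd> \<gamma>'"
  shows "\<gamma> = \<gamma>'"
proof -
  note D = pullbackD[OF assms(1)]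
  note G = cellD[OF assms(2)]
  have "f \<rhd> (p \<rhd> \<gamma>) = g \<rhd> (q \<rhd> \<gamma>)"
    using D G assms(4) by (simp flip: lwhisk_comp)
  then have "\<exists>!x. cell K x h k \<and> p \<rhd> x = p \<rhd> \<gamma> \<and> q \<rhd> x = q \<rhd> \<gamma>"
    using D G assms(4)
    by (intro pullback_cell_ex1[OF assms(1), where X = "Dom K h"]) (auto simp: arr_def cell_def)
  then show ?thesis using assms by metis
qed

lemma pb_arr_eq:
  assumes "is_pullback K f g (p, q)" "arr K u X (Dom K f)" "arr K v X (Dom K g)" "f \<cdot> u = g \<cdot> v"
  shows "arr K (pb_arr K (p, q) u v) X (Dom K p)"
    "p \<cdot> pb_arr K (p, q) u v = u" "q \<cdot> pb_arr K (p, q) u v = v"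
proof -
  have "Dom K u = X" using assms(2) by (simp add: arr_def)
  then show "arr K (pb_arr K (p, q) u v) X (Dom K p)"
    "p \<cdot> pb_arr K (p, q) u v = u" "q \<cdot> pb_arr K (p, q) u v = v"
    using theI'[OF pullback_arr_ex1[OF assms]] by (auto simp: pb_arr_def)
qed

lemma pb_cell_eq:
  assumes "is_pullback K f g (p, q)" "arr K h X (Dom K p)" "arr K k X (Dom K p)"
    "cell K \<alpha> (p \<cdot> h) (p \<cdot> k)" "cell K \<beta> (q \<cdot> h) (q \<cdot> k)" "f \<rhd> \<alpha> = g \<rhd> \<beta>"
  shows "cell K (pb_cell K (p, q) h k \<alpha> \<beta>) h k"
    "p \<rhd> pb_cell K (p, q) h k \<alpha> \<beta> = \<alpha>" "q \<rhd> pb_cell K (p, q) h k \<alpha> \<beta> = \<beta>"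
  using theI'[OF pullback_cell_ex1[OF assms]] by (auto simp: pb_cell_def)

end

section \<open>Arrows and 2-cells over an object\<close>

lemma slice_sel [simp]:
  "Obj (slice K B) = {f \<in> Arr K. Cod K f = B}"
  "Dom (slice K B) (f, h, g) = f" "Cod (slice K B) (f, h, g) = g"
  "Src (slice K B) (f, \<alpha>, g) = (f, Src K \<alpha>, g)" "Tgt (slice K B) (f, \<alpha>, g) = (f, Tgt K \<alpha>, g)"
  "Id1 (slice K B) f = (f, Id1 K (Dom K f), f)"
  "Comp (slice K B) (g, k, e) (f, h, g') = (f, k \<cdot>\<^bsub>K\<^esub> h, e)"
  "Id2 (slice K B) (f, h, g) = (f, Id2 K h, g)"
  "VComp (slice K B) (g, \<beta>, e) (f, \<alpha>, g') = (f, \<beta> \<bullet>\<^bsub>K\<^esub> \<alpha>, g')"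
  "HComp (slice K B) (g, \<beta>, e) (f, \<alpha>, g') = (f, \<beta> \<star>\<^bsub>K\<^esub> \<alpha>, e)"
  by (simp_all add: slice_def)

lemma slice_whisk [simp]:
  "(g, k, e) \<rhd>\<^bsub>slice K B\<^esub> (f, \<alpha>, g') = (f, k \<rhd>\<^bsub>K\<^esub> \<alpha>, e)"
  "(g, \<alpha>, e) \<lhd>\<^bsub>slice K B\<^esub> (f, h, g') = (f, \<alpha> \<lhd>\<^bsub>K\<^esub> h, e)"
  by (simp_all add: lwhisk_def rwhisk_def)

definition over :: "('o, 'a, 'c) two_cat \<Rightarrow> 'o \<Rightarrow> 'a \<Rightarrow> 'a \<Rightarrow> 'a \<Rightarrow> bool" where
  "over K B f h g \<longleftrightarrow> f \<in> Arr K \<and> Cod K f = B \<and> g \<in> Arr K \<and> Cod K g = B \<and>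
     h \<in> Arr K \<and> Dom K h = Dom K f \<and> Cod K h = Dom K g \<and> g \<cdot>\<^bsub>K\<^esub> h = f"

definition over_cell :: "('o, 'a, 'c) two_cat \<Rightarrow> 'o \<Rightarrow> 'a \<Rightarrow> 'c \<Rightarrow> 'a \<Rightarrow> bool" where
  "over_cell K B f \<alpha> g \<longleftrightarrow> \<alpha> \<in> Cell K \<and> over K B f (Src K \<alpha>) g \<and> over K B f (Tgt K \<alpha>) g \<and>
     g \<rhd>\<^bsub>K\<^esub> \<alpha> = Id2 K f"

lemma arr_slice_iff:
  "arr (slice K B) x f g \<longleftrightarrow> (\<exists>h. x = (f, h, g) \<and> over K B f h g)"
  by (cases x) (auto simp: arr_def over_def slice_def)

lemma slice_Arr_iff: "(f, h, g) \<in> Arr (slice K B) \<longleftrightarrow> over K B f h g"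
  by (auto simp: arr_def over_def slice_def)

lemma (in two_category) slice_Cell_iff: "(f, \<alpha>, g) \<in> Cell (slice K B) \<longleftrightarrow> over_cell K B f \<alpha> g"
  by (cases "\<alpha> \<in> Cell K") (simp_all add: arr_def over_def over_cell_def slice_def, metis)

lemma (in two_category) cell_slice_iff:
  "cell (slice K B) x y z \<longleftrightarrow>
    (\<exists>f \<alpha> g. x = (f, \<alpha>, g) \<and> y = (f, Src K \<alpha>, g) \<and> z = (f, Tgt K \<alpha>, g) \<and> over_cell K B f \<alpha> g)"
  by (cases x) (auto simp: cell_def slice_Cell_iff)

context two_category
begin

lemma overD:
  assumes "over K B f h g"
  shows "f \<in> Arr K" "Cod K f = B" "g \<in> Arr K" "Cod K g = B" "h \<in> Arr K" "Dom K h = Dom K f"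
    "Cod K h = Dom K g" "g \<cdot> h = f"
  using assms by (auto simp: over_def)

lemma over_cellD:
  assumes "over_cell K B f \<alpha> g"
  shows "\<alpha> \<in> Cell K" "over K B f (Src K \<alpha>) g" "over K B f (Tgt K \<alpha>) g" "g \<rhd> \<alpha> = Id2 K f"
    "Dom K (Src K \<alpha>) = Dom K f" "Cod K (Src K \<alpha>) = Dom K g"
  using assms by (simp_all add: over_cell_def over_def)

lemma over_comp:
  assumes "over K B f h g" "over K B g k e"
  shows "over K B f (k \<cdot> h) e"
  using assms by (simp add: over_def flip: comp_assoc)

lemma over_cell_vcomp:
  assumes "over_cell K B f \<alpha> g" "over_cell K B f \<beta> g" "Src K \<beta> = Tgt K \<alpha>"
  shows "over_cell K B f (\<beta> \<bullet> \<alpha>) g"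
  using assms by (simp add: over_cell_def over_def lwhisk_vcomp)

lemma over_cell_hcomp:
  assumes "over_cell K B f \<alpha> g" "over_cell K B g \<beta> e"
  shows "over_cell K B f (\<beta> \<star> \<alpha>) e"
proof -
  have "e \<rhd> (\<beta> \<star> \<alpha>) = Id2 K f"
    using assms by (simp add: over_cell_def over_def lwhisk_hcomp id2_hcomp)
  then show ?thesis
    using assms over_comp[of B f "Src K \<alpha>" g "Src K \<beta>" e]
      over_comp[of B f "Tgt K \<alpha>" g "Tgt K \<beta>" e]
    by (simp add: over_cell_def over_def)
qed

lemma over_cell_id2: "over K B f h g \<Longrightarrow> over_cell K B f (Id2 K h) g"
  by (simp add: over_cell_def over_def)

lemma over_id1: "f \<in> Arr K \<Longrightarrow> Cod K f = B \<Longrightarrow> over K B f (Id1 K (Dom K f)) f"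
  by (auto simp: over_def)

end

section \<open>2-monads on a slice given by comma objects\<close>

text \<open>The equations that characterize the data of \<open>\<Phi>\<close> in terms of the projections of comma objects
  \<open>Phi f\<close>, \<open>q f\<close> with 2-cell \<open>lam f\<close>, without fixing a construction of these comma objects.  This
  makes the locale apply to three families: chosen comma objects, pullbacks along \<open>d0\<close>, and the comma
  objects of \<open>\<Psi>\<close> after reversing the 2-cells.\<close>

locale comma_monad = two_category K for K :: "('o, 'a, 'c) two_cat" (structure) +
  fixes B :: 'o and Phi q :: "'a \<Rightarrow> 'a" and lam :: "'a \<Rightarrow> 'c"
    and act :: "'a \<Rightarrow> 'a \<Rightarrow> 'a \<Rightarrow> 'a" and act2 :: "'a \<Rightarrow> 'c \<Rightarrow> 'a \<Rightarrow> 'c"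
    and e m :: "'a \<Rightarrow> 'a"
  assumes comma:
    "\<lbrakk>f \<in> Arr K; Cod K f = B\<rbrakk> \<Longrightarrow> is_comma K (Id1 K B) f (Phi f, q f, lam f)"
    and act: "over K B f h g \<Longrightarrow> arr K (act f h g) (Dom K (Phi f)) (Dom K (Phi g)) \<and>
      Phi g \<cdot> act f h g = Phi f \<and> q g \<cdot> act f h g = h \<cdot> q f \<and> lam g \<lhd> act f h g = lam f"
    and act2: "over_cell K B f \<alpha> g \<Longrightarrow>
      cell K (act2 f \<alpha> g) (act f (Src K \<alpha>) g) (act f (Tgt K \<alpha>) g) \<and>
      Phi g \<rhd> act2 f \<alpha> g = Id2 K (Phi f) \<and> q g \<rhd> act2 f \<alpha> g = \<alpha> \<lhd> q f"
    and unit: "\<lbrakk>f \<in> Arr K; Cod K f = B\<rbrakk> \<Longrightarrow> arr K (e f) (Dom K f) (Dom K (Phi f)) \<and>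
      Phi f \<cdot> e f = f \<and> q f \<cdot> e f = Id1 K (Dom K f) \<and> lam f \<lhd> e f = Id2 K f"
    and mult: "\<lbrakk>f \<in> Arr K; Cod K f = B\<rbrakk> \<Longrightarrow>
      arr K (m f) (Dom K (Phi (Phi f))) (Dom K (Phi f)) \<and>
      Phi f \<cdot> m f = Phi (Phi f) \<and> q f \<cdot> m f = q f \<cdot> q (Phi f) \<and>
      lam f \<lhd> m f = (lam f \<lhd> q (Phi f)) \<bullet> lam (Phi f)"
begin

definition monad :: "('a, 'c) slice_monad" where
  "monad = \<lparr>
     Fun = \<lparr>onO = Phi, onA = (\<lambda>(f, h, g). (Phi f, act f h g, Phi g)),
            onC = (\<lambda>(f, \<alpha>, g). (Phi f, act2 f \<alpha> g, Phi g))\<rparr>,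
     Unit = (\<lambda>f. (f, e f, Phi f)), Mult = (\<lambda>f. (Phi (Phi f), m f, Phi f))\<rparr>"

lemma monad_sel [simp]:
  "onO (Fun monad) = Phi" "onA (Fun monad) (f, h, g) = (Phi f, act f h g, Phi g)"
  "onC (Fun monad) (f, \<alpha>, g) = (Phi f, act2 f \<alpha> g, Phi g)"
  "Unit monad f = (f, e f, Phi f)" "Mult monad f = (Phi (Phi f), m f, Phi f)"
  by (simp_all add: monad_def)

lemma typing [simp]:
  assumes "f \<in> Arr K" "Cod K f = B"
  shows "Phi f \<in> Arr K" "Cod K (Phi f) = B" "q f \<in> Arr K" "Dom K (q f) = Dom K (Phi f)"
    "Cod K (q f) = Dom K f" "lam f \<in> Cell K" "Src K (lam f) = Phi f" "Tgt K (lam f) = f \<cdot> q f"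
    "e f \<in> Arr K" "Dom K (e f) = Dom K f" "Cod K (e f) = Dom K (Phi f)"
    "m f \<in> Arr K" "Dom K (m f) = Dom K (Phi (Phi f))" "Cod K (m f) = Dom K (Phi f)"
  using commaD[OF comma[OF assms]] assms unit[OF assms] mult[OF assms] dom_cod_obj[of f]
  by (auto simp: arr_def)

lemma unit_eqs [simp]:
  assumes "f \<in> Arr K" "Cod K f = B"
  shows "Phi f \<cdot> e f = f" "q f \<cdot> e f = Id1 K (Dom K f)" "lam f \<lhd> e f = Id2 K f"
    "y \<in> Arr K \<Longrightarrow> Cod K y = Dom K f \<Longrightarrow> Phi f \<cdot> e f \<cdot> y = f \<cdot> y"
    "y \<in> Arr K \<Longrightarrow> Cod K y = Dom K f \<Longrightarrow> q f \<cdot> e f \<cdot> y = y"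
  using unit[OF assms] assms by (simp_all flip: comp_assoc)

lemma mult_eqs [simp]:
  assumes "f \<in> Arr K" "Cod K f = B"
  shows "Phi f \<cdot> m f = Phi (Phi f)" "q f \<cdot> m f = q f \<cdot> q (Phi f)"
    "lam f \<lhd> m f = (lam f \<lhd> q (Phi f)) \<bullet> lam (Phi f)"
    "y \<in> Arr K \<Longrightarrow> Cod K y = Dom K (Phi (Phi f)) \<Longrightarrow> Phi f \<cdot> m f \<cdot> y = Phi (Phi f) \<cdot> y"
    "y \<in> Arr K \<Longrightarrow> Cod K y = Dom K (Phi (Phi f)) \<Longrightarrow> q f \<cdot> m f \<cdot> y = q f \<cdot> q (Phi f) \<cdot> y"
  using mult[OF assms] assms by (simp_all flip: comp_assoc)

lemma act_eqs [simp]: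
  assumes "over K B f h g"
  shows "act f h g \<in> Arr K" "Dom K (act f h g) = Dom K (Phi f)" "Cod K (act f h g) = Dom K (Phi g)"
    "Phi g \<cdot> act f h g = Phi f" "q g \<cdot> act f h g = h \<cdot> q f" "lam g \<lhd> act f h g = lam f"
    "y \<in> Arr K \<Longrightarrow> Cod K y = Dom K (Phi f) \<Longrightarrow> Phi g \<cdot> act f h g \<cdot> y = Phi f \<cdot> y"
    "y \<in> Arr K \<Longrightarrow> Cod K y = Dom K (Phi f) \<Longrightarrow> q g \<cdot> act f h g \<cdot> y = h \<cdot> q f \<cdot> y"
  using act[OF assms] assms by (simp_all add: arr_def over_def flip: comp_assoc)

lemma act2_eqs [simp]:
  assumes "over_cell K B f \<alpha> g"
  shows "act2 f \<alpha> g \<in> Cell K" "Src K (act2 f \<alpha> g) = act f (Src K \<alpha>) g"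
    "Tgt K (act2 f \<alpha> g) = act f (Tgt K \<alpha>) g"
    "Phi g \<rhd> act2 f \<alpha> g = Id2 K (Phi f)" "q g \<rhd> act2 f \<alpha> g = \<alpha> \<lhd> q f"
  using act2[OF assms] by (simp_all add: cell_def)

lemma arr_eqI:
  assumes "f \<in> Arr K" "Cod K f = B" "x \<in> Arr K" "y \<in> Arr K" "Cod K x = Dom K (Phi f)"
    "Cod K y = Dom K (Phi f)" "Dom K x = Dom K y"
    "Phi f \<cdot> x = Phi f \<cdot> y" "q f \<cdot> x = q f \<cdot> y" "lam f \<lhd> x = lam f \<lhd> y"
  shows "x = y"
  using comma_arr_eqI[OF comma[OF assms(1,2)], of x "Dom K y" y] assms by (auto simp: arr_def)

lemma cell_eqI:
  assumes "f \<in> Arr K" "Cod K f = B" "\<gamma> \<in> Cell K" "\<gamma>' \<in> Cell K" "Src K \<gamma> = Src K \<gamma>'"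
    "Tgt K \<gamma> = Tgt K \<gamma>'" "Cod K (Src K \<gamma>) = Dom K (Phi f)"
    "Phi f \<rhd> \<gamma> = Phi f \<rhd> \<gamma>'" "q f \<rhd> \<gamma> = q f \<rhd> \<gamma>'"
  shows "\<gamma> = \<gamma>'"
  using comma_cell_eqI[OF comma[OF assms(1,2)], of \<gamma> "Src K \<gamma>" "Tgt K \<gamma>" \<gamma>'] assms
  by (auto simp: cell_def)

lemma over_act: "over K B f h g \<Longrightarrow> over K B (Phi f) (act f h g) (Phi g)"
  using overD[of B f h g] by (simp add: over_def[of _ _ "Phi f"])

lemma over_unit: "f \<in> Arr K \<Longrightarrow> Cod K f = B \<Longrightarrow> over K B f (e f) (Phi f)"
  by (auto simp: over_def)

lemma over_mult: "f \<in> Arr K \<Longrightarrow> Cod K f = B \<Longrightarrow> over K B (Phi (Phi f)) (m f) (Phi f)"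
  by (auto simp: over_def)

lemma over_cell_act2: "over_cell K B f \<alpha> g \<Longrightarrow> over_cell K B (Phi f) (act2 f \<alpha> g) (Phi g)"
  using over_cellD[of B f \<alpha> g] by (simp add: over_cell_def[of _ _ "Phi f"] over_act)

lemma act_id1:
  assumes "f \<in> Arr K" "Cod K f = B"
  shows "act f (Id1 K (Dom K f)) f = Id1 K (Dom K (Phi f))"
  by (rule arr_eqI[of f])
    (use assms over_id1[OF assms] in \<open>simp_all\<close>)

lemma act_comp:
  assumes "over K B f h g" "over K B g k j"
  shows "act f (k \<cdot> h) j = act g k j \<cdot> act f h g"
  by (rule arr_eqI[of j])
    (use over_comp[OF assms] overD[OF assms(1)] overD[OF assms(2)] assms in \<open>simp_all add: rwhisk_comp\<close>)

lemma act2_id2: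
  assumes "over K B f h g"
  shows "act2 f (Id2 K h) g = Id2 K (act f h g)"
  by (rule cell_eqI[of g])
    (use over_cell_id2[OF assms] overD[OF assms(1)] assms in \<open>simp_all\<close>)

lemma act2_vcomp:
  assumes "over_cell K B f \<alpha> g" "over_cell K B f \<beta> g" "Src K \<beta> = Tgt K \<alpha>"
  shows "act2 f (\<beta> \<bullet> \<alpha>) g = act2 f \<beta> g \<bullet> act2 f \<alpha> g"
proof -
  note o = over_cellD[OF assms(1)] over_cellD[OF assms(2)]
  show ?thesis
    by (rule cell_eqI[of g])
      (use over_cell_vcomp[OF assms] o overD[OF o(2)] overD[OF o(3)] overD[OF o(9)] assms in \<open>simp_all add: lwhisk_vcomp rwhisk_vcomp\<close>)
qed

lemma act2_hcomp:
  assumes "over_cell K B f \<alpha> g" "over_cell K B g \<beta> j"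
  shows "act2 f (\<beta> \<star> \<alpha>) j = act2 g \<beta> j \<star> act2 f \<alpha> g"
proof -
  note o = over_cellD[OF assms(1)] over_cellD[OF assms(2)]
  show ?thesis
    by (rule cell_eqI[of j])
      (use over_cell_hcomp[OF assms] o overD[OF o(2)] overD[OF o(3)] overD[OF o(8)] overD[OF o(9)] assms in \<open>simp_all add: lwhisk_hcomp rwhisk_hcomp id2_hcomp act_comp hcomp_middle\<close>)
qed

text \<open>Both sides of each functoriality law are arrows or 2-cells into a comma object with equal composites
  with the projections (and the 2-cell).\<close>

lemma is_functor: "two_functor (slice K B) (slice K B) (Fun monad)"
  unfolding two_functor_def
  by (auto simp: arr_slice_iff cell_slice_iff slice_Arr_iff over_act over_cell_act2 act_id1 act_comp act2_id2
      act2_vcomp act2_hcomp)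

lemma unit_natural:
  assumes "over K B f h g"
  shows "e g \<cdot> h = act f h g \<cdot> e f"
  by (rule arr_eqI[of g])
    (use overD[OF assms] assms in \<open>simp_all add: rwhisk_comp\<close>)

lemma unit_natural2:
  assumes "over_cell K B f \<alpha> g"
  shows "e g \<rhd> \<alpha> = act2 f \<alpha> g \<lhd> e f"
proof -
  note o = over_cellD[OF assms(1)]
  note o' = overD[OF o(2)] overD[OF o(3)]
  have 1: "(\<alpha> \<lhd> q f) \<lhd> e f = \<alpha>"
    using o o' by (simp flip: rwhisk_comp)
  show ?thesis
    by (rule cell_eqI[of g])
      (use 1 o o' assms in \<open>simp_all add: unit_natural lwhisk_rwhisk flip: lwhisk_comp\<close>)
qed

lemma mult_natural:
  assumes "over K B f h g"
  shows "m g \<cdot> act (Phi f) (act f h g) (Phi g) = act f h g \<cdot> m f"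
proof -
  note o = overD[OF assms] over_act[OF assms]
  have "(lam g \<lhd> q (Phi g)) \<lhd> act (Phi f) (act f h g) (Phi g) = (lam g \<lhd> act f h g) \<lhd> q (Phi f)"
    using assms o by (simp del: act_eqs(6) flip: rwhisk_comp)
  then have 1: "(lam g \<lhd> q (Phi g)) \<lhd> act (Phi f) (act f h g) (Phi g) = lam f \<lhd> q (Phi f)"
    using assms by simp
  show ?thesis
    by (rule arr_eqI[of g]) (use 1 assms o in \<open>simp_all add: rwhisk_comp rwhisk_vcomp\<close>)
qed

lemma mult_natural2:
  assumes "over_cell K B f \<alpha> g"
  shows "m g \<rhd> act2 (Phi f) (act2 f \<alpha> g) (Phi g) = act2 f \<alpha> g \<lhd> m f"
proof -
  note o = over_cellD[OF assms(1)]
  note o' = overD[OF o(2)] overD[OF o(3)]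
  have 1: "(\<alpha> \<lhd> q f) \<lhd> m f = (\<alpha> \<lhd> q f) \<lhd> q (Phi f)"
    using o o' by (simp flip: rwhisk_comp)
  have 2: "(q g \<cdot> q (Phi g)) \<rhd> act2 (Phi f) (act2 f \<alpha> g) (Phi g) = (\<alpha> \<lhd> q f) \<lhd> q (Phi f)"
    using o o' assms over_act[OF o(2)] over_cell_act2[OF assms] by (simp add: lwhisk_comp lwhisk_rwhisk)
  show ?thesis
    by (rule cell_eqI[of g])
      (use 1 2 o o' assms over_act[OF o(2)] over_act[OF o(3)] over_cell_act2[OF assms] in \<open>simp_all add: mult_natural lwhisk_rwhisk flip: lwhisk_comp\<close>)
qed

lemma mult_unit:
  assumes "f \<in> Arr K" "Cod K f = B"
  shows "m f \<cdot> e (Phi f) = Id1 K (Dom K (Phi f))"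
    "m f \<cdot> act f (e f) (Phi f) = Id1 K (Dom K (Phi f))"
proof -
  have 1: "(lam f \<lhd> q (Phi f)) \<lhd> e (Phi f) = lam f"
    using assms by (simp flip: rwhisk_comp)
  show "m f \<cdot> e (Phi f) = Id1 K (Dom K (Phi f))"
    by (rule arr_eqI[of f]) (use 1 assms in \<open>simp_all add: rwhisk_comp rwhisk_vcomp\<close>)
  note o = over_unit[OF assms]
  have 2: "(lam f \<lhd> q (Phi f)) \<lhd> act f (e f) (Phi f) = Id2 K (f \<cdot> q f)"
    using assms o rwhisk_comp[of "lam f" "q f" "e f"] by (simp flip: rwhisk_comp)
  show "m f \<cdot> act f (e f) (Phi f) = Id1 K (Dom K (Phi f))"
    by (rule arr_eqI[of f]) (use 2 assms o in \<open>simp_all add: rwhisk_comp rwhisk_vcomp\<close>)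
qed

lemma mult_mult:
  assumes "f \<in> Arr K" "Cod K f = B"
  shows "m f \<cdot> m (Phi f) = m f \<cdot> act (Phi (Phi f)) (m f) (Phi f)"
proof -
  note o = over_mult[OF assms]
  have 1: "(lam f \<lhd> q (Phi f)) \<lhd> m (Phi f) = (lam f \<lhd> q (Phi f)) \<lhd> q (Phi (Phi f))"
    using assms by (simp flip: rwhisk_comp)
  have "(lam f \<lhd> q (Phi f)) \<lhd> act (Phi (Phi f)) (m f) (Phi f) = (lam f \<lhd> m f) \<lhd> q (Phi (Phi f))"
    using assms o by (simp del: mult_eqs flip: rwhisk_comp)
  then have 2: "(lam f \<lhd> q (Phi f)) \<lhd> act (Phi (Phi f)) (m f) (Phi f) =
      ((lam f \<lhd> q (Phi f)) \<lhd> q (Phi (Phi f))) \<bullet> (lam (Phi f) \<lhd> q (Phi (Phi f)))"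
    using assms by (simp add: rwhisk_vcomp)
  show ?thesis
    by (rule arr_eqI[of f]) (use 1 2 assms o in \<open>simp_all add: rwhisk_comp rwhisk_vcomp\<close>)
qed

text \<open>The monad laws too are equations between arrows into \<open>Phi f\<close>.  After composing with \<open>lam f\<close> the
  associativity law compares the two bracketings of a composite of three 2-cells, and a unit law
  cancels an identity 2-cell.\<close>

theorem two_monad: "is_two_monad (slice K B) monad"
  unfolding is_two_monad_def two_nat_def
  by (auto simp: is_functor id_fun_def comp_fun_def arr_slice_iff cell_slice_iff over_unit over_mult
      unit_natural unit_natural2 mult_natural mult_natural2 mult_unit mult_mult)

end

text \<open>Comma objects are unique up to a unique isomorphism that respects the projections and the
  2-cell.  As these determine the rest of the structure, the isomorphisms are compatible with it.\<close>

locale comma_monad_pair = two_category K +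
  S: comma_monad K B Phi q lam act act2 e m + T: comma_monad K B Phi' q' lam' act' act2' e' m'
  for K :: "('o, 'a, 'c) two_cat" (structure) and B Phi q lam act act2 e m Phi' q' lam' act' act2' e' m'
begin

definition comparison :: "'a \<Rightarrow> 'a" where
  "comparison f = cm_arr K (Phi' f, q' f, lam' f) (Phi f) (q f) (lam f)"

lemma comparison_eqs [simp]:
  assumes "f \<in> Arr K" "Cod K f = B"
  shows "comparison f \<in> Arr K" "Dom K (comparison f) = Dom K (Phi f)"
    "Cod K (comparison f) = Dom K (Phi' f)"
    "Phi' f \<cdot> comparison f = Phi f" "q' f \<cdot> comparison f = q f" "lam' f \<lhd> comparison f = lam f"
    "y \<in> Arr K \<Longrightarrow> Cod K y = Dom K (Phi f) \<Longrightarrow> Phi' f \<cdot> comparison f \<cdot> y = Phi f \<cdot> y"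
    "y \<in> Arr K \<Longrightarrow> Cod K y = Dom K (Phi f) \<Longrightarrow> q' f \<cdot> comparison f \<cdot> y = q f \<cdot> y"
proof -
  have B: "B \<in> Obj K" using assms dom_cod_obj(2)[of f] by simp
  note c = cm_arr_eq[OF T.comma[OF assms], of "Phi f" "Dom K (Phi f)" "q f" "lam f", folded comparison_def]
  show *: "comparison f \<in> Arr K" "Dom K (comparison f) = Dom K (Phi f)"
    "Cod K (comparison f) = Dom K (Phi' f)"
    "Phi' f \<cdot> comparison f = Phi f" "q' f \<cdot> comparison f = q f" "lam' f \<lhd> comparison f = lam f"
    using c assms B by (simp_all add: arr_def cell_def)
  show "y \<in> Arr K \<Longrightarrow> Cod K y = Dom K (Phi f) \<Longrightarrow> Phi' f \<cdot> comparison f \<cdot> y = Phi f \<cdot> y"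
    "y \<in> Arr K \<Longrightarrow> Cod K y = Dom K (Phi f) \<Longrightarrow> q' f \<cdot> comparison f \<cdot> y = q f \<cdot> y"
    using * assms by (simp_all flip: comp_assoc)
qed

lemma over_comparison:
  "f \<in> Arr K \<Longrightarrow> Cod K f = B \<Longrightarrow> over K B (Phi f) (comparison f) (Phi' f)"
  by (simp add: over_def)

lemma comparison_natural:
  assumes "over K B f h g"
  shows "comparison g \<cdot> act f h g = act' f h g \<cdot> comparison f"
  by (rule T.arr_eqI[of g]) (use assms overD[OF assms] in \<open>simp_all add: rwhisk_comp\<close>)

lemma comparison_natural2:
  assumes "over_cell K B f \<alpha> g"
  shows "comparison g \<rhd> act2 f \<alpha> g = act2' f \<alpha> g \<lhd> comparison f"
proof -
  note o = over_cellD[OF assms(1)]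
  note o' = overD[OF o(2)] overD[OF o(3)]
  have 1: "(\<alpha> \<lhd> q' f) \<lhd> comparison f = \<alpha> \<lhd> q f"
    using o o' by (simp flip: rwhisk_comp)
  show ?thesis
    by (rule T.cell_eqI[of g])
      (use 1 o o' assms in \<open>simp_all add: comparison_natural lwhisk_rwhisk flip: lwhisk_comp\<close>)
qed

lemma comparison_unit:
  assumes "f \<in> Arr K" "Cod K f = B"
  shows "comparison f \<cdot> e f = e' f"
  by (rule T.arr_eqI[of f]) (use assms in \<open>simp_all add: rwhisk_comp\<close>)

lemma comparison_mult:
  assumes "f \<in> Arr K" "Cod K f = B"
  shows "comparison f \<cdot> m f =
    m' f \<cdot> comparison (Phi' f) \<cdot> act (Phi f) (comparison f) (Phi' f)"
proof -
  note o = over_comparison[OF assms]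
  have "(lam' f \<lhd> q' (Phi' f)) \<lhd> (comparison (Phi' f) \<cdot> act (Phi f) (comparison f) (Phi' f)) =
      (lam' f \<lhd> comparison f) \<lhd> q (Phi f)"
    using assms o by (simp del: comparison_eqs(6) flip: rwhisk_comp)
  then have 1: "((lam' f \<lhd> q' (Phi' f)) \<lhd> comparison (Phi' f)) \<lhd> act (Phi f) (comparison f) (Phi' f) =
      lam f \<lhd> q (Phi f)"
    using assms o by (simp add: rwhisk_comp)
  show ?thesis
    by (rule T.arr_eqI[of f]) (use 1 assms o in \<open>simp_all add: rwhisk_comp rwhisk_vcomp\<close>)
qed

lemma comparison_inverse:
  assumes "f \<in> Arr K" "Cod K f = B"
  shows "\<exists>g. inverse_arrs (slice K B) (Phi f, comparison f, Phi' f) g"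
proof -
  have B: "B \<in> Obj K" using assms dom_cod_obj(2)[of f] by simp
  obtain w where "arr K w (Dom K (Phi' f)) (Dom K (Phi f)) \<and>
      Phi f \<cdot> w = Phi' f \<and> q f \<cdot> w = q' f \<and> lam f \<lhd> w = lam' f"
    using ex1_implies_ex[OF comma_arr_ex1[OF S.comma[OF assms],
        of "Phi' f" "Dom K (Phi' f)" "q' f" "lam' f"]] assms B
    by (auto simp: arr_def cell_def)
  then have w: "w \<in> Arr K" "Dom K w = Dom K (Phi' f)" "Cod K w = Dom K (Phi f)"
    "Phi f \<cdot> w = Phi' f" "q f \<cdot> w = q' f" "lam f \<lhd> w = lam' f"
    by (simp_all add: arr_def)
  \<comment> \<open>the comparison in the other direction is the inverse, again by cancelling the projections\<close>
  have w': "Phi f \<cdot> w \<cdot> comparison f = Phi f" "q f \<cdot> w \<cdot> comparison f = q f"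
    using w assms comp_assoc[of "comparison f" w "Phi f"] comp_assoc[of "comparison f" w "q f"]
    by simp_all
  have 1: "w \<cdot> comparison f = Id1 K (Dom K (Phi f))"
    by (rule S.arr_eqI[of f]) (use w w' assms in \<open>simp_all add: rwhisk_comp\<close>)
  have 2: "comparison f \<cdot> w = Id1 K (Dom K (Phi' f))"
    by (rule T.arr_eqI[of f]) (use w assms in \<open>simp_all add: rwhisk_comp\<close>)
  show ?thesis
    using 1 2 w assms
    by (intro exI[of _ "(Phi' f, w, Phi f)"])
      (simp add: inverse_arrs_def arr_slice_iff over_def)
qed

theorem iso: "two_monads_iso (slice K B) S.monad T.monad"
  unfolding two_monads_iso_def
proof (intro conjI exI[of _ "\<lambda>f. (Phi f, comparison f, Phi' f)"] ballI)
  show "two_nat (slice K B) (slice K B) (Fun S.monad) (Fun T.monad) (\<lambda>f. (Phi f, comparison f, Phi' f))"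
    unfolding two_nat_def
    by (auto simp: arr_slice_iff cell_slice_iff over_comparison comparison_natural comparison_natural2)
qed (simp_all del: split_paired_Ex
    add: S.two_monad T.two_monad comparison_inverse comparison_unit comparison_mult)

end

context two_category
begin

text \<open>The equations hold as soon as all data are the arrows and 2-cells induced by the universal
  property; what remains to be verified is that the induced ones exist.\<close>

lemma comma_monadI:
  fixes act2 :: "'a \<Rightarrow> 'c \<Rightarrow> 'a \<Rightarrow> 'c"
  assumes comma: "\<And>f. \<lbrakk>f \<in> Arr K; Cod K f = B\<rbrakk> \<Longrightarrow> is_comma K (Id1 K B) f (Phi f, q f, lam f)"
    and act: "\<And>f h g. over K B f h g \<Longrightarrow>
      act f h g = cm_arr K (Phi g, q g, lam g) (Phi f) (h \<cdot> q f) (lam f)"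
    and act2: "\<And>f \<alpha> g. over_cell K B f \<alpha> g \<Longrightarrow>
      act2 f \<alpha> g = cm_cell K (Phi g, q g, lam g) (act f (Src K \<alpha>) g) (act f (Tgt K \<alpha>) g)
        (Id2 K (Phi f)) (\<alpha> \<lhd> q f)"
    and unit: "\<And>f. \<lbrakk>f \<in> Arr K; Cod K f = B\<rbrakk> \<Longrightarrow>
      e f = cm_arr K (Phi f, q f, lam f) f (Id1 K (Dom K f)) (Id2 K f)"
    and mult: "\<And>f. \<lbrakk>f \<in> Arr K; Cod K f = B\<rbrakk> \<Longrightarrow>
      m f = cm_arr K (Phi f, q f, lam f) (Phi (Phi f)) (q f \<cdot> q (Phi f))
        ((lam f \<lhd> q (Phi f)) \<bullet> lam (Phi f))"
  shows "comma_monad K B Phi q lam act act2 e m"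
proof unfold_locales
  have B: "B \<in> Obj K" if "f \<in> Arr K" "Cod K f = B" for f
    using that dom_cod_obj(2)[of f] by simp
  have t: "Phi f \<in> Arr K" "Cod K (Phi f) = B" "q f \<in> Arr K" "Dom K (q f) = Dom K (Phi f)"
    "Cod K (q f) = Dom K f" "lam f \<in> Cell K" "Src K (lam f) = Phi f" "Tgt K (lam f) = f \<cdot> q f"
    if "f \<in> Arr K" "Cod K f = B" for f
    using commaD[OF comma[OF that]] that B[OF that] by simp_all
  show act': "arr K (act f h g) (Dom K (Phi f)) (Dom K (Phi g)) \<and>
      Phi g \<cdot> act f h g = Phi f \<and> q g \<cdot> act f h g = h \<cdot> q f \<and> lam g \<lhd> act f h g = lam f"
    if o: "over K B f h g" for f h g
  proof -
    have o': "f \<in> Arr K" "Cod K f = B" "g \<in> Arr K" "Cod K g = B" "h \<in> Arr K" "Dom K h = Dom K f"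
      "Cod K h = Dom K g" "g \<cdot> h = f"
      using o by (simp_all add: over_def)
    have "g \<cdot> h \<cdot> q f = f \<cdot> q f"
      using o' t[of f] comp_assoc[of "q f" h g] by simp
    then show ?thesis
      unfolding act[OF o]
      using cm_arr_eq[OF comma, of g "Phi f" "Dom K (Phi f)" "h \<cdot> q f" "lam f"] o' B[of g] t[of f]
      by (simp add: arr_def cell_def)
  qed
  show "cell K (act2 f \<alpha> g) (act f (Src K \<alpha>) g) (act f (Tgt K \<alpha>) g) \<and>
      Phi g \<rhd> act2 f \<alpha> g = Id2 K (Phi f) \<and> q g \<rhd> act2 f \<alpha> g = \<alpha> \<lhd> q f"
    if o: "over_cell K B f \<alpha> g" for f \<alpha> g
  proof -
    have o': "f \<in> Arr K" "Cod K f = B" "g \<in> Arr K" "Cod K g = B" "\<alpha> \<in> Cell K" "Dom K (Src K \<alpha>) = Dom K f"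
      "Cod K (Src K \<alpha>) = Dom K g" "g \<rhd> \<alpha> = Id2 K f"
      using o by (simp_all add: over_cell_def over_def)
    have a: "over K B f (Src K \<alpha>) g" "over K B f (Tgt K \<alpha>) g"
      using o by (simp_all add: over_cell_def)
    have "g \<rhd> (\<alpha> \<lhd> q f) = Id2 K (f \<cdot> q f)"
      using o' t[of f] by (simp add: lwhisk_rwhisk)
    then show ?thesis
      unfolding act2[OF o]
      using cm_cell_eq[OF comma, of g "act f (Src K \<alpha>) g" "Dom K (Phi f)" "act f (Tgt K \<alpha>) g"
          "Id2 K (Phi f)" "\<alpha> \<lhd> q f"] act'[OF a(1)] act'[OF a(2)] o' B[of g] t[of f]
      by (simp add: arr_def cell_def)
  qed
  show "arr K (e f) (Dom K f) (Dom K (Phi f)) \<and>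
      Phi f \<cdot> e f = f \<and> q f \<cdot> e f = Id1 K (Dom K f) \<and> lam f \<lhd> e f = Id2 K f"
    if o: "f \<in> Arr K" "Cod K f = B" for f
    unfolding unit[OF o]
    using cm_arr_eq[OF comma[OF o], of f "Dom K f" "Id1 K (Dom K f)" "Id2 K f"] o B[OF o]
    by (simp add: arr_def cell_def)
  show "arr K (m f) (Dom K (Phi (Phi f))) (Dom K (Phi f)) \<and>
      Phi f \<cdot> m f = Phi (Phi f) \<and> q f \<cdot> m f = q f \<cdot> q (Phi f) \<and>
      lam f \<lhd> m f = (lam f \<lhd> q (Phi f)) \<bullet> lam (Phi f)"
    if o: "f \<in> Arr K" "Cod K f = B" for f
    unfolding mult[OF o]
    using cm_arr_eq[OF comma[OF o], of "Phi (Phi f)" "Dom K (Phi (Phi f))" "q f \<cdot> q (Phi f)"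
        "(lam f \<lhd> q (Phi f)) \<bullet> lam (Phi f)"] o B[OF o] t[OF o] t[of "Phi f"]
    by (simp add: arr_def cell_def)
qed (rule comma)

lemma Phi_comma_monad:
  assumes "chosen_commas K cm"
  shows "comma_monad K B (Phi_ob K cm B) (Phi_q K cm B) (Phi_lam K cm B) (Phi_arr K cm B)
    (\<lambda>f \<alpha> g. fst (snd (onC (Fun (Phi_monad K cm B)) (f, \<alpha>, g))))
    (\<lambda>f. fst (snd (Unit (Phi_monad K cm B) f))) (\<lambda>f. fst (snd (Mult (Phi_monad K cm B) f)))"
proof (rule comma_monadI)
  have cm: "cm (Id1 K B) f = (Phi_ob K cm B f, Phi_q K cm B f, Phi_lam K cm B f)" for f
    by (simp add: Phi_ob_def Phi_q_def Phi_lam_def)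
  show "is_comma K (Id1 K B) f (Phi_ob K cm B f, Phi_q K cm B f, Phi_lam K cm B f)"
    if "f \<in> Arr K" "Cod K f = B" for f
    using assms that dom_cod_obj(2)[of f] by (simp add: chosen_commas_def flip: cm)
qed (simp_all add: Phi_monad_def Phi_arr_def Let_def Phi_ob_def Phi_q_def Phi_lam_def)

text \<open>The 2-monad \<open>\<Phi>\<close> is recovered from its components, which instantiate \<open>comma_monad\<close>.\<close>

lemma Phi_monad_eq:
  assumes "chosen_commas K cm"
  shows "comma_monad.monad (Phi_ob K cm B) (Phi_arr K cm B)
    (\<lambda>f \<alpha> g. fst (snd (onC (Fun (Phi_monad K cm B)) (f, \<alpha>, g))))
    (\<lambda>f. fst (snd (Unit (Phi_monad K cm B) f))) (\<lambda>f. fst (snd (Mult (Phi_monad K cm B) f)))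
    = Phi_monad K cm B"
  unfolding comma_monad.monad_def[OF Phi_comma_monad[OF assms]]
  by (simp add: Phi_monad_def Let_def)

end

section \<open>Identities are exponentiable\<close>

locale base_change = two_category K for K :: "('o, 'a, 'c) two_cat" (structure) +
  fixes pb :: "'a \<Rightarrow> 'a \<Rightarrow> 'a \<times> 'a" and f :: 'a
  assumes pb: "chosen_pullbacks K pb" and f [simp]: "f \<in> Arr K"
begin

abbreviation "D h \<equiv> fst (pb f h)"
abbreviation "r h \<equiv> snd (pb f h)"
abbreviation "act \<equiv> Delta_arr K pb f"
abbreviation "act2 h \<alpha> h' \<equiv> pb_cell K (pb f h') (act h (Src K \<alpha>) h') (act h (Tgt K \<alpha>) h')
  (Id2 K (D h)) (\<alpha> \<lhd> r h)"

lemma pullback: "\<lbrakk>h \<in> Arr K; Cod K h = Cod K f\<rbrakk> \<Longrightarrow> is_pullback K f h (D h, r h)"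
  using pb by (simp add: chosen_pullbacks_def)

lemma proj_typing [simp]:
  assumes "h \<in> Arr K" "Cod K h = Cod K f"
  shows "D h \<in> Arr K" "r h \<in> Arr K" "Dom K (r h) = Dom K (D h)" "Cod K (D h) = Dom K f"
    "Cod K (r h) = Dom K h"
  using pullbackD[OF pullback[OF assms]] by simp_all

lemma square: "\<lbrakk>h \<in> Arr K; Cod K h = Cod K f\<rbrakk> \<Longrightarrow> f \<cdot> D h = h \<cdot> r h"
  by (rule pullbackD(9)[OF pullback])

lemma arr_eqI:
  assumes "h \<in> Arr K" "Cod K h = Cod K f" "x \<in> Arr K" "y \<in> Arr K" "Cod K x = Dom K (D h)"
    "Cod K y = Dom K (D h)" "Dom K x = Dom K y" "D h \<cdot> x = D h \<cdot> y" "r h \<cdot> x = r h \<cdot> y"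
  shows "x = y"
  using pullback_arr_eqI[OF pullback[OF assms(1,2)], of x "Dom K y" y] assms by (simp add: arr_def)

lemma cell_eqI:
  assumes "h \<in> Arr K" "Cod K h = Cod K f" "\<gamma> \<in> Cell K" "\<gamma>' \<in> Cell K" "Src K \<gamma> = Src K \<gamma>'"
    "Tgt K \<gamma> = Tgt K \<gamma>'" "Cod K (Src K \<gamma>) = Dom K (D h)"
    "D h \<rhd> \<gamma> = D h \<rhd> \<gamma>'" "r h \<rhd> \<gamma> = r h \<rhd> \<gamma>'"
  shows "\<gamma> = \<gamma>'"
  using pullback_cell_eqI[OF pullback[OF assms(1,2)], of \<gamma> "Src K \<gamma>" "Tgt K \<gamma>" \<gamma>'] assms
  by (simp add: cell_def)

lemma act_eqs [simp]:
  assumes "over K (Cod K f) h k h'"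
  shows "act h k h' \<in> Arr K" "Dom K (act h k h') = Dom K (D h)" "Cod K (act h k h') = Dom K (D h')"
    "D h' \<cdot> act h k h' = D h" "r h' \<cdot> act h k h' = k \<cdot> r h"
    "y \<in> Arr K \<Longrightarrow> Cod K y = Dom K (D h) \<Longrightarrow> D h' \<cdot> act h k h' \<cdot> y = D h \<cdot> y"
    "y \<in> Arr K \<Longrightarrow> Cod K y = Dom K (D h) \<Longrightarrow> r h' \<cdot> act h k h' \<cdot> y = k \<cdot> r h \<cdot> y"
proof -
  note o = overD[OF assms]
  have "h' \<cdot> k \<cdot> r h = h \<cdot> r h"
    using o comp_assoc[of "r h" k h'] by simp
  then have a: "arr K (act h k h') (Dom K (D h)) (Dom K (D h'))"
    "D h' \<cdot> act h k h' = D h" "r h' \<cdot> act h k h' = k \<cdot> r h"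
    using pb_arr_eq[OF pullback, of h' "D h" "Dom K (D h)" "k \<cdot> r h"] o square[of h]
    by (simp_all add: arr_def Delta_arr_def)
  then show *: "act h k h' \<in> Arr K" "Dom K (act h k h') = Dom K (D h)"
    "Cod K (act h k h') = Dom K (D h')" "D h' \<cdot> act h k h' = D h" "r h' \<cdot> act h k h' = k \<cdot> r h"
    by (simp_all add: arr_def)
  show "y \<in> Arr K \<Longrightarrow> Cod K y = Dom K (D h) \<Longrightarrow> D h' \<cdot> act h k h' \<cdot> y = D h \<cdot> y"
    "y \<in> Arr K \<Longrightarrow> Cod K y = Dom K (D h) \<Longrightarrow> r h' \<cdot> act h k h' \<cdot> y = k \<cdot> r h \<cdot> y"
    using * o by (simp_all flip: comp_assoc)
qed

lemma act2_eqs [simp]: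
  assumes "over_cell K (Cod K f) h \<alpha> h'"
  shows "act2 h \<alpha> h' \<in> Cell K" "Src K (act2 h \<alpha> h') = act h (Src K \<alpha>) h'"
    "Tgt K (act2 h \<alpha> h') = act h (Tgt K \<alpha>) h'"
    "D h' \<rhd> act2 h \<alpha> h' = Id2 K (D h)" "r h' \<rhd> act2 h \<alpha> h' = \<alpha> \<lhd> r h"
proof -
  note o = over_cellD[OF assms]
  note o' = overD[OF o(2)] overD[OF o(3)]
  have "h' \<rhd> (\<alpha> \<lhd> r h) = Id2 K (h \<cdot> r h)"
    using o o' by (simp add: lwhisk_rwhisk)
  then show "act2 h \<alpha> h' \<in> Cell K" "Src K (act2 h \<alpha> h') = act h (Src K \<alpha>) h'"
    "Tgt K (act2 h \<alpha> h') = act h (Tgt K \<alpha>) h'"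
    "D h' \<rhd> act2 h \<alpha> h' = Id2 K (D h)" "r h' \<rhd> act2 h \<alpha> h' = \<alpha> \<lhd> r h"
    using pb_cell_eq[OF pullback, of h' "act h (Src K \<alpha>) h'" "Dom K (D h)" "act h (Tgt K \<alpha>) h'"
        "Id2 K (D h)" "\<alpha> \<lhd> r h"] o o' square[of h]
    by (simp_all add: arr_def cell_def)
qed

lemma over_act:
  assumes "over K (Cod K f) h k h'"
  shows "over K (Dom K f) (D h) (act h k h') (D h')"
  unfolding over_def using overD[OF assms] assms by simp

lemma over_cell_act2:
  assumes "over_cell K (Cod K f) h \<alpha> h'"
  shows "over_cell K (Dom K f) (D h) (act2 h \<alpha> h') (D h')"
  using over_cellD[OF assms] assms by (simp add: over_cell_def[of _ "Dom K f"] over_act)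

lemma act_id1:
  assumes "h \<in> Arr K" "Cod K h = Cod K f"
  shows "act h (Id1 K (Dom K h)) h = Id1 K (Dom K (D h))"
  by (rule arr_eqI[of h]) (use assms over_id1[OF assms] in simp_all)

lemma act_comp:
  assumes "over K (Cod K f) h k h'" "over K (Cod K f) h' k' j"
  shows "act h (k' \<cdot> k) j = act h' k' j \<cdot> act h k h'"
  by (rule arr_eqI[of j])
    (use over_comp[OF assms] overD[OF assms(1)] overD[OF assms(2)] assms in simp_all)

lemma act2_id2:
  assumes "over K (Cod K f) h k h'"
  shows "act2 h (Id2 K k) h' = Id2 K (act h k h')"
  by (rule cell_eqI[of h'])
    (use act2_eqs[OF over_cell_id2[OF assms]] overD[OF assms(1)] assms in simp_all)

lemma act2_vcomp:
  assumes "over_cell K (Cod K f) h \<alpha> h'" "over_cell K (Cod K f) h \<beta> h'" "Src K \<beta> = Tgt K \<alpha>"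
  shows "act2 h (\<beta> \<bullet> \<alpha>) h' = act2 h \<beta> h' \<bullet> act2 h \<alpha> h'"
proof -
  note o = over_cellD[OF assms(1)] over_cellD[OF assms(2)]
  show ?thesis
    by (rule cell_eqI[of h'])
      (use act2_eqs[OF over_cell_vcomp[OF assms]] act2_eqs[OF assms(1)] act2_eqs[OF assms(2)]
        o overD[OF o(2)] overD[OF o(3)] overD[OF o(9)] assms
        in \<open>simp_all add: lwhisk_vcomp rwhisk_vcomp\<close>)
qed

lemma act2_hcomp:
  assumes "over_cell K (Cod K f) h \<alpha> h'" "over_cell K (Cod K f) h' \<beta> j"
  shows "act2 h (\<beta> \<star> \<alpha>) j = act2 h' \<beta> j \<star> act2 h \<alpha> h'"
proof -
  note o = over_cellD[OF assms(1)] over_cellD[OF assms(2)]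
  show ?thesis
    by (rule cell_eqI[of j])
      (use act2_eqs[OF over_cell_hcomp[OF assms]]
        o overD[OF o(2)] overD[OF o(3)] overD[OF o(8)] overD[OF o(9)] assms
        in \<open>simp_all add: lwhisk_hcomp rwhisk_hcomp id2_hcomp act_comp hcomp_middle\<close>)
qed

lemma Delta_sel:
  "onO (Delta_fun K pb f) = D" "onA (Delta_fun K pb f) (h, k, h') = (D h, act h k h', D h')"
  "onC (Delta_fun K pb f) (h, \<alpha>, h') = (D h, act2 h \<alpha> h', D h')"
  by (simp_all add: Delta_fun_def)

lemma Delta_two_functor:
  "two_functor (slice K (Cod K f)) (slice K (Dom K f)) (Delta_fun K pb f)"
  unfolding two_functor_def
  by (auto simp: Delta_sel arr_slice_iff cell_slice_iff slice_Arr_iff over_act over_cell_act2 act_id1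
      act_comp act2_id2 act2_vcomp act2_hcomp simp del: act2_eqs(4,5))

end

text \<open>A pullback of an identity along \<open>h\<close> is isomorphic to \<open>h\<close> through its second projection \<open>r h\<close>.
  These isomorphisms are 2-natural, so pulling back along an identity is isomorphic to the identity
  2-functor, which is its own right adjoint: the unit is the inverse \<open>s\<close> of \<open>r\<close> and the counit is \<open>r\<close>.\<close>

lemma (in two_category) exponentiable_id1:
  assumes "chosen_pullbacks K pb" "A \<in> Obj K"
  shows "exponentiable K pb (Id1 K A)"
proof -
  let ?i = "Id1 K A"
  interpret base_change K pb ?i
    using assms by unfold_locales simp_all
  note [simp] = assms(2)
  define s where "s h = pb_arr K (D h, r h) h (Id1 K (Dom K h))" for h
  have D: "h \<cdot> r h = D h" if "h \<in> Arr K" "Cod K h = A" for h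
    using square[of h] that by simp
  have s: "s h \<in> Arr K" "Dom K (s h) = Dom K h" "Cod K (s h) = Dom K (D h)"
    "D h \<cdot> s h = h" "r h \<cdot> s h = Id1 K (Dom K h)" if "h \<in> Arr K" "Cod K h = A" for h
    using pb_arr_eq[OF pullback, of h h "Dom K h" "Id1 K (Dom K h)", folded s_def] that
    by (simp_all add: arr_def)
  have sr: "s h \<cdot> r h = Id1 K (Dom K (D h))" if h: "h \<in> Arr K" "Cod K h = A" for h
  proof (rule arr_eqI[of h])
    have "D h \<cdot> s h \<cdot> r h = (D h \<cdot> s h) \<cdot> r h"
      using s(1-3)[OF h] h by simp
    also have "\<dots> = D h"
      using s(4)[OF h] D[OF h] by simp
    finally show "D h \<cdot> s h \<cdot> r h = D h \<cdot> Id1 K (Dom K (D h))"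
      using h by simp
    have "r h \<cdot> s h \<cdot> r h = (r h \<cdot> s h) \<cdot> r h"
      using s(1-3)[OF h] h by simp
    also have "\<dots> = r h"
      using s(5)[OF h] h by simp
    finally show "r h \<cdot> s h \<cdot> r h = r h \<cdot> Id1 K (Dom K (D h))"
      using h by simp
  qed (use s(1-3)[OF h] h in simp_all)
  have r_over: "over K A (D h) (r h) h" and s_over: "over K A h (s h) (D h)"
    if "h \<in> Arr K" "Cod K h = A" for h
    using D[OF that] s[OF that] that by (simp_all add: over_def)
  have s_nat: "s h' \<cdot> k = act h k h' \<cdot> s h" if o: "over K A h k h'" for h k h'
  proof -
    note o' = overD[OF o]
    note t = s[OF o'(1,2)] s[OF o'(3,4)[simplified]]
    show ?thesis
    proof (rule arr_eqI[of h'])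
      have "D h' \<cdot> s h' \<cdot> k = (D h' \<cdot> s h') \<cdot> k"
        using t(6-8) o'(3-7) by simp
      also have "\<dots> = h"
        using t(9) o'(8) by simp
      finally show "D h' \<cdot> s h' \<cdot> k = D h' \<cdot> act h k h' \<cdot> s h"
        using t(1-4) o by simp
      have "r h' \<cdot> s h' \<cdot> k = (r h' \<cdot> s h') \<cdot> k"
        using t(6-8) o'(3-7) by simp
      also have "\<dots> = k"
        using t(10) o'(5,7) by simp
      finally show "r h' \<cdot> s h' \<cdot> k = r h' \<cdot> act h k h' \<cdot> s h"
        using t(1-3,5) o o'(1-7) by simp
    qed (use t(1-3,6-8) o o'(1-7) in simp_all)
  qed
  have s_nat2: "s h' \<rhd> \<alpha> = act2 h \<alpha> h' \<lhd> s h" if o: "over_cell K A h \<alpha> h'" for h \<alpha> h'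
  proof -
    note o1 = over_cellD[OF o]
    note o2 = overD[OF o1(2)] overD[OF o1(3)]
    have 1: "(\<alpha> \<lhd> r h) \<lhd> s h = \<alpha>"
      using o1 o2 s[of h] by (simp flip: rwhisk_comp)
    show ?thesis
      by (rule cell_eqI[of h'])
        (use 1 o o1 o2 s[of h] s[of h'] act2_eqs[of h \<alpha> h'] s_nat[OF o1(2)] s_nat[OF o1(3)]
          in \<open>simp_all add: lwhisk_rwhisk flip: lwhisk_comp\<close>)
  qed
  have "has_right_2_adjoint (slice K A) (slice K A) (Delta_fun K pb ?i)"
    unfolding has_right_2_adjoint_def
  proof (intro exI conjI)
    show "two_functor (slice K A) (slice K A) (Delta_fun K pb ?i)"
      using Delta_two_functor by simp
    show "two_functor (slice K A) (slice K A) id_fun"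
      by (simp add: two_functor_def id_fun_def)
    show "two_nat (slice K A) (slice K A) id_fun (id_fun \<circ>\<^sub>F Delta_fun K pb ?i) (\<lambda>h. (h, s h, D h))"
      unfolding two_nat_def
      by (auto simp: id_fun_def comp_fun_def Delta_sel arr_slice_iff cell_slice_iff s_over s_nat s_nat2)
    show "two_nat (slice K A) (slice K A) (Delta_fun K pb ?i \<circ>\<^sub>F id_fun) id_fun (\<lambda>h. (D h, r h, h))"
      unfolding two_nat_def
      using act_eqs(5) act2_eqs(5)
      by (auto simp: id_fun_def comp_fun_def Delta_sel arr_slice_iff cell_slice_iff r_over)
    show "\<forall>h \<in> Obj (slice K A). (\<lambda>h. (D h, r h, h)) (onO (Delta_fun K pb ?i) h) \<cdot>\<^bsub>slice K A\<^esub>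
        onA (Delta_fun K pb ?i) (h, s h, D h) = Id1 (slice K A) (onO (Delta_fun K pb ?i) h)"
      using s_over act_eqs(5) sr by (auto simp: Delta_sel)
    show "\<forall>h \<in> Obj (slice K A). onA id_fun (D h, r h, h) \<cdot>\<^bsub>slice K A\<^esub>
        (\<lambda>h. (h, s h, D h)) (onO id_fun h) = Id1 (slice K A) (onO id_fun h)"
      using s(5) by (auto simp: id_fun_def)
  qed
  then show ?thesis
    by (simp add: exponentiable_def)
qed

section \<open>Spans as polynomials\<close>

lemma PolyHom_sel [simp]:
  "Dom (PolyHom K pb X Y) (p, f, q) = p" "Cod (PolyHom K pb X Y) (p, f, q) = q"
  "Id1 (PolyHom K pb X Y) p = (p, (Id1 K (Dom K (p2 p)), Id1 K (Cod K (p2 p))), p)"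
  "Src (PolyHom K pb X Y) (p, (\<phi>0, \<phi>1), q) = (p, (Src K \<phi>0, Src K \<phi>1), q)"
  "Tgt (PolyHom K pb X Y) (p, (\<phi>0, \<phi>1), q) = (p, (Tgt K \<phi>0, Tgt K \<phi>1), q)"
  "Comp (PolyHom K pb X Y) (q, (g0, g1), r) (p, (f0, f1), q') = (p, (g0 \<cdot>\<^bsub>K\<^esub> f0, g1 \<cdot>\<^bsub>K\<^esub> f1), r)"
  "Id2 (PolyHom K pb X Y) (p, (f0, f1), q) = (p, (Id2 K f0, Id2 K f1), q)"
  "VComp (PolyHom K pb X Y) (q, (\<psi>0, \<psi>1), r) (p, (\<phi>0, \<phi>1), q') =
    (p, (\<psi>0 \<bullet>\<^bsub>K\<^esub> \<phi>0, \<psi>1 \<bullet>\<^bsub>K\<^esub> \<phi>1), q')"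
  "HComp (PolyHom K pb X Y) (q, (\<psi>0, \<psi>1), r) (p, (\<phi>0, \<phi>1), q') =
    (p, (\<psi>0 \<star>\<^bsub>K\<^esub> \<phi>0, \<psi>1 \<star>\<^bsub>K\<^esub> \<phi>1), r)"
  by (simp_all add: PolyHom_def)

lemma PolyHom_whisk [simp]:
  "(q, (g0, g1), r) \<rhd>\<^bsub>PolyHom K pb X Y\<^esub> (p, (\<phi>0, \<phi>1), q') = (p, (g0 \<rhd>\<^bsub>K\<^esub> \<phi>0, g1 \<rhd>\<^bsub>K\<^esub> \<phi>1), r)"
  "(q, (\<phi>0, \<phi>1), r) \<lhd>\<^bsub>PolyHom K pb X Y\<^esub> (p, (f0, f1), q') = (p, (\<phi>0 \<lhd>\<^bsub>K\<^esub> f0, \<phi>1 \<lhd>\<^bsub>K\<^esub> f1), r)"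
  by (simp_all add: lwhisk_def rwhisk_def)

context two_category
begin

definition span_arr :: "'a poly \<Rightarrow> 'a \<Rightarrow> 'a poly \<Rightarrow> bool" where
  "span_arr p w q \<longleftrightarrow> w \<in> Arr K \<and> Dom K w = Dom K (p1 p) \<and> Cod K w = Dom K (p1 q) \<and>
     p1 q \<cdot> w = p1 p \<and> p3 q \<cdot> w = p3 p"

text \<open>With identities as middle maps, the pullback condition on an arrow of polynomials is no restriction
  on an arrow of spans.\<close>

lemma pullback_id1:
  assumes "w \<in> Arr K" "Dom K w = X" "Cod K w = Y"
  shows "is_pullback K (Id1 K Y) w (w, Id1 K X)"
proof -
  have o [simp]: "X \<in> Obj K" "Y \<in> Obj K"
    using assms dom_cod_obj[of w] by simp_all
  have 1: "\<exists>!x. arr K x Z X \<and> w \<cdot> x = u \<and> Id1 K X \<cdot> x = v"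
    if "arr K u Z Y" "arr K v Z X" "Id1 K Y \<cdot> u = w \<cdot> v" for Z u v
  proof (rule ex1I[of _ v])
    show "arr K v Z X \<and> w \<cdot> v = u \<and> Id1 K X \<cdot> v = v"
      using that by (simp add: arr_def)
    show "x = v" if "arr K x Z X \<and> w \<cdot> x = u \<and> Id1 K X \<cdot> x = v" for x
      using that Comp_Id1_left[of x Z X] by simp
  qed
  have 2: "\<exists>!\<gamma>. cell K \<gamma> h k \<and> w \<rhd> \<gamma> = \<alpha> \<and> Id1 K X \<rhd> \<gamma> = \<beta>"
    if "arr K h Z X" "arr K k Z X" "cell K \<alpha> (w \<cdot> h) (w \<cdot> k)"
      "cell K \<beta> (Id1 K X \<cdot> h) (Id1 K X \<cdot> k)" "Id1 K Y \<rhd> \<alpha> = w \<rhd> \<beta>" for Z h k \<alpha> \<beta>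
  proof (rule ex1I[of _ \<beta>])
    show "cell K \<beta> h k \<and> w \<rhd> \<beta> = \<alpha> \<and> Id1 K X \<rhd> \<beta> = \<beta>"
      using that assms by (simp add: cell_def arr_def)
    show "\<gamma> = \<beta>" if \<gamma>: "cell K \<gamma> h k \<and> w \<rhd> \<gamma> = \<alpha> \<and> Id1 K X \<rhd> \<gamma> = \<beta>" for \<gamma>
      using \<gamma> \<open>arr K h Z X\<close> whisk_id1(1)[of \<gamma> X] by (simp add: cell_def arr_def)
  qed
  have "w \<in> Arr K" "Dom K w = X" "Cod K w = Y"
    using assms by simp_all
  then have 3: "Id1 K Y \<in> Arr K" "w \<in> Arr K" "Id1 K X \<in> Arr K" "Cod K (Id1 K Y) = Cod K w"
    "X = Dom K (Id1 K X)" "Cod K w = Y" "Cod K (Id1 K X) = X"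
    "Id1 K Y \<cdot> w = w \<cdot> Id1 K X"
    by simp_all
  have 4: "Dom K (Id1 K Y) = Y" "Dom K w = X"
    using assms by simp_all
  show ?thesis
    unfolding is_pullback_def prod.case 4
    by (intro conjI allI impI 3 4; elim conjE; (rule 1 | rule 2); assumption)
qed

end

locale spans = two_category K for K :: "('o, 'a, 'c) two_cat" (structure) +
  fixes pb :: "'a \<Rightarrow> 'a \<Rightarrow> 'a \<times> 'a"
  assumes pb: "chosen_pullbacks K pb"
begin

lemma pullback: "\<lbrakk>f \<in> Arr K; g \<in> Arr K; Cod K f = Cod K g\<rbrakk> \<Longrightarrow> is_pullback K f g (fst (pb f g), snd (pb f g))"
  using pb by (simp add: chosen_pullbacks_def)

lemma is_poly_span:
  assumes "x \<in> Arr K" "y \<in> Arr K" "Dom K x = A" "Dom K y = A" "Cod K x = X" "Cod K y = Y"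
  shows "is_poly K pb X Y (Poly x (Id1 K A) y)"
proof -
  have "A \<in> Obj K" using assms dom_cod_obj(1)[of x] by simp
  then show ?thesis using assms exponentiable_id1[OF pb] by (simp add: is_poly_def)
qed

lemma spanD:
  assumes "is_poly K pb X Y p" "is_span K p"
  shows "p1 p \<in> Arr K" "p3 p \<in> Arr K" "Dom K (p3 p) = Dom K (p1 p)" "Cod K (p1 p) = X"
    "Cod K (p3 p) = Y" "p2 p = Id1 K (Dom K (p1 p))" "Dom K (p1 p) \<in> Obj K"
proof -
  have p: "p1 p \<in> Arr K" "p3 p \<in> Arr K" "Cod K (p1 p) = X" "Cod K (p2 p) = Dom K (p3 p)"
    "Cod K (p3 p) = Y" "p2 p = Id1 K (Dom K (p1 p))"
    using assms unfolding is_poly_def is_span_def by blast+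
  then show "p1 p \<in> Arr K" "p3 p \<in> Arr K" "Dom K (p3 p) = Dom K (p1 p)" "Cod K (p1 p) = X"
    "Cod K (p3 p) = Y" "p2 p = Id1 K (Dom K (p1 p))" "Dom K (p1 p) \<in> Obj K"
    by simp_all
qed

lemma is_poly_span_arr:
  assumes "is_poly K pb X Y p" "is_poly K pb X Y q" "is_span K p" "is_span K q" "span_arr p w q"
  shows "is_poly_arr K p (w, w) q"
  using assms(5) spanD[OF assms(1,3)] spanD[OF assms(2,4)]
    pullback_id1[of w "Dom K (p1 p)" "Dom K (p1 q)"]
  by (simp add: is_poly_arr_def span_arr_def arr_def)

lemma arr_spanI:
  assumes "is_poly K pb X Y p" "is_poly K pb X Y q" "is_span K p" "is_span K q" "span_arr p w q"
  shows "arr (PolyHom K pb X Y) (p, (w, w), q) p q"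
  using is_poly_span_arr[OF assms] assms by (simp add: arr_def PolyHom_def)

lemma cell_spanI:
  assumes "is_poly K pb X Y p" "is_poly K pb X Y q" "is_span K p" "is_span K q" "span_arr p w q"
    "span_arr p w' q" "cell K \<phi> w w'" "p1 q \<rhd> \<phi> = Id2 K (p1 p)" "p3 q \<rhd> \<phi> = Id2 K (p3 p)"
  shows "cell (PolyHom K pb X Y) (p, (\<phi>, \<phi>), q) (p, (w, w), q) (p, (w', w'), q)"
  using is_poly_span_arr[OF assms(1-5)] is_poly_span_arr[OF assms(1-4,6)] assms(1,2,5-9)
    spanD[OF assms(1,3)] spanD[OF assms(2,4)]
  by (simp add: cell_def PolyHom_def span_arr_def)

text \<open>The operator \<open>inv_arr\<close> is a definite description, so besides the inverse its uniqueness has to be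
  shown; the competing inverse may a priori have two different components.\<close>

lemma inv_arr_span:
  assumes pq: "is_poly K pb X Y p" "is_poly K pb X Y q" "is_span K p" "is_span K q" "span_arr p w q"
    and s: "s \<in> Arr K" "Dom K s = Dom K (p1 q)" "Cod K s = Dom K (p1 p)"
      "s \<cdot> w = Id1 K (Dom K (p1 p))" "w \<cdot> s = Id1 K (Dom K (p1 q))"
  shows "inv_arr (PolyHom K pb X Y) (p, (w, w), q) = (q, (s, s), p)"
proof -
  note p = spanD[OF pq(1,3)]
  note q = spanD[OF pq(2,4)]
  have w: "w \<in> Arr K" "Dom K w = Dom K (p1 p)" "Cod K w = Dom K (p1 q)"
    "p1 q \<cdot> w = p1 p" "p3 q \<cdot> w = p3 p"
    using pq(5) by (simp_all add: span_arr_def)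
  have "(p1 q \<cdot> w) \<cdot> s = p1 q" "(p3 q \<cdot> w) \<cdot> s = p3 q"
    using w(1-3) s p(1-3) q(1-3) by simp_all
  then have "p1 p \<cdot> s = p1 q" "p3 p \<cdot> s = p3 q"
    by (simp_all only: w(4,5))
  then have "span_arr q s p"
    using s p q by (simp add: span_arr_def)
  note sa = arr_spanI[OF pq(2,1,4,3) this]
  have inv: "inverse_arrs (PolyHom K pb X Y) (p, (w, w), q) (q, (s, s), p)"
    using sa s p(6,7) q(6,7) by (simp add: inverse_arrs_def)
  show ?thesis
    unfolding inv_arr_def
  proof (rule the_equality)
    show "inverse_arrs (PolyHom K pb X Y) (p, (w, w), q) (q, (s, s), p)"
      by (rule inv)
  next
    fix g assume g: "inverse_arrs (PolyHom K pb X Y) (p, (w, w), q) g"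
    obtain g0 g1 where g_eq: "g = (q, (g0, g1), p)"
      using g by (cases g) (auto simp: inverse_arrs_def arr_def)
    have "is_poly_arr K q (g0, g1) p"
      using g by (simp add: g_eq inverse_arrs_def arr_def PolyHom_def)
    then have g01: "g0 \<in> Arr K" "Dom K g0 = Dom K (p1 q)" "Cod K g0 = Dom K (p1 p)"
      "g1 \<in> Arr K" "Dom K g1 = Dom K (p1 q)" "Cod K g1 = Dom K (p1 p)"
      using p q by (simp_all add: is_poly_arr_def arr_def)
    have gw: "g0 \<cdot> w = Id1 K (Dom K (p1 p))" "g1 \<cdot> w = Id1 K (Dom K (p1 p))"
      using g p(6,7) q(6,7) by (simp_all add: g_eq inverse_arrs_def)
    have "g0 = (g0 \<cdot> w) \<cdot> s" "g1 = (g1 \<cdot> w) \<cdot> s"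
      using g01 w(1-3) s by simp_all
    then show "g = (q, (s, s), p)"
      using gw s by (simp add: g_eq)
  qed
qed

text \<open>An adjunction between spans is an adjunction in \<open>K\<close> between the apexes whose unit and counit become
  identities on the legs: the two components of each arrow and 2-cell coincide.\<close>

lemma adjoint_spansI:
  assumes pq: "is_poly K pb X Y p" "is_poly K pb X Y q" "is_span K p" "is_span K q"
    and f: "span_arr p f q" and g: "span_arr q g p"
    and \<eta>: "cell K \<eta> (Id1 K (Dom K (p1 p))) (g \<cdot> f)" "p1 p \<rhd> \<eta> = Id2 K (p1 p)"
      "p3 p \<rhd> \<eta> = Id2 K (p3 p)"
    and \<epsilon>: "cell K \<epsilon> (f \<cdot> g) (Id1 K (Dom K (p1 q)))" "p1 q \<rhd> \<epsilon> = Id2 K (p1 q)"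
      "p3 q \<rhd> \<epsilon> = Id2 K (p3 q)"
    and triangles: "(\<epsilon> \<lhd> f) \<bullet> (f \<rhd> \<eta>) = Id2 K f" "(g \<rhd> \<epsilon>) \<bullet> (\<eta> \<lhd> g) = Id2 K g"
  shows "adjoint_arrs (PolyHom K pb X Y) (p, (f, f), q) (q, (g, g), p)"
proof -
  note p = spanD[OF pq(1,3)]
  note q = spanD[OF pq(2,4)]
  have comp: "span_arr x (k \<cdot> h) z" if "span_arr x h y" "span_arr y k z" "p1 z \<in> Arr K"
    "p3 z \<in> Arr K" "Dom K (p3 z) = Dom K (p1 z)" for x y z h k
  proof -
    have "p1 z \<cdot> k \<cdot> h = (p1 z \<cdot> k) \<cdot> h" "p3 z \<cdot> k \<cdot> h = (p3 z \<cdot> k) \<cdot> h"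
      by ((rule comp_assoc[symmetric]; use that in \<open>simp add: span_arr_def\<close>)+)
    then show ?thesis
      using that by (simp add: span_arr_def)
  qed
  have id: "span_arr p (Id1 K (Dom K (p1 p))) p" "span_arr q (Id1 K (Dom K (p1 q))) q"
    using p q by (simp_all add: span_arr_def)
  have gf: "span_arr p (g \<cdot> f) p" "span_arr q (f \<cdot> g) q"
    using comp[OF f g] comp[OF g f] p q by simp_all
  note \<eta>' = cell_spanI[OF pq(1,1,3,3) id(1) gf(1) \<eta>]
  note \<epsilon>' = cell_spanI[OF pq(2,2,4,4) gf(2) id(2) \<epsilon>]
  show ?thesis
    unfolding adjoint_arrs_def
    using arr_spanI[OF pq f] arr_spanI[OF pq(2,1,4,3) g] \<eta>' \<epsilon>' triangles p(6,7) q(6,7)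
    by (intro conjI exI[of _ "(p, (\<eta>, \<eta>), p)"] exI[of _ "(q, (\<epsilon>, \<epsilon>), q)"])
      (simp_all add: arr_def)
qed

end

section \<open>The internal category on the arrow object\<close>

text \<open>The pullback \<open>P\<close> is the object of composable pairs; \<open>a\<close> is the morphism that comes second and \<open>b\<close>
  the one that comes first, so that the domain of \<open>a\<close> is the codomain of \<open>b\<close>.\<close>

locale arrow_object = spans K pb for K :: "('o, 'a, 'c) two_cat" (structure) and pb +
  fixes B E :: 'o and d1 d0 :: 'a and l :: 'c
  assumes B [simp]: "B \<in> Obj K" and cotensor: "is_arrow_cotensor K B E d1 d0 l"
begin

abbreviation "a \<equiv> fst (pb d1 d0)"
abbreviation "b \<equiv> snd (pb d1 d0)"
abbreviation "P \<equiv> Dom K a"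
abbreviation "M \<equiv> Poly d0 (Id1 K E) d1"
abbreviation "MM \<equiv> Poly (d0 \<cdot> a) (Id1 K P) (d1 \<cdot> b)"
abbreviation "u0 \<equiv> cm_arr K (d1, d0, l) (Id1 K B) (Id1 K B) (Id2 K (Id1 K B))"
abbreviation "m0 \<equiv> cm_arr K (d1, d0, l) (d1 \<cdot> b) (d0 \<cdot> a) ((l \<lhd> a) \<bullet> (l \<lhd> b))"
abbreviation "u \<equiv> (id_span K B, (u0, u0), M)"
abbreviation "m \<equiv> (MM, (m0, m0), M)"

lemma comma: "is_comma K (Id1 K B) (Id1 K B) (d1, d0, l)"
  using cotensor by (simp add: is_arrow_cotensor_def)

lemma d_typing [simp]:
  "d1 \<in> Arr K" "d0 \<in> Arr K" "Dom K d1 = E" "Dom K d0 = E" "Cod K d1 = B" "Cod K d0 = B"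
  "l \<in> Cell K" "Src K l = d1" "Tgt K l = d0" "E \<in> Obj K"
proof -
  show *: "d1 \<in> Arr K" "d0 \<in> Arr K" "Dom K d1 = E" "Dom K d0 = E" "Cod K d1 = B" "Cod K d0 = B"
    using commaD[OF comma] cotensor by (simp_all add: is_arrow_cotensor_def)
  show "l \<in> Cell K" "Src K l = d1" "Tgt K l = d0" "E \<in> Obj K"
    using commaD[OF comma] * dom_cod_obj(1)[of d1] by simp_all
qed

lemma E_eqI:
  assumes "x \<in> Arr K" "y \<in> Arr K" "Cod K x = E" "Cod K y = E" "Dom K x = Dom K y"
    "d1 \<cdot> x = d1 \<cdot> y" "d0 \<cdot> x = d0 \<cdot> y" "l \<lhd> x = l \<lhd> y"
  shows "x = y"
  using comma_arr_eqI[OF comma, of x "Dom K y" y] assms by (simp add: arr_def)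

lemma E_cell_eqI:
  assumes "\<gamma> \<in> Cell K" "\<gamma>' \<in> Cell K" "Src K \<gamma> = Src K \<gamma>'" "Tgt K \<gamma> = Tgt K \<gamma>'"
    "Cod K (Src K \<gamma>) = E" "d1 \<rhd> \<gamma> = d1 \<rhd> \<gamma>'" "d0 \<rhd> \<gamma> = d0 \<rhd> \<gamma>'"
  shows "\<gamma> = \<gamma>'"
  using comma_cell_eqI[OF comma, of \<gamma> "Src K \<gamma>" "Tgt K \<gamma>" \<gamma>'] assms by (simp add: cell_def)

lemma P_typing [simp]:
  "a \<in> Arr K" "b \<in> Arr K" "Dom K b = P" "Cod K a = E" "Cod K b = E" "P \<in> Obj K"
  using pullbackD[OF pullback[of d1 d0]] by simp_all

lemma P_square [simp]:
  "d0 \<cdot> b = d1 \<cdot> a" "y \<in> Arr K \<Longrightarrow> Cod K y = P \<Longrightarrow> d0 \<cdot> b \<cdot> y = d1 \<cdot> a \<cdot> y"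
proof -
  show *: "d0 \<cdot> b = d1 \<cdot> a"
    using pullbackD(9)[OF pullback[of d1 d0]] by simp
  show "y \<in> Arr K \<Longrightarrow> Cod K y = P \<Longrightarrow> d0 \<cdot> b \<cdot> y = d1 \<cdot> a \<cdot> y"
    using * comp_assoc[of y b d0] comp_assoc[of y a d1] by simp
qed

lemma P_cell_eqI:
  assumes "\<gamma> \<in> Cell K" "\<gamma>' \<in> Cell K" "Src K \<gamma> = Src K \<gamma>'" "Tgt K \<gamma> = Tgt K \<gamma>'"
    "Cod K (Src K \<gamma>) = P" "a \<rhd> \<gamma> = a \<rhd> \<gamma>'" "b \<rhd> \<gamma> = b \<rhd> \<gamma>'"
  shows "\<gamma> = \<gamma>'"
  using pullback_cell_eqI[OF pullback[of d1 d0], of \<gamma> "Src K \<gamma>" "Tgt K \<gamma>" \<gamma>'] assms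
  by (simp add: cell_def)

lemma unit_eqs [simp]:
  "u0 \<in> Arr K" "Dom K u0 = B" "Cod K u0 = E" "d1 \<cdot> u0 = Id1 K B" "d0 \<cdot> u0 = Id1 K B"
  "l \<lhd> u0 = Id2 K (Id1 K B)"
  "y \<in> Arr K \<Longrightarrow> Cod K y = B \<Longrightarrow> d1 \<cdot> u0 \<cdot> y = y"
  "y \<in> Arr K \<Longrightarrow> Cod K y = B \<Longrightarrow> d0 \<cdot> u0 \<cdot> y = y"
  "y \<in> Arr K \<Longrightarrow> Cod K y = B \<Longrightarrow> l \<lhd> (u0 \<cdot> y) = Id2 K y"
proof -
  show *: "u0 \<in> Arr K" "Dom K u0 = B" "Cod K u0 = E" "d1 \<cdot> u0 = Id1 K B" "d0 \<cdot> u0 = Id1 K B"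
    "l \<lhd> u0 = Id2 K (Id1 K B)"
    using cm_arr_eq[OF comma, of "Id1 K B" B "Id1 K B" "Id2 K (Id1 K B)"]
    by (simp_all add: arr_def cell_def)
  show "y \<in> Arr K \<Longrightarrow> Cod K y = B \<Longrightarrow> d1 \<cdot> u0 \<cdot> y = y"
    "y \<in> Arr K \<Longrightarrow> Cod K y = B \<Longrightarrow> d0 \<cdot> u0 \<cdot> y = y"
    using * comp_assoc[of y u0 d1] comp_assoc[of y u0 d0] by simp_all
  show "y \<in> Arr K \<Longrightarrow> Cod K y = B \<Longrightarrow> l \<lhd> (u0 \<cdot> y) = Id2 K y"
    using * by (simp add: rwhisk_comp)
qed

lemma mult_eqs [simp]:
  "m0 \<in> Arr K" "Dom K m0 = P" "Cod K m0 = E" "d1 \<cdot> m0 = d1 \<cdot> b" "d0 \<cdot> m0 = d0 \<cdot> a"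
  "l \<lhd> m0 = (l \<lhd> a) \<bullet> (l \<lhd> b)"
  "y \<in> Arr K \<Longrightarrow> Cod K y = P \<Longrightarrow> d1 \<cdot> m0 \<cdot> y = d1 \<cdot> b \<cdot> y"
  "y \<in> Arr K \<Longrightarrow> Cod K y = P \<Longrightarrow> d0 \<cdot> m0 \<cdot> y = d0 \<cdot> a \<cdot> y"
  "y \<in> Arr K \<Longrightarrow> Cod K y = P \<Longrightarrow> l \<lhd> (m0 \<cdot> y) = (l \<lhd> (a \<cdot> y)) \<bullet> (l \<lhd> (b \<cdot> y))"
proof -
  show *: "m0 \<in> Arr K" "Dom K m0 = P" "Cod K m0 = E" "d1 \<cdot> m0 = d1 \<cdot> b" "d0 \<cdot> m0 = d0 \<cdot> a"
    "l \<lhd> m0 = (l \<lhd> a) \<bullet> (l \<lhd> b)"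
    using cm_arr_eq[OF comma, of "d1 \<cdot> b" P "d0 \<cdot> a" "(l \<lhd> a) \<bullet> (l \<lhd> b)"]
    by (simp_all add: arr_def cell_def)
  show "y \<in> Arr K \<Longrightarrow> Cod K y = P \<Longrightarrow> d1 \<cdot> m0 \<cdot> y = d1 \<cdot> b \<cdot> y"
    "y \<in> Arr K \<Longrightarrow> Cod K y = P \<Longrightarrow> d0 \<cdot> m0 \<cdot> y = d0 \<cdot> a \<cdot> y"
    using * comp_assoc[of y m0 d1] comp_assoc[of y m0 d0] by simp_all
  show "y \<in> Arr K \<Longrightarrow> Cod K y = P \<Longrightarrow> l \<lhd> (m0 \<cdot> y) = (l \<lhd> (a \<cdot> y)) \<bullet> (l \<lhd> (b \<cdot> y))"
    using * by (simp add: rwhisk_comp rwhisk_vcomp)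
qed

lemma pair_eqs:
  assumes "x \<in> Arr K" "y \<in> Arr K" "Dom K y = Dom K x" "Cod K x = E" "Cod K y = E" "d1 \<cdot> x = d0 \<cdot> y"
  defines "w \<equiv> pb_arr K (pb d1 d0) x y"
  shows "w \<in> Arr K" "Dom K w = Dom K x" "Cod K w = P" "a \<cdot> w = x" "b \<cdot> w = y"
  using pb_arr_eq[OF pullback[of d1 d0], of x "Dom K x" y] assms by (simp_all add: arr_def)

lemma M_span:
  "is_poly K pb B B (id_span K B)" "is_poly K pb B B M" "is_poly K pb B B MM"
  "is_span K (id_span K B)" "is_span K M" "is_span K MM"
  by (simp_all add: is_span_def id_span_def is_poly_span)

lemma span_comp_eq:
  "span_comp K pb q p = Poly (p1 p \<cdot> fst (span_pb pb q p)) (Id1 K (Dom K (fst (span_pb pb q p))))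
    (p3 q \<cdot> snd (span_pb pb q p))"
  by (simp add: span_comp_def case_prod_beta)

lemma MM_eq: "span_comp K pb M M = MM"
  by (simp add: span_comp_eq span_pb_def)

abbreviation "a1 \<equiv> fst (pb d1 (Id1 K B))"
abbreviation "b1 \<equiv> snd (pb d1 (Id1 K B))"
abbreviation "a2 \<equiv> fst (pb (Id1 K B) d0)"
abbreviation "b2 \<equiv> snd (pb (Id1 K B) d0)"

lemma unitor_typing [simp]:
  "a1 \<in> Arr K" "b1 \<in> Arr K" "Dom K b1 = Dom K a1" "Cod K a1 = E" "Cod K b1 = B" "d1 \<cdot> a1 = b1"
  "a2 \<in> Arr K" "b2 \<in> Arr K" "Dom K b2 = Dom K a2" "Cod K a2 = B" "Cod K b2 = E" "d0 \<cdot> b2 = a2"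
  using pullbackD[OF pullback[of d1 "Id1 K B"]] pullbackD[OF pullback[of "Id1 K B" d0]] by simp_all

text \<open>The whiskered units \<open>u \<circ> M\<close> and \<open>M \<circ> u\<close> insert an identity as the first and as the second member
  of a composable pair, respectively.\<close>

abbreviation "uM \<equiv> pb_arr K (pb d1 d0) a1 (u0 \<cdot> b1)"
abbreviation "Mu \<equiv> pb_arr K (pb d1 d0) (u0 \<cdot> a2) b2"

lemmas uM_eqs [simp] = pair_eqs[of a1 "u0 \<cdot> b1", simplified]
lemmas Mu_eqs [simp] = pair_eqs[of "u0 \<cdot> a2" b2, simplified]

lemma unit_left_eq: "unit_left K pb B M u = (span_comp K pb (id_span K B) M, (uM, uM), MM)"
  by (simp add: Let_def unit_left_def span_hcomp_def span_pb_def id_span_def MM_eq)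

lemma unit_right_eq: "unit_right K pb B M u = (span_comp K pb M (id_span K B), (Mu, Mu), MM)"
  by (simp add: Let_def unit_right_def span_hcomp_def span_pb_def id_span_def MM_eq)

lemma lunit_eq: "span_lunit K pb M = (span_comp K pb (id_span K B) M, (a1, a1), M)"
  by (simp add: Let_def span_lunit_def span_pb_def id_span_def)

lemma runit_eq: "span_runit K pb M = (span_comp K pb M (id_span K B), (b2, b2), M)"
  by (simp add: Let_def span_runit_def span_pb_def id_span_def)

lemma mult_uM: "m0 \<cdot> uM = a1"
  by (rule E_eqI) simp_all

lemma mult_Mu: "m0 \<cdot> Mu = b2"
  by (rule E_eqI) simp_all

text \<open>The pullbacks \<open>(a3, b3)\<close> and \<open>(a4, b4)\<close> are the two objects of composable triples; \<open>re\<close> rebrackets.\<close>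

abbreviation "a3 \<equiv> fst (pb d1 (d0 \<cdot> a))"
abbreviation "b3 \<equiv> snd (pb d1 (d0 \<cdot> a))"
abbreviation "a4 \<equiv> fst (pb (d1 \<cdot> b) d0)"
abbreviation "b4 \<equiv> snd (pb (d1 \<cdot> b) d0)"

lemma triple_typing [simp]:
  "a3 \<in> Arr K" "b3 \<in> Arr K" "Dom K b3 = Dom K a3" "Cod K a3 = E" "Cod K b3 = P"
  "d0 \<cdot> a \<cdot> b3 = d1 \<cdot> a3"
  "a4 \<in> Arr K" "b4 \<in> Arr K" "Dom K b4 = Dom K a4" "Cod K a4 = P" "Cod K b4 = E"
  "d0 \<cdot> b4 = d1 \<cdot> b \<cdot> a4"
  using pullbackD[OF pullback[of d1 "d0 \<cdot> a"]] pullbackD[OF pullback[of "d1 \<cdot> b" d0]] by simp_all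

abbreviation "mM \<equiv> pb_arr K (pb d1 d0) a3 (m0 \<cdot> b3)"
abbreviation "Mm \<equiv> pb_arr K (pb d1 d0) (m0 \<cdot> a4) b4"
abbreviation "re0 \<equiv> pb_arr K (pb d1 d0) a3 (a \<cdot> b3)"
abbreviation "re \<equiv> pb_arr K (pb (d1 \<cdot> b) d0) re0 (b \<cdot> b3)"

lemmas mM_eqs [simp] = pair_eqs[of a3 "m0 \<cdot> b3", simplified]
lemmas Mm_eqs [simp] = pair_eqs[of "m0 \<cdot> a4" b4, simplified]
lemmas re0_eqs [simp] = pair_eqs[of a3 "a \<cdot> b3", simplified]

lemma re_eqs [simp]:
  "re \<in> Arr K" "Dom K re = Dom K a3" "Cod K re = Dom K a4" "a4 \<cdot> re = re0" "b4 \<cdot> re = b \<cdot> b3"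
  using pb_arr_eq[OF pullback[of "d1 \<cdot> b" d0], of re0 "Dom K a3" "b \<cdot> b3"]
  by (simp_all add: arr_def)

text \<open>On composable triples both sides classify the composite of all three 2-cells.\<close>

lemma mult_assoc: "m0 \<cdot> mM = m0 \<cdot> Mm \<cdot> re"
proof (rule E_eqI)
  have 1: "a \<cdot> Mm \<cdot> re = m0 \<cdot> re0" "b \<cdot> Mm \<cdot> re = b \<cdot> b3"
    using comp_assoc[of re Mm a] comp_assoc[of re Mm b] by simp_all
  show "d1 \<cdot> m0 \<cdot> mM = d1 \<cdot> m0 \<cdot> Mm \<cdot> re"
    using 1 by simp
  show "d0 \<cdot> m0 \<cdot> mM = d0 \<cdot> m0 \<cdot> Mm \<cdot> re"
    using 1 by simp
  show "l \<lhd> (m0 \<cdot> mM) = l \<lhd> (m0 \<cdot> Mm \<cdot> re)"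
    using 1 by simp
qed simp_all

lemma hcomp_mult_id: "span_hcomp K pb m (Id1 (PolyHom K pb B B) M) = (span_comp K pb MM M, (mM, mM), MM)"
  by (simp add: Let_def span_hcomp_def span_pb_def MM_eq)

lemma hcomp_id_mult: "span_hcomp K pb (Id1 (PolyHom K pb B B) M) m = (span_comp K pb M MM, (Mm, Mm), MM)"
  by (simp add: Let_def span_hcomp_def span_pb_def MM_eq)

lemma span_assoc_eq: "span_assoc K pb M M M = (span_comp K pb MM M, (re, re), span_comp K pb M MM)"
  by (simp add: Let_def span_assoc_def span_pb_def MM_eq)

lemma u_span: "span_arr (id_span K B) u0 M"
  by (simp add: span_arr_def id_span_def)

lemma m_span: "span_arr MM m0 M"
  by (simp add: span_arr_def)

theorem poly_monad: "is_poly_monad K pb B M u m"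
proof -
  have "M \<in> Obj (PolyHom K pb B B)"
    using M_span by (simp add: PolyHom_def)
  then show ?thesis
    using arr_spanI[OF M_span(1,2,4,5) u_span] arr_spanI[OF M_span(3,2,6,5) m_span] M_span
    unfolding is_poly_monad_def Let_def MM_eq unit_left_eq unit_right_eq lunit_eq runit_eq
      hcomp_mult_id hcomp_id_mult span_assoc_eq
    by (simp add: mult_uM mult_Mu mult_assoc)
qed

section \<open>Colax idempotency\<close>

abbreviation "s1 \<equiv> pb_arr K (pb d1 (Id1 K B)) (Id1 K E) d1"
abbreviation "s2 \<equiv> pb_arr K (pb (Id1 K B) d0) d0 (Id1 K E)"

lemma s_eqs [simp]:
  "s1 \<in> Arr K" "Dom K s1 = E" "Cod K s1 = Dom K a1" "a1 \<cdot> s1 = Id1 K E" "b1 \<cdot> s1 = d1"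
  "s2 \<in> Arr K" "Dom K s2 = E" "Cod K s2 = Dom K a2" "a2 \<cdot> s2 = d0" "b2 \<cdot> s2 = Id1 K E"
  using pb_arr_eq[OF pullback[of d1 "Id1 K B"], of "Id1 K E" E d1]
    pb_arr_eq[OF pullback[of "Id1 K B" d0], of d0 E "Id1 K E"]
  by (simp_all add: arr_def)

lemma unitor_inverse: "s1 \<cdot> a1 = Id1 K (Dom K a1)" "s2 \<cdot> b2 = Id1 K (Dom K a2)"
proof -
  have "a1 \<cdot> s1 \<cdot> a1 = a1" "b1 \<cdot> s1 \<cdot> a1 = b1"
    using comp_assoc[of a1 s1 a1] comp_assoc[of a1 s1 b1] by simp_all
  then show "s1 \<cdot> a1 = Id1 K (Dom K a1)"
    using pullback_arr_eqI[OF pullback[of d1 "Id1 K B"], of "s1 \<cdot> a1" "Dom K a1" "Id1 K (Dom K a1)"]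
    by (simp add: arr_def)
  have "a2 \<cdot> s2 \<cdot> b2 = a2" "b2 \<cdot> s2 \<cdot> b2 = b2"
    using comp_assoc[of b2 s2 a2] comp_assoc[of b2 s2 b2] by simp_all
  then show "s2 \<cdot> b2 = Id1 K (Dom K a2)"
    using pullback_arr_eqI[OF pullback[of "Id1 K B" d0], of "s2 \<cdot> b2" "Dom K a2" "Id1 K (Dom K a2)"]
    by (simp add: arr_def)
qed

lemma unitor_spans:
  "is_poly K pb B B (span_comp K pb (id_span K B) M)" "is_poly K pb B B (span_comp K pb M (id_span K B))"
  "is_span K (span_comp K pb (id_span K B) M)" "is_span K (span_comp K pb M (id_span K B))"
  "span_arr (span_comp K pb (id_span K B) M) a1 M" "span_arr (span_comp K pb M (id_span K B)) b2 M"
  by (simp_all add: span_comp_eq span_pb_def id_span_def is_span_def is_poly_span span_arr_def)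

text \<open>The whiskered units with the unitors removed: on elements, \<open>L\<close> sends \<open>\<alpha>\<close> to the pair of \<open>\<alpha>\<close> and
  the identity of its domain, and \<open>R\<close> to the pair of the identity of its codomain and \<open>\<alpha>\<close>.\<close>

definition L where "L = uM \<cdot> s1"
definition R where "R = Mu \<cdot> s2"

lemma L_eqs [simp]:
  "L \<in> Arr K" "Dom K L = E" "Cod K L = P" "a \<cdot> L = Id1 K E" "b \<cdot> L = u0 \<cdot> d1"
  using comp_assoc[of s1 uM a] comp_assoc[of s1 uM b] by (simp_all add: L_def)

lemma R_eqs [simp]:
  "R \<in> Arr K" "Dom K R = E" "Cod K R = P" "a \<cdot> R = u0 \<cdot> d0" "b \<cdot> R = Id1 K E"
  using comp_assoc[of s2 Mu a] comp_assoc[of s2 Mu b] by (simp_all add: R_def)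

lemma LR_comp [simp]:
  "y \<in> Arr K \<Longrightarrow> Cod K y = E \<Longrightarrow> a \<cdot> L \<cdot> y = y" "y \<in> Arr K \<Longrightarrow> Cod K y = E \<Longrightarrow> b \<cdot> L \<cdot> y = u0 \<cdot> d1 \<cdot> y"
  "y \<in> Arr K \<Longrightarrow> Cod K y = E \<Longrightarrow> b \<cdot> R \<cdot> y = y" "y \<in> Arr K \<Longrightarrow> Cod K y = E \<Longrightarrow> a \<cdot> R \<cdot> y = u0 \<cdot> d0 \<cdot> y"
  using comp_assoc[of y L a] comp_assoc[of y L b] comp_assoc[of y R a] comp_assoc[of y R b] by simp_all

lemma mult_L: "m0 \<cdot> L = Id1 K E"
  by (rule E_eqI) simp_all

lemma mult_R: "m0 \<cdot> R = Id1 K E"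
  by (rule E_eqI) simp_all

lemma unit_left_L:
  "unit_left K pb B M u \<cdot>\<^bsub>PolyHom K pb B B\<^esub> inv_arr (PolyHom K pb B B) (span_lunit K pb M) = (M, (L, L), MM)"
proof -
  have "inv_arr (PolyHom K pb B B) (span_comp K pb (id_span K B) M, (a1, a1), M)
      = (M, (s1, s1), span_comp K pb (id_span K B) M)"
    by (rule inv_arr_span[OF unitor_spans(1) M_span(2) unitor_spans(3) M_span(5) unitor_spans(5)])
      (simp_all add: span_comp_eq span_pb_def id_span_def unitor_inverse)
  then show ?thesis by (simp add: unit_left_eq lunit_eq L_def)
qed

lemma unit_right_R:
  "unit_right K pb B M u \<cdot>\<^bsub>PolyHom K pb B B\<^esub> inv_arr (PolyHom K pb B B) (span_runit K pb M) = (M, (R, R), MM)"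
proof -
  have "inv_arr (PolyHom K pb B B) (span_comp K pb M (id_span K B), (b2, b2), M)
      = (M, (s2, s2), span_comp K pb M (id_span K B))"
    by (rule inv_arr_span[OF unitor_spans(2) M_span(2) unitor_spans(4) M_span(5) unitor_spans(6)])
      (simp_all add: span_comp_eq span_pb_def id_span_def unitor_inverse)
  then show ?thesis by (simp add: unit_right_eq runit_eq R_def)
qed

lemma E_cell_ex:
  assumes "h \<in> Arr K" "k \<in> Arr K" "Cod K h = E" "Cod K k = E" "Dom K k = Dom K h"
    "cell K \<alpha> (d1 \<cdot> h) (d1 \<cdot> k)" "cell K \<beta> (d0 \<cdot> h) (d0 \<cdot> k)"
    "\<beta> \<bullet> (l \<lhd> h) = (l \<lhd> k) \<bullet> \<alpha>"
  obtains \<gamma> where "\<gamma> \<in> Cell K" "Src K \<gamma> = h" "Tgt K \<gamma> = k" "d1 \<rhd> \<gamma> = \<alpha>" "d0 \<rhd> \<gamma> = \<beta>"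
  using comma_cell_ex1[OF comma, of h "Dom K h" k \<alpha> \<beta>] assms by (auto simp: arr_def cell_def)

lemma P_cell_ex:
  assumes "h \<in> Arr K" "k \<in> Arr K" "Cod K h = P" "Cod K k = P" "Dom K k = Dom K h"
    "cell K \<alpha> (a \<cdot> h) (a \<cdot> k)" "cell K \<beta> (b \<cdot> h) (b \<cdot> k)" "d1 \<rhd> \<alpha> = d0 \<rhd> \<beta>"
  obtains \<gamma> where "\<gamma> \<in> Cell K" "Src K \<gamma> = h" "Tgt K \<gamma> = k" "a \<rhd> \<gamma> = \<alpha>" "b \<rhd> \<gamma> = \<beta>"
  using pullback_cell_ex1[OF pullback[of d1 d0], of h "Dom K h" k \<alpha> \<beta>] assms
  by (auto simp: arr_def cell_def)

text \<open>The unit is an identity because composing with an identity changes nothing.  The counit is the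
  square of pairs from \<open>(\<alpha>\<beta>, 1)\<close> to \<open>(\<alpha>, \<beta>)\<close> that is \<open>\<beta>\<close> on the middle object and the identity on the
  two outer ones.\<close>

lemma L_adjoint: "adjoint_arrs (PolyHom K pb B B) (M, (L, L), MM) m"
proof -
  obtain \<epsilon>a where \<epsilon>a: "\<epsilon>a \<in> Cell K" "Src K \<epsilon>a = m0" "Tgt K \<epsilon>a = a"
    "d1 \<rhd> \<epsilon>a = l \<lhd> b" "d0 \<rhd> \<epsilon>a = Id2 K (d0 \<cdot> a)"
    by (rule E_cell_ex[of m0 a "l \<lhd> b" "Id2 K (d0 \<cdot> a)"]) (simp_all add: cell_def)
  obtain \<epsilon>b where \<epsilon>b: "\<epsilon>b \<in> Cell K" "Src K \<epsilon>b = u0 \<cdot> d1 \<cdot> b" "Tgt K \<epsilon>b = b"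
    "d1 \<rhd> \<epsilon>b = Id2 K (d1 \<cdot> b)" "d0 \<rhd> \<epsilon>b = l \<lhd> b"
    by (rule E_cell_ex[of "u0 \<cdot> d1 \<cdot> b" b "Id2 K (d1 \<cdot> b)" "l \<lhd> b"]) (simp_all add: cell_def)
  obtain \<epsilon> where \<epsilon>: "\<epsilon> \<in> Cell K" "Src K \<epsilon> = L \<cdot> m0" "Tgt K \<epsilon> = Id1 K P"
    "a \<rhd> \<epsilon> = \<epsilon>a" "b \<rhd> \<epsilon> = \<epsilon>b"
    by (rule P_cell_ex[of "L \<cdot> m0" "Id1 K P" \<epsilon>a \<epsilon>b]) (use \<epsilon>a \<epsilon>b in \<open>simp_all add: cell_def\<close>)
  \<comment> \<open>on pairs in the image of \<open>L\<close> the first member is an identity, which makes the counit trivial\<close>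
  have w: "(l \<lhd> b) \<lhd> L = Id2 K d1"
    using rwhisk_comp[of l L b] by simp
  have \<epsilon>aL: "\<epsilon>a \<lhd> L = Id2 K (Id1 K E)"
    by (rule E_cell_eqI) (use \<epsilon>a w in \<open>simp_all add: lwhisk_rwhisk mult_L\<close>)
  have \<epsilon>bL: "\<epsilon>b \<lhd> L = Id2 K (u0 \<cdot> d1)"
    by (rule E_cell_eqI) (use \<epsilon>b w in \<open>simp_all add: lwhisk_rwhisk mult_L\<close>)
  have \<epsilon>L: "\<epsilon> \<lhd> L = Id2 K L"
    by (rule P_cell_eqI) (use \<epsilon> \<epsilon>aL \<epsilon>bL in \<open>simp_all add: lwhisk_rwhisk mult_L\<close>)
  have legs: "(d0 \<cdot> a) \<rhd> \<epsilon> = Id2 K (d0 \<cdot> a)" "(d1 \<cdot> b) \<rhd> \<epsilon> = Id2 K (d1 \<cdot> b)"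
    using \<epsilon> \<epsilon>a \<epsilon>b by (simp_all add: lwhisk_comp)
  have m\<epsilon>: "m0 \<rhd> \<epsilon> = Id2 K m0"
  proof (rule E_cell_eqI)
    show "d1 \<rhd> (m0 \<rhd> \<epsilon>) = d1 \<rhd> Id2 K m0" "d0 \<rhd> (m0 \<rhd> \<epsilon>) = d0 \<rhd> Id2 K m0"
      using \<epsilon> legs by (simp_all flip: lwhisk_comp)
    show "Src K (m0 \<rhd> \<epsilon>) = Src K (Id2 K m0)"
      using \<epsilon> comp_assoc[of m0 L m0] by (simp add: mult_L)
  qed (use \<epsilon> in simp_all)
  show ?thesis
    by (rule adjoint_spansI[OF M_span(2,3,5,6) _ m_span, where \<eta> = "Id2 K (Id1 K E)" and \<epsilon> = \<epsilon>])
      (use \<epsilon> \<epsilon>L m\<epsilon> legs in \<open>simp_all add: span_arr_def cell_def mult_L\<close>)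
qed

text \<open>Dually, the unit is the square from \<open>(\<alpha>, \<beta>)\<close> to \<open>(1, \<alpha>\<beta>)\<close> that is \<open>\<alpha>\<close> on the middle object.\<close>

lemma R_adjoint: "adjoint_arrs (PolyHom K pb B B) m (M, (R, R), MM)"
proof -
  obtain \<eta>a where \<eta>a: "\<eta>a \<in> Cell K" "Src K \<eta>a = a" "Tgt K \<eta>a = u0 \<cdot> d0 \<cdot> a"
    "d1 \<rhd> \<eta>a = l \<lhd> a" "d0 \<rhd> \<eta>a = Id2 K (d0 \<cdot> a)"
    by (rule E_cell_ex[of a "u0 \<cdot> d0 \<cdot> a" "l \<lhd> a" "Id2 K (d0 \<cdot> a)"]) (simp_all add: cell_def)
  obtain \<eta>b where \<eta>b: "\<eta>b \<in> Cell K" "Src K \<eta>b = b" "Tgt K \<eta>b = m0"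
    "d1 \<rhd> \<eta>b = Id2 K (d1 \<cdot> b)" "d0 \<rhd> \<eta>b = l \<lhd> a"
    by (rule E_cell_ex[of b m0 "Id2 K (d1 \<cdot> b)" "l \<lhd> a"]) (simp_all add: cell_def)
  obtain \<eta> where \<eta>: "\<eta> \<in> Cell K" "Src K \<eta> = Id1 K P" "Tgt K \<eta> = R \<cdot> m0"
    "a \<rhd> \<eta> = \<eta>a" "b \<rhd> \<eta> = \<eta>b"
    by (rule P_cell_ex[of "Id1 K P" "R \<cdot> m0" \<eta>a \<eta>b]) (use \<eta>a \<eta>b in \<open>simp_all add: cell_def\<close>)
  have w: "(l \<lhd> a) \<lhd> R = Id2 K d0"
    using rwhisk_comp[of l R a] by simp
  have \<eta>aR: "\<eta>a \<lhd> R = Id2 K (u0 \<cdot> d0)"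
    by (rule E_cell_eqI) (use \<eta>a w in \<open>simp_all add: lwhisk_rwhisk mult_R\<close>)
  have \<eta>bR: "\<eta>b \<lhd> R = Id2 K (Id1 K E)"
    by (rule E_cell_eqI) (use \<eta>b w in \<open>simp_all add: lwhisk_rwhisk mult_R\<close>)
  have \<eta>R: "\<eta> \<lhd> R = Id2 K R"
    by (rule P_cell_eqI) (use \<eta> \<eta>aR \<eta>bR in \<open>simp_all add: lwhisk_rwhisk mult_R\<close>)
  have legs: "(d0 \<cdot> a) \<rhd> \<eta> = Id2 K (d0 \<cdot> a)" "(d1 \<cdot> b) \<rhd> \<eta> = Id2 K (d1 \<cdot> b)"
    using \<eta> \<eta>a \<eta>b by (simp_all add: lwhisk_comp)
  have m\<eta>: "m0 \<rhd> \<eta> = Id2 K m0"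
  proof (rule E_cell_eqI)
    show "d1 \<rhd> (m0 \<rhd> \<eta>) = d1 \<rhd> Id2 K m0" "d0 \<rhd> (m0 \<rhd> \<eta>) = d0 \<rhd> Id2 K m0"
      using \<eta> legs by (simp_all flip: lwhisk_comp)
    show "Tgt K (m0 \<rhd> \<eta>) = Tgt K (Id2 K m0)"
      using \<eta> comp_assoc[of m0 R m0] by (simp add: mult_R)
  qed (use \<eta> in simp_all)
  show ?thesis
    by (rule adjoint_spansI[OF M_span(3,2,6,5) m_span, where \<eta> = \<eta> and \<epsilon> = "Id2 K (Id1 K E)"])
      (use \<eta> \<eta>R m\<eta> legs in \<open>simp_all add: span_arr_def cell_def mult_R\<close>)
qed

theorem colax: "colax_idempotent K pb B M u m"
  unfolding colax_idempotent_def Let_def unit_left_L unit_right_R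
  using L_adjoint R_adjoint by simp

section \<open>The 2-monad of the span\<close>

text \<open>An arrow into the pullback of \<open>d0\<close> and \<open>f\<close> is an arrow \<open>z\<close> into \<open>E\<close> with a factorization of
  \<open>d0 \<cdot> z\<close> through \<open>f\<close>, that is, a 2-cell whose codomain factors through \<open>f\<close>.\<close>

lemma comma_of_pullback:
  assumes "is_pullback K d0 f (c, d)"
  shows "is_comma K (Id1 K B) f (d1 \<cdot> c, d, l \<lhd> c)"
proof -
  note D = pullbackD[OF assms]
  have f: "f \<in> Arr K" "Cod K f = B" and c: "c \<in> Arr K" "Cod K c = E"
    and d: "d \<in> Arr K" "Dom K d = Dom K c" "Cod K d = Dom K f" and sq: "f \<cdot> d = d0 \<cdot> c"
    using D by simp_all
  have 1: "\<exists>!w. arr K w X (Dom K (d1 \<cdot> c)) \<and> (d1 \<cdot> c) \<cdot> w = x \<and> d \<cdot> w = y \<and> (l \<lhd> c) \<lhd> w = \<sigma>"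
    if "arr K x X (Dom K (Id1 K B))" "arr K y X (Dom K f)" "cell K \<sigma> (Id1 K B \<cdot> x) (f \<cdot> y)" for X x y \<sigma>
  proof -
    have xy: "x \<in> Arr K" "Dom K x = X" "Cod K x = B" "y \<in> Arr K" "Dom K y = X" "Cod K y = Dom K f"
      "\<sigma> \<in> Cell K" "Src K \<sigma> = x" "Tgt K \<sigma> = f \<cdot> y"
      using that by (simp_all add: arr_def cell_def)
    have "\<exists>!z. arr K z X (Dom K d1) \<and> d1 \<cdot> z = x \<and> d0 \<cdot> z = f \<cdot> y \<and> l \<lhd> z = \<sigma>"
      by (rule comma_arr_ex1[OF comma]) (use xy f in \<open>simp_all add: arr_def cell_def\<close>)
    then obtain z where z: "z \<in> Arr K" "Dom K z = X" "Cod K z = E" "d1 \<cdot> z = x" "d0 \<cdot> z = f \<cdot> y"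
      "l \<lhd> z = \<sigma>"
      by (auto simp: arr_def)
    have ex: "\<exists>!w. arr K w X (Dom K c) \<and> c \<cdot> w = z \<and> d \<cdot> w = y"
      by (rule pullback_arr_ex1[OF assms]) (use z xy in \<open>simp_all add: arr_def\<close>)
    then obtain w where w: "arr K w X (Dom K c)" "c \<cdot> w = z" "d \<cdot> w = y"
      by blast
    show ?thesis
    proof (rule ex1I[of _ w])
      show "arr K w X (Dom K (d1 \<cdot> c)) \<and> (d1 \<cdot> c) \<cdot> w = x \<and> d \<cdot> w = y \<and> (l \<lhd> c) \<lhd> w = \<sigma>"
        using w z c by (simp add: arr_def flip: rwhisk_comp)
      fix v assume v: "arr K v X (Dom K (d1 \<cdot> c)) \<and> (d1 \<cdot> c) \<cdot> v = x \<and> d \<cdot> v = y \<and> (l \<lhd> c) \<lhd> v = \<sigma>"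
      then have v0: "v \<in> Arr K" "Dom K v = X" "Cod K v = Dom K c" "d \<cdot> v = y" "(d1 \<cdot> c) \<cdot> v = x"
        "(l \<lhd> c) \<lhd> v = \<sigma>"
        using c by (simp_all add: arr_def del: comp_assoc)
      then have v': "v \<in> Arr K" "Dom K v = X" "Cod K v = Dom K c" "d \<cdot> v = y" "d1 \<cdot> c \<cdot> v = x"
        "l \<lhd> (c \<cdot> v) = \<sigma>"
        using c by (simp_all add: rwhisk_comp)
      have "d0 \<cdot> c \<cdot> v = f \<cdot> y"
        using comp_assoc[of v d f] comp_assoc[of v c d0] v'(1-4) f d c sq by simp
      then have "c \<cdot> v = z"
        by (intro E_eqI[of "c \<cdot> v" z]) (use v' z c in simp_all)
      then show "v = w"
        using ex w v' by (auto simp: arr_def)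
    qed
  qed
  have 2: "\<exists>!\<gamma>. cell K \<gamma> h k \<and> (d1 \<cdot> c) \<rhd> \<gamma> = \<alpha> \<and> d \<rhd> \<gamma> = \<beta>"
    if "arr K h X (Dom K (d1 \<cdot> c))" "arr K k X (Dom K (d1 \<cdot> c))"
      "cell K \<alpha> ((d1 \<cdot> c) \<cdot> h) ((d1 \<cdot> c) \<cdot> k)" "cell K \<beta> (d \<cdot> h) (d \<cdot> k)"
      and compat: "(f \<rhd> \<beta>) \<bullet> ((l \<lhd> c) \<lhd> h) = ((l \<lhd> c) \<lhd> k) \<bullet> (Id1 K B \<rhd> \<alpha>)" for X h k \<alpha> \<beta>
  proof -
    have hk: "h \<in> Arr K" "Dom K h = X" "Cod K h = Dom K c" "k \<in> Arr K" "Dom K k = X" "Cod K k = Dom K c"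
      "\<alpha> \<in> Cell K" "Src K \<alpha> = d1 \<cdot> c \<cdot> h" "Tgt K \<alpha> = d1 \<cdot> c \<cdot> k" "\<beta> \<in> Cell K" "Src K \<beta> = d \<cdot> h"
      "Tgt K \<beta> = d \<cdot> k"
      using that c by (simp_all add: arr_def cell_def)
    have sq': "f \<cdot> d \<cdot> h = d0 \<cdot> c \<cdot> h" "f \<cdot> d \<cdot> k = d0 \<cdot> c \<cdot> k"
      using comp_assoc[of h d f] comp_assoc[of h c d0] comp_assoc[of k d f] comp_assoc[of k c d0] hk(1-6)
        f d c sq by simp_all
    \<comment> \<open>\<open>\<alpha>\<close> and \<open>f \<rhd> \<beta>\<close> form a square, hence a 2-cell between arrows into \<open>E\<close>, which then lifts to the
      pullback together with \<open>\<beta>\<close>\<close>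
    obtain \<delta> where \<delta>: "\<delta> \<in> Cell K" "Src K \<delta> = c \<cdot> h" "Tgt K \<delta> = c \<cdot> k" "d1 \<rhd> \<delta> = \<alpha>"
      "d0 \<rhd> \<delta> = f \<rhd> \<beta>"
      by (rule E_cell_ex[of "c \<cdot> h" "c \<cdot> k" \<alpha> "f \<rhd> \<beta>"])
        (use hk sq' f c d compat in \<open>simp_all add: cell_def rwhisk_comp\<close>)
    have ex: "\<exists>!\<gamma>. cell K \<gamma> h k \<and> c \<rhd> \<gamma> = \<delta> \<and> d \<rhd> \<gamma> = \<beta>"
      by (rule pullback_cell_ex1[OF assms, of h X]) (use \<delta> hk in \<open>simp_all add: arr_def cell_def\<close>)
    then obtain \<gamma> where \<gamma>: "cell K \<gamma> h k" "c \<rhd> \<gamma> = \<delta>" "d \<rhd> \<gamma> = \<beta>"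
      by blast
    show ?thesis
    proof (rule ex1I[of _ \<gamma>])
      show "cell K \<gamma> h k \<and> (d1 \<cdot> c) \<rhd> \<gamma> = \<alpha> \<and> d \<rhd> \<gamma> = \<beta>"
        using \<gamma> \<delta> c hk by (simp add: cell_def lwhisk_comp)
      fix \<gamma>' assume \<gamma>'': "cell K \<gamma>' h k \<and> (d1 \<cdot> c) \<rhd> \<gamma>' = \<alpha> \<and> d \<rhd> \<gamma>' = \<beta>"
      then have \<gamma>0: "\<gamma>' \<in> Cell K" "Src K \<gamma>' = h" "Tgt K \<gamma>' = k" "(d1 \<cdot> c) \<rhd> \<gamma>' = \<alpha>" "d \<rhd> \<gamma>' = \<beta>"
        by (simp_all add: cell_def)
      then have \<gamma>': "\<gamma>' \<in> Cell K" "Src K \<gamma>' = h" "Tgt K \<gamma>' = k" "d1 \<rhd> (c \<rhd> \<gamma>') = \<alpha>" "d \<rhd> \<gamma>' = \<beta>"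
        using c hk by (simp_all add: lwhisk_comp)
      have "(d0 \<cdot> c) \<rhd> \<gamma>' = (f \<cdot> d) \<rhd> \<gamma>'"
        by (simp add: sq)
      then have "d0 \<rhd> (c \<rhd> \<gamma>') = f \<rhd> (d \<rhd> \<gamma>')"
        using \<gamma>'(1-3) hk f c d by (simp add: lwhisk_comp del: lwhisk_typ)
      then have "c \<rhd> \<gamma>' = \<delta>"
        by (intro E_cell_eqI[of "c \<rhd> \<gamma>'" \<delta>]) (use \<gamma>' \<delta> hk c in simp_all)
      then show "\<gamma>' = \<gamma>"
        using ex \<gamma> \<gamma>'' by blast
    qed
  qed
  have 3: "Dom K (Id1 K B) = B" "Cod K (Id1 K B) = B" "Id1 K B \<in> Arr K"
    by simp_all
  show ?thesis
    unfolding is_comma_def prod.case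
  proof (intro conjI)
    show "\<forall>X u v \<sigma>. arr K u X (Dom K (Id1 K B)) \<and> arr K v X (Dom K f) \<and> cell K \<sigma> (Id1 K B \<cdot> u) (f \<cdot> v) \<longrightarrow>
      (\<exists>!w. arr K w X (Dom K (d1 \<cdot> c)) \<and> (d1 \<cdot> c) \<cdot> w = u \<and> d \<cdot> w = v \<and> (l \<lhd> c) \<lhd> w = \<sigma>)"
      by (intro allI impI, elim conjE, rule 1; assumption)
    show "\<forall>X h k \<alpha> \<beta>. arr K h X (Dom K (d1 \<cdot> c)) \<and> arr K k X (Dom K (d1 \<cdot> c)) \<and>
      cell K \<alpha> ((d1 \<cdot> c) \<cdot> h) ((d1 \<cdot> c) \<cdot> k) \<and> cell K \<beta> (d \<cdot> h) (d \<cdot> k) \<and>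
      (f \<rhd> \<beta>) \<bullet> ((l \<lhd> c) \<lhd> h) = ((l \<lhd> c) \<lhd> k) \<bullet> (Id1 K B \<rhd> \<alpha>) \<longrightarrow>
      (\<exists>!\<gamma>. cell K \<gamma> h k \<and> (d1 \<cdot> c) \<rhd> \<gamma> = \<alpha> \<and> d \<rhd> \<gamma> = \<beta>)"
      by (intro allI impI, elim conjE, rule 2; assumption)
  qed (use f c d sq in \<open>simp_all add: cell_def\<close>)
qed

sublocale bc: base_change K pb d0
  using pb by unfold_locales simp_all

abbreviation "P_act \<equiv> bc.act"
abbreviation "P_act2 \<equiv> bc.act2"
abbreviation "P_e f \<equiv> fst (snd (Unit (P_monad K pb B M u m) f))"
abbreviation "P_m f \<equiv> fst (snd (Mult (P_monad K pb B M u m) f))"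
abbreviation "P_ob f \<equiv> d1 \<cdot> bc.D f"
abbreviation "P_lam f \<equiv> l \<lhd> bc.D f"

lemma P_fun_M: "onO (P_fun K pb M) f = P_ob f"
  by (simp add: P_fun_def comp_fun_def Sigma_fun_def Delta_fun_def)

lemma P_unit_eqs:
  assumes f: "f \<in> Arr K" "Cod K f = B"
  shows "P_e f \<in> Arr K" "Dom K (P_e f) = Dom K f" "Cod K (P_e f) = Dom K (bc.D f)"
    "bc.D f \<cdot> P_e f = u0 \<cdot> f" "bc.r f \<cdot> P_e f = Id1 K (Dom K f)"
proof -
  let ?c = "fst (pb (Id1 K B) f)" and ?d = "snd (pb (Id1 K B) f)"
  define x where "x = pb_arr K (pb (Id1 K B) f) f (Id1 K (Dom K f))"
  define y where "y = pb_arr K (pb d0 f) (u0 \<cdot> ?c) ?d"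
  have e: "P_e f = y \<cdot> x"
    by (simp add: P_monad_def P_nat_def P_unit_def id_span_def x_def y_def)
  have cd: "?c \<in> Arr K" "?d \<in> Arr K" "Dom K ?d = Dom K ?c" "Cod K ?c = B" "Cod K ?d = Dom K f" "f \<cdot> ?d = ?c"
    using pullbackD[OF pullback[of "Id1 K B" f]] f by simp_all
  have x: "x \<in> Arr K" "Dom K x = Dom K f" "Cod K x = Dom K ?c" "?c \<cdot> x = f" "?d \<cdot> x = Id1 K (Dom K f)"
    using pb_arr_eq[OF pullback[of "Id1 K B" f], of f "Dom K f" "Id1 K (Dom K f)"] f
    by (simp_all add: arr_def x_def)
  have y: "y \<in> Arr K" "Dom K y = Dom K ?c" "Cod K y = Dom K (bc.D f)" "bc.D f \<cdot> y = u0 \<cdot> ?c" "bc.r f \<cdot> y = ?d"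
    using pb_arr_eq[OF bc.pullback[of f], of "u0 \<cdot> ?c" "Dom K ?c" ?d] f cd
    by (simp_all add: arr_def y_def)
  show "P_e f \<in> Arr K" "Dom K (P_e f) = Dom K f" "Cod K (P_e f) = Dom K (bc.D f)"
    "bc.D f \<cdot> P_e f = u0 \<cdot> f" "bc.r f \<cdot> P_e f = Id1 K (Dom K f)"
    unfolding e using x y cd f comp_assoc[of x y "bc.D f"] comp_assoc[of x y "bc.r f"] by simp_all
qed

text \<open>Here \<open>w\<close> is the composable pair that underlies an iterated pullback: its outer projection \<open>bc.D\<close>
  to \<open>E\<close> is the first member and the inner one the second.\<close>

lemma P_mult_eqs:
  assumes f: "f \<in> Arr K" "Cod K f = B"
  shows "P_m f \<in> Arr K" "Dom K (P_m f) = Dom K (bc.D (P_ob f))" "Cod K (P_m f) = Dom K (bc.D f)"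
    "\<exists>w. w \<in> Arr K \<and> Dom K w = Dom K (bc.D (P_ob f)) \<and> Cod K w = P \<and>
      a \<cdot> w = bc.D f \<cdot> bc.r (P_ob f) \<and> b \<cdot> w = bc.D (P_ob f) \<and> bc.D f \<cdot> P_m f = m0 \<cdot> w"
    "bc.r f \<cdot> P_m f = bc.r f \<cdot> bc.r (P_ob f)"
proof -
  let ?k = "P_ob f" and ?c = "fst (pb (d0 \<cdot> a) f)" and ?d = "snd (pb (d0 \<cdot> a) f)"
  define w where "w = pb_arr K (pb d1 d0) (bc.D f \<cdot> bc.r ?k) (bc.D ?k)"
  define x where "x = pb_arr K (pb (d0 \<cdot> a) f) w (bc.r f \<cdot> bc.r ?k)"
  define y where "y = pb_arr K (pb d0 f) (m0 \<cdot> ?c) ?d"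
  have k: "?k \<in> Arr K" "Cod K ?k = B"
    using f by simp_all
  have m: "P_m f = y \<cdot> x"
    by (simp add: P_monad_def P_nat_def P_comp_def Let_def P_fun_M MM_eq span_pb_def w_def x_def y_def)
  have cd: "?c \<in> Arr K" "?d \<in> Arr K" "Dom K ?d = Dom K ?c" "Cod K ?c = P" "Cod K ?d = Dom K f"
    "f \<cdot> ?d = d0 \<cdot> a \<cdot> ?c"
    using pullbackD[OF pullback[of "d0 \<cdot> a" f]] f by simp_all
  have sq: "d0 \<cdot> bc.D f \<cdot> bc.r ?k = f \<cdot> bc.r f \<cdot> bc.r ?k"
    using bc.square[of f] comp_assoc[of "bc.r ?k" "bc.D f" d0] comp_assoc[of "bc.r ?k" "bc.r f" f] f k by simp
  have sq': "d0 \<cdot> bc.D ?k = d1 \<cdot> bc.D f \<cdot> bc.r ?k"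
    using bc.square[of ?k] f k by simp
  have w: "w \<in> Arr K" "Dom K w = Dom K (bc.D ?k)" "Cod K w = P" "a \<cdot> w = bc.D f \<cdot> bc.r ?k" "b \<cdot> w = bc.D ?k"
    using pair_eqs[of "bc.D f \<cdot> bc.r ?k" "bc.D ?k"] f k sq' by (simp_all add: w_def)
  have x: "x \<in> Arr K" "Dom K x = Dom K (bc.D ?k)" "Cod K x = Dom K ?c" "?c \<cdot> x = w"
    "?d \<cdot> x = bc.r f \<cdot> bc.r ?k"
    using pb_arr_eq[OF pullback[of "d0 \<cdot> a" f], of w "Dom K (bc.D ?k)" "bc.r f \<cdot> bc.r ?k"] f k w sq
    by (simp_all add: arr_def x_def)
  have y: "y \<in> Arr K" "Dom K y = Dom K ?c" "Cod K y = Dom K (bc.D f)" "bc.D f \<cdot> y = m0 \<cdot> ?c" "bc.r f \<cdot> y = ?d"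
    using pb_arr_eq[OF bc.pullback[of f], of "m0 \<cdot> ?c" "Dom K ?c" ?d] f cd
    by (simp_all add: arr_def y_def)
  have "bc.D f \<cdot> P_m f = m0 \<cdot> w"
    unfolding m using x y cd f comp_assoc[of x y "bc.D f"] by simp
  then show "\<exists>w. w \<in> Arr K \<and> Dom K w = Dom K (bc.D (P_ob f)) \<and> Cod K w = P \<and>
      a \<cdot> w = bc.D f \<cdot> bc.r (P_ob f) \<and> b \<cdot> w = bc.D (P_ob f) \<and> bc.D f \<cdot> P_m f = m0 \<cdot> w"
    using w by blast
  show "P_m f \<in> Arr K" "Dom K (P_m f) = Dom K (bc.D (P_ob f))" "Cod K (P_m f) = Dom K (bc.D f)"
    "bc.r f \<cdot> P_m f = bc.r f \<cdot> bc.r (P_ob f)"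
    unfolding m using x y cd f k comp_assoc[of x y "bc.r f"] by simp_all
qed

text \<open>The equations for the unit and the multiplication reduce to those that define \<open>u0\<close> and \<open>m0\<close>.\<close>

lemma P_comma_monad:
  "comma_monad K B P_ob bc.r P_lam P_act P_act2 P_e P_m"
proof unfold_locales
  show "is_comma K (Id1 K B) f (P_ob f, bc.r f, P_lam f)" if "f \<in> Arr K" "Cod K f = B" for f
    using comma_of_pullback[OF bc.pullback[of f]] that by simp
  show "arr K (P_act f h g) (Dom K (P_ob f)) (Dom K (P_ob g)) \<and>
      P_ob g \<cdot> P_act f h g = P_ob f \<and> bc.r g \<cdot> P_act f h g = h \<cdot> bc.r f \<and> P_lam g \<lhd> P_act f h g = P_lam f"
    if "over K B f h g" for f h g
    using that overD[OF that] by (simp add: arr_def flip: rwhisk_comp)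
  show "cell K (P_act2 f \<alpha> g) (P_act f (Src K \<alpha>) g) (P_act f (Tgt K \<alpha>) g) \<and>
      P_ob g \<rhd> P_act2 f \<alpha> g = Id2 K (P_ob f) \<and> bc.r g \<rhd> P_act2 f \<alpha> g = \<alpha> \<lhd> bc.r f"
    if o: "over_cell K B f \<alpha> g" for f \<alpha> g
  proof -
    note o1 = over_cellD[OF o]
    show ?thesis
      using bc.act2_eqs[of f \<alpha> g] o o1 overD[OF o1(2)] overD[OF o1(3)]
      by (simp add: cell_def lwhisk_comp)
  qed
  show "arr K (P_e f) (Dom K f) (Dom K (P_ob f)) \<and>
      P_ob f \<cdot> P_e f = f \<and> bc.r f \<cdot> P_e f = Id1 K (Dom K f) \<and> P_lam f \<lhd> P_e f = Id2 K f"
    if f: "f \<in> Arr K" "Cod K f = B" for f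
    using P_unit_eqs[OF f] f by (simp add: arr_def flip: rwhisk_comp)
  show "arr K (P_m f) (Dom K (P_ob (P_ob f))) (Dom K (P_ob f)) \<and>
      P_ob f \<cdot> P_m f = P_ob (P_ob f) \<and> bc.r f \<cdot> P_m f = bc.r f \<cdot> bc.r (P_ob f) \<and>
      P_lam f \<lhd> P_m f = (P_lam f \<lhd> bc.r (P_ob f)) \<bullet> P_lam (P_ob f)"
    if f: "f \<in> Arr K" "Cod K f = B" for f
  proof -
    note e = P_mult_eqs[OF f]
    obtain w where "w \<in> Arr K" "Dom K w = Dom K (bc.D (P_ob f))" "Cod K w = P"
      "a \<cdot> w = bc.D f \<cdot> bc.r (P_ob f)" "b \<cdot> w = bc.D (P_ob f)" "bc.D f \<cdot> P_m f = m0 \<cdot> w"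
      using e(4) by blast
    then show ?thesis
      using e(1,2,3,5) f by (simp add: arr_def flip: rwhisk_comp)
  qed
qed

lemma P_monad_eq: "comma_monad.monad P_ob P_act P_act2 P_e P_m = P_monad K pb B M u m"
  unfolding comma_monad.monad_def[OF P_comma_monad]
  by (auto simp: P_monad_def P_fun_def Sigma_fun_def Delta_fun_def comp_fun_def P_nat_def P_unit_def
      P_comp_def Let_def MM_eq id_span_def fun_eq_iff)

theorem P_monad_iso:
  assumes "comma_monad K B Phi q lam act act2 e m'"
  shows "two_monads_iso (slice K B) (P_monad K pb B M u m) (comma_monad.monad Phi act act2 e m')"
proof -
  interpret pair: comma_monad_pair K B P_ob bc.r P_lam P_act P_act2 P_e P_m Phi q lam act act2 e m'
    using P_comma_monad assms by (simp add: comma_monad_pair_def two_category_axioms)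
  show ?thesis
    using pair.iso by (simp only: P_monad_eq)
qed

end

section \<open>Reversing 2-cells\<close>

definition co :: "('o, 'a, 'c) two_cat \<Rightarrow> ('o, 'a, 'c) two_cat" where
  "co K = K\<lparr>Src := Tgt K, Tgt := Src K, VComp := (\<lambda>\<beta> \<alpha>. \<alpha> \<bullet>\<^bsub>K\<^esub> \<beta>)\<rparr>"

lemma co_sel [simp]:
  "Obj (co K) = Obj K" "Arr (co K) = Arr K" "Cell (co K) = Cell K" "Dom (co K) = Dom K"
  "Cod (co K) = Cod K" "Src (co K) = Tgt K" "Tgt (co K) = Src K" "Id1 (co K) = Id1 K"
  "Comp (co K) = Comp K" "Id2 (co K) = Id2 K" "VComp (co K) \<beta> \<alpha> = \<alpha> \<bullet>\<^bsub>K\<^esub> \<beta>"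
  "HComp (co K) = HComp K"
  by (simp_all add: co_def)

lemma co_co [simp]: "co (co K) = K"
  by (simp add: co_def)

lemma co_basic [simp]:
  "arr (co K) = arr K" "cell (co K) \<alpha> f g \<longleftrightarrow> cell K \<alpha> g f"
  "g \<rhd>\<^bsub>co K\<^esub> \<alpha> = g \<rhd>\<^bsub>K\<^esub> \<alpha>" "\<alpha> \<lhd>\<^bsub>co K\<^esub> f = \<alpha> \<lhd>\<^bsub>K\<^esub> f"
  by (auto simp: fun_eq_iff arr_def cell_def lwhisk_def rwhisk_def)

lemma two_category_co:
  assumes "two_category K"
  shows "two_category (co K)"
proof -
  interpret two_category K by (rule assms)
  have ic: "HComp K (VComp K \<beta> \<beta>') (VComp K \<alpha> \<alpha>') = VComp K (HComp K \<beta> \<alpha>) (HComp K \<beta>' \<alpha>')"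
    if "\<alpha> \<in> Cell K" "\<beta> \<in> Cell K" "Dom K (Src K \<beta>) = Cod K (Src K \<alpha>)" "\<alpha>' \<in> Cell K" "Tgt K \<alpha>' = Src K \<alpha>"
      "\<beta>' \<in> Cell K" "Tgt K \<beta>' = Src K \<beta>" for \<alpha> \<alpha>' \<beta> \<beta>'
    using that src_tgt(3)[of \<beta>'] src_tgt(4)[of \<alpha>'] by (intro interchange') simp_all
  show ?thesis
    by unfold_locales (auto simp: arr_def cell_def hcomp_assoc id2_hcomp_id2 ic
        whisk_id1[unfolded lwhisk_def rwhisk_def])
qed

lemma is_pullback_co [simp]: "is_pullback (co K) = is_pullback K"
proof -
  have 1: "is_pullback K f g (p, q)" if "is_pullback (co K) f g (p, q)" for K :: "('o, 'a, 'c) two_cat" and f g p q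
    using that unfolding is_pullback_def prod.case co_sel co_basic by blast
  show ?thesis
    using 1[of K] 1[of "co K"] by (auto simp: fun_eq_iff)
qed

lemma is_comma_co:
  assumes "is_comma K f g (p, q, l)"
  shows "is_comma (co K) g f (q, p, l)"
proof -
  have 1: "\<exists>!w. arr K w X (Dom K q) \<and> q \<cdot>\<^bsub>K\<^esub> w = u \<and> p \<cdot>\<^bsub>K\<^esub> w = v \<and> l \<lhd>\<^bsub>K\<^esub> w = \<sigma>"
    if "arr K u X (Dom K g)" "arr K v X (Dom K f)" "cell K \<sigma> (f \<cdot>\<^bsub>K\<^esub> v) (g \<cdot>\<^bsub>K\<^esub> u)" for X u v \<sigma>
  proof -
    have "Dom K p = Dom K q"
      using assms by (simp add: is_comma_def)
    moreover have "\<exists>!w. arr K w X (Dom K p) \<and> p \<cdot>\<^bsub>K\<^esub> w = v \<and> q \<cdot>\<^bsub>K\<^esub> w = u \<and> l \<lhd>\<^bsub>K\<^esub> w = \<sigma>"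
      using assms that unfolding is_comma_def prod.case by blast
    ultimately show ?thesis by (simp add: conj_commute conj_left_commute)
  qed
  have 2: "\<exists>!\<gamma>. cell K \<gamma> k h \<and> q \<rhd>\<^bsub>K\<^esub> \<gamma> = \<alpha> \<and> p \<rhd>\<^bsub>K\<^esub> \<gamma> = \<beta>"
    if "arr K h X (Dom K q)" "arr K k X (Dom K q)" "cell K \<alpha> (q \<cdot>\<^bsub>K\<^esub> k) (q \<cdot>\<^bsub>K\<^esub> h)"
      "cell K \<beta> (p \<cdot>\<^bsub>K\<^esub> k) (p \<cdot>\<^bsub>K\<^esub> h)"
      "(l \<lhd>\<^bsub>K\<^esub> h) \<bullet>\<^bsub>K\<^esub> (f \<rhd>\<^bsub>K\<^esub> \<beta>) = (g \<rhd>\<^bsub>K\<^esub> \<alpha>) \<bullet>\<^bsub>K\<^esub> (l \<lhd>\<^bsub>K\<^esub> k)" for X h k \<alpha> \<beta>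
  proof -
    have "Dom K p = Dom K q"
      using assms by (simp add: is_comma_def)
    then have "arr K k X (Dom K p)" "arr K h X (Dom K p)"
      "(g \<rhd>\<^bsub>K\<^esub> \<alpha>) \<bullet>\<^bsub>K\<^esub> (l \<lhd>\<^bsub>K\<^esub> k) = (l \<lhd>\<^bsub>K\<^esub> h) \<bullet>\<^bsub>K\<^esub> (f \<rhd>\<^bsub>K\<^esub> \<beta>)"
      using that by simp_all
    then have "\<exists>!\<gamma>. cell K \<gamma> k h \<and> p \<rhd>\<^bsub>K\<^esub> \<gamma> = \<beta> \<and> q \<rhd>\<^bsub>K\<^esub> \<gamma> = \<alpha>"
      using assms that(3,4) unfolding is_comma_def prod.case by blast
    then show ?thesis by (simp add: conj_commute conj_left_commute)
  qed
  show ?thesis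
    unfolding is_comma_def prod.case co_sel co_basic
  proof (intro conjI)
    show "\<forall>X u v \<sigma>. arr K u X (Dom K g) \<and> arr K v X (Dom K f) \<and> cell K \<sigma> (f \<cdot>\<^bsub>K\<^esub> v) (g \<cdot>\<^bsub>K\<^esub> u) \<longrightarrow>
      (\<exists>!w. arr K w X (Dom K q) \<and> q \<cdot>\<^bsub>K\<^esub> w = u \<and> p \<cdot>\<^bsub>K\<^esub> w = v \<and> l \<lhd>\<^bsub>K\<^esub> w = \<sigma>)"
      by (intro allI impI, elim conjE, rule 1; assumption)
    show "\<forall>X h k \<alpha> \<beta>. arr K h X (Dom K q) \<and> arr K k X (Dom K q) \<and>
      cell K \<alpha> (q \<cdot>\<^bsub>K\<^esub> k) (q \<cdot>\<^bsub>K\<^esub> h) \<and> cell K \<beta> (p \<cdot>\<^bsub>K\<^esub> k) (p \<cdot>\<^bsub>K\<^esub> h) \<and>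
      (l \<lhd>\<^bsub>K\<^esub> h) \<bullet>\<^bsub>K\<^esub> (f \<rhd>\<^bsub>K\<^esub> \<beta>) = (g \<rhd>\<^bsub>K\<^esub> \<alpha>) \<bullet>\<^bsub>K\<^esub> (l \<lhd>\<^bsub>K\<^esub> k) \<longrightarrow>
      (\<exists>!\<gamma>. cell K \<gamma> k h \<and> q \<rhd>\<^bsub>K\<^esub> \<gamma> = \<alpha> \<and> p \<rhd>\<^bsub>K\<^esub> \<gamma> = \<beta>)"
      by (intro allI impI, elim conjE, rule 2; assumption)
  qed (use assms in \<open>simp_all add: is_comma_def\<close>)
qed

lemma pb_arr_co [simp]: "pb_arr (co K) = pb_arr K"
  by (simp add: pb_arr_def fun_eq_iff)

lemma pb_cell_co [simp]: "pb_cell (co K) pq h k = pb_cell K pq k h"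
  by (simp add: pb_cell_def fun_eq_iff split_beta)

lemma cm_arr_co:
  assumes "Dom K p = Dom K q" "Dom K u = Dom K v"
  shows "cm_arr (co K) (p, q, l) u v \<sigma> = cm_arr K (q, p, l) v u \<sigma>"
  using assms by (auto simp: cm_arr_def intro: arg_cong[where f = The])

lemma cm_cell_co: "cm_cell (co K) (p, q, l) h k \<alpha> \<beta> = cm_cell K (q, p, l) k h \<beta> \<alpha>"
  by (auto simp: cm_cell_def intro: arg_cong[where f = The])

text \<open>Forming a slice commutes with reversing 2-cells, except that
  the value of the vertical composition at 2-cells that are not composable may change: its source and
  target are read off from one of the two arguments.  Hence the relation \<open>co_dual\<close> between 2-categories
  instead of an equation with \<open>co\<close>.  Its last clause serves for the conditions on 2-functors and
  2-natural transformations that read off the endpoints of a 2-cell from its source: in the dual they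
  are read off from what was its target.\<close>

definition co_dual :: "('o, 'a, 'c) two_cat \<Rightarrow> ('o, 'a, 'c) two_cat \<Rightarrow> bool" where
  "co_dual L L' \<longleftrightarrow> Obj L' = Obj L \<and> Arr L' = Arr L \<and> Cell L' = Cell L \<and> Dom L' = Dom L \<and>
     Cod L' = Cod L \<and> Src L' = Tgt L \<and> Tgt L' = Src L \<and> Id1 L' = Id1 L \<and> Comp L' = Comp L \<and>
     Id2 L' = Id2 L \<and> HComp L' = HComp L \<and>
     (\<forall>\<alpha> \<beta> f g h. cell L \<alpha> f g \<and> cell L \<beta> g h \<longrightarrow> \<alpha> \<bullet>\<^bsub>L'\<^esub> \<beta> = \<beta> \<bullet>\<^bsub>L\<^esub> \<alpha>) \<and>
     (\<forall>\<alpha> f g A B. cell L \<alpha> f g \<longrightarrow> arr L f A B \<longleftrightarrow> arr L g A B)"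

lemma co_dual_basic:
  assumes "co_dual L L'"
  shows "arr L' = arr L" "cell L' \<alpha> f g \<longleftrightarrow> cell L \<alpha> g f"
    "g \<rhd>\<^bsub>L'\<^esub> \<alpha> = g \<rhd>\<^bsub>L\<^esub> \<alpha>" "\<alpha> \<lhd>\<^bsub>L'\<^esub> f = \<alpha> \<lhd>\<^bsub>L\<^esub> f"
    "Obj L' = Obj L" "Arr L' = Arr L" "Dom L' = Dom L" "Cod L' = Cod L" "Id1 L' = Id1 L"
    "Comp L' = Comp L" "Id2 L' = Id2 L" "HComp L' = HComp L"
    "cell L \<alpha> f g \<Longrightarrow> cell L \<beta> g h \<Longrightarrow> \<alpha> \<bullet>\<^bsub>L'\<^esub> \<beta> = \<beta> \<bullet>\<^bsub>L\<^esub> \<alpha>"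
    "cell L \<alpha> f g \<Longrightarrow> arr L f A B \<longleftrightarrow> arr L g A B"
proof -
  have *: "Obj L' = Obj L" "Arr L' = Arr L" "Dom L' = Dom L" "Cod L' = Cod L" "Id1 L' = Id1 L"
    "Comp L' = Comp L" "Id2 L' = Id2 L" "HComp L' = HComp L" "Cell L' = Cell L" "Src L' = Tgt L"
    "Tgt L' = Src L"
    using assms by (simp_all add: co_dual_def)
  then show "arr L' = arr L" "cell L' \<alpha> f g \<longleftrightarrow> cell L \<alpha> g f"
    "g \<rhd>\<^bsub>L'\<^esub> \<alpha> = g \<rhd>\<^bsub>L\<^esub> \<alpha>" "\<alpha> \<lhd>\<^bsub>L'\<^esub> f = \<alpha> \<lhd>\<^bsub>L\<^esub> f"
    "Obj L' = Obj L" "Arr L' = Arr L" "Dom L' = Dom L" "Cod L' = Cod L" "Id1 L' = Id1 L"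
    "Comp L' = Comp L" "Id2 L' = Id2 L" "HComp L' = HComp L"
    by (auto simp: fun_eq_iff arr_def cell_def lwhisk_def rwhisk_def)
  show "cell L \<alpha> f g \<Longrightarrow> cell L \<beta> g h \<Longrightarrow> \<alpha> \<bullet>\<^bsub>L'\<^esub> \<beta> = \<beta> \<bullet>\<^bsub>L\<^esub> \<alpha>"
    "cell L \<alpha> f g \<Longrightarrow> arr L f A B \<longleftrightarrow> arr L g A B"
    using assms unfolding co_dual_def by blast+
qed

lemma co_dual_sym:
  assumes "co_dual L L'"
  shows "co_dual L' L"
proof -
  note d = co_dual_basic[OF assms]
  show ?thesis
    unfolding co_dual_def[of L'] d(1,2)
    using assms d(13,14) by (intro conjI allI impI; (elim conjE)?) (simp_all add: co_dual_def[of L])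
qed

lemma two_functor_co_dualI:
  assumes F: "two_functor K L F" and K: "co_dual K K'" and L: "co_dual L L'"
  shows "two_functor K' L' F"
proof -
  note Kd = co_dual_basic[OF K] and Ld = co_dual_basic[OF L]
  have Fc: "cell L (onC F \<alpha>) (onA F f) (onA F g)" if "cell K \<alpha> f g" for \<alpha> f g
    using F that by (simp add: two_functor_def)
  have Fv: "onC F (\<beta> \<bullet>\<^bsub>K\<^esub> \<alpha>) = onC F \<beta> \<bullet>\<^bsub>L\<^esub> onC F \<alpha>" if "cell K \<alpha> f g" "cell K \<beta> g h" for \<alpha> \<beta> f g h
    using F that unfolding two_functor_def by blast
  have Fh: "onC F (\<beta> \<star>\<^bsub>K\<^esub> \<alpha>) = onC F \<beta> \<star>\<^bsub>L\<^esub> onC F \<alpha>"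
    if "cell K \<alpha> f f'" "cell K \<beta> g g'" "arr K f A B" "arr K g B C" for \<alpha> \<beta> f f' g g' A B C
    using F that unfolding two_functor_def by blast
  have v: "onC F (\<alpha> \<bullet>\<^bsub>K'\<^esub> \<beta>) = onC F \<alpha> \<bullet>\<^bsub>L'\<^esub> onC F \<beta>" if c: "cell K \<alpha> f g" "cell K \<beta> g h" for \<alpha> \<beta> f g h
    using Fv[OF c] Kd(13)[OF c] Ld(13)[OF Fc[OF c(1)] Fc[OF c(2)]] by simp
  have h: "onC F (\<beta> \<star>\<^bsub>K\<^esub> \<alpha>) = onC F \<beta> \<star>\<^bsub>L\<^esub> onC F \<alpha>"
    if c: "cell K \<alpha> f' f" "cell K \<beta> g' g" "arr K f A B" "arr K g B C" for \<alpha> \<beta> f f' g g' A B C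
    using Fh[OF c(1,2)] c(3,4) Kd(14)[OF c(1)] Kd(14)[OF c(2)] by blast
  show ?thesis
    unfolding two_functor_def Kd(1-12) Ld(1-12)
  proof (intro conjI)
    show "\<forall>\<alpha> \<beta> f f' g g' A B C. cell K \<alpha> f' f \<and> cell K \<beta> g' g \<and> arr K f A B \<and> arr K g B C \<longrightarrow>
        onC F (\<beta> \<star>\<^bsub>K\<^esub> \<alpha>) = onC F \<beta> \<star>\<^bsub>L\<^esub> onC F \<alpha>"
      using h by metis
    show "\<forall>\<alpha> \<beta> f g h. cell K \<alpha> g f \<and> cell K \<beta> h g \<longrightarrow>
        onC F (\<beta> \<bullet>\<^bsub>K'\<^esub> \<alpha>) = onC F \<beta> \<bullet>\<^bsub>L'\<^esub> onC F \<alpha>"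
      using v by metis
  qed (use F in \<open>simp_all add: two_functor_def\<close>)
qed

lemma two_functor_co_dual:
  assumes "co_dual K K'" "co_dual L L'"
  shows "two_functor K' L' F \<longleftrightarrow> two_functor K L F"
  using two_functor_co_dualI[OF _ assms]
    two_functor_co_dualI[OF _ co_dual_sym[OF assms(1)] co_dual_sym[OF assms(2)]] by blast

lemma two_nat_co_dual:
  assumes "co_dual K K'" "co_dual L L'"
  shows "two_nat K' L' F G \<tau> \<longleftrightarrow> two_nat K L F G \<tau>"
proof -
  note Kd = co_dual_basic[OF assms(1)] and Ld = co_dual_basic[OF assms(2)]
  have "(\<forall>\<alpha> f g A B. cell K \<alpha> g f \<and> arr K f A B \<longrightarrow> Q \<alpha> A B) \<longleftrightarrow>
      (\<forall>\<alpha> f g A B. cell K \<alpha> f g \<and> arr K f A B \<longrightarrow> Q \<alpha> A B)" for Q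
    using Kd(14) by blast
  then show ?thesis
    unfolding two_nat_def Kd(1-12) Ld(1-12) by simp
qed

lemma has_right_2_adjoint_co_dual:
  assumes "co_dual K K'" "co_dual L L'"
  shows "has_right_2_adjoint K' L' F \<longleftrightarrow> has_right_2_adjoint K L F"
  unfolding has_right_2_adjoint_def two_functor_co_dual[OF assms] two_functor_co_dual[OF assms(2,1)]
    two_nat_co_dual[OF assms(1,1)] two_nat_co_dual[OF assms(2,2)]
    co_dual_basic(1-12)[OF assms(1)] co_dual_basic(1-12)[OF assms(2)] by (rule refl)

lemma two_monads_iso_co_dual:
  assumes "co_dual K K'"
  shows "two_monads_iso K' S T \<longleftrightarrow> two_monads_iso K S T"
  unfolding two_monads_iso_def is_two_monad_def inverse_arrs_def two_functor_co_dual[OF assms assms]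
    two_nat_co_dual[OF assms assms] co_dual_basic(1-12)[OF assms] by (rule refl)

lemma over_co [simp]: "over (co K) = over K"
  by (simp add: over_def fun_eq_iff)

lemma over_cell_co [simp]: "over_cell (co K) = over_cell K"
  by (auto simp: over_cell_def fun_eq_iff)

lemma slice_co_dual:
  assumes "two_category K"
  shows "co_dual (slice K B) (slice (co K) B)"
proof -
  interpret two_category K by (rule assms)
  interpret co: two_category "co K" by (rule two_category_co[OF assms])
  have "Arr (slice (co K) B) = Arr (slice K B)" "Cell (slice (co K) B) = Cell (slice K B)"
    by (auto simp: slice_Arr_iff slice_Cell_iff co.slice_Cell_iff)
  then show ?thesis
    unfolding co_dual_def
    by (auto simp: cell_slice_iff arr_slice_iff over_cell_def)
      (auto simp: slice_def fun_eq_iff)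
qed

lemma Delta_co [simp]: "Delta_fun (co K) pb f = Delta_fun K pb f"
  by (simp add: Delta_fun_def Delta_arr_def fun_eq_iff)

lemma exponentiable_co:
  assumes "two_category K"
  shows "exponentiable (co K) pb f \<longleftrightarrow> exponentiable K pb f"
  by (simp add: exponentiable_def has_right_2_adjoint_co_dual[OF slice_co_dual slice_co_dual] assms)

context two_category
begin

lemma is_poly_co [simp]: "is_poly (co K) = is_poly K"
  by (simp add: is_poly_def fun_eq_iff exponentiable_co two_category_axioms)

lemma is_poly_arr_co [simp]: "is_poly_arr (co K) = is_poly_arr K"
  by (simp add: is_poly_arr_def fun_eq_iff)

lemma PolyHom_co [simp]:
  "Obj (PolyHom (co K) pb X Y) = Obj (PolyHom K pb X Y)"
  "arr (PolyHom (co K) pb X Y) = arr (PolyHom K pb X Y)"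
  "Arr (PolyHom (co K) pb X Y) = Arr (PolyHom K pb X Y)"
  "Cell (PolyHom (co K) pb X Y) = Cell (PolyHom K pb X Y)"
  "Dom (PolyHom (co K) pb X Y) = Dom (PolyHom K pb X Y)"
  "Cod (PolyHom (co K) pb X Y) = Cod (PolyHom K pb X Y)"
  "Id1 (PolyHom (co K) pb X Y) = Id1 (PolyHom K pb X Y)"
  "Comp (PolyHom (co K) pb X Y) = Comp (PolyHom K pb X Y)"
  "cell (PolyHom (co K) pb X Y) \<alpha> x y \<longleftrightarrow> cell (PolyHom K pb X Y) \<alpha> y x"
  "inv_arr (PolyHom (co K) pb X Y) = inv_arr (PolyHom K pb X Y)"
  by (auto simp: PolyHom_def fun_eq_iff arr_def cell_def inv_arr_def inverse_arrs_def)

text \<open>Reversing 2-cells exchanges unit and counit.\<close>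

lemma adjoint_PolyHom_co:
  assumes "adjoint_arrs (PolyHom (co K) pb X Y) x y"
  shows "adjoint_arrs (PolyHom K pb X Y) y x"
proof -
  let ?H = "PolyHom K pb X Y"
  obtain p f0 f1 q where x: "x = (p, (f0, f1), q)"
    by (metis prod.collapse)
  obtain g0 g1 where y: "y = (q, (g0, g1), p)"
    using assms x by (cases y) (auto simp: adjoint_arrs_def arr_def)
  obtain \<eta> \<epsilon> where \<eta>: "cell ?H \<eta> (y \<cdot>\<^bsub>?H\<^esub> x) (Id1 ?H (Dom ?H x))"
    and \<epsilon>: "cell ?H \<epsilon> (Id1 ?H (Cod ?H x)) (x \<cdot>\<^bsub>?H\<^esub> y)"
    and t: "(\<epsilon> \<lhd>\<^bsub>PolyHom (co K) pb X Y\<^esub> x) \<bullet>\<^bsub>PolyHom (co K) pb X Y\<^esub> (x \<rhd>\<^bsub>PolyHom (co K) pb X Y\<^esub> \<eta>)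
        = Id2 (PolyHom (co K) pb X Y) x"
      "(y \<rhd>\<^bsub>PolyHom (co K) pb X Y\<^esub> \<epsilon>) \<bullet>\<^bsub>PolyHom (co K) pb X Y\<^esub> (\<eta> \<lhd>\<^bsub>PolyHom (co K) pb X Y\<^esub> y)
        = Id2 (PolyHom (co K) pb X Y) y"
    and a: "x \<in> Arr ?H" "arr ?H y (Cod ?H x) (Dom ?H x)"
    using assms unfolding adjoint_arrs_def PolyHom_co by blast
  obtain \<eta>0 \<eta>1 where \<eta>_eq: "\<eta> = (p, (\<eta>0, \<eta>1), p)"
    using \<eta> x y by (cases \<eta>) (auto simp: cell_def)
  obtain \<epsilon>0 \<epsilon>1 where \<epsilon>_eq: "\<epsilon> = (q, (\<epsilon>0, \<epsilon>1), q)"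
    using \<epsilon> x y by (cases \<epsilon>) (auto simp: cell_def)
  show ?thesis
    unfolding adjoint_arrs_def
    using \<eta> \<epsilon> t a by (intro conjI exI[of _ \<epsilon>] exI[of _ \<eta>]) (auto simp: x y \<eta>_eq \<epsilon>_eq arr_def)
qed

lemma span_co [simp]:
  "span_comp (co K) = span_comp K" "span_hcomp (co K) = span_hcomp K" "id_span (co K) = id_span K"
  "span_lunit (co K) = span_lunit K" "span_runit (co K) = span_runit K"
  "span_assoc (co K) = span_assoc K" "is_span (co K) = is_span K"
  "unit_left (co K) = unit_left K" "unit_right (co K) = unit_right K"
proof -
  show *: "span_comp (co K) = span_comp K" "id_span (co K) = id_span K"
    by (simp_all add: span_comp_def id_span_def fun_eq_iff)
  show "span_hcomp (co K) = span_hcomp K"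
    by (simp add: span_hcomp_def * fun_eq_iff)
  then show "span_lunit (co K) = span_lunit K" "span_runit (co K) = span_runit K"
    "span_assoc (co K) = span_assoc K" "is_span (co K) = is_span K"
    "unit_left (co K) = unit_left K" "unit_right (co K) = unit_right K"
    by (simp_all add: span_lunit_def span_runit_def span_assoc_def is_span_def unit_left_def
        unit_right_def * fun_eq_iff)
qed

lemma is_poly_monad_co: "is_poly_monad (co K) pb B M u m \<longleftrightarrow> is_poly_monad K pb B M u m"
  by (simp add: is_poly_monad_def Let_def)

lemma colax_idempotent_co:
  "colax_idempotent (co K) pb B M u m \<Longrightarrow> lax_idempotent K pb B M u m"
  by (auto simp: colax_idempotent_def lax_idempotent_def Let_def dest: adjoint_PolyHom_co)

lemma P_monad_co: "P_monad (co K) pb B M u m = P_monad K pb B M u m"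
proof -
  have "P_fun (co K) = P_fun K"
    by (simp add: P_fun_def Sigma_fun_def fun_eq_iff)
  moreover have "P_unit (co K) = P_unit K" "P_comp (co K) = P_comp K" "P_nat (co K) = P_nat K"
    using calculation by (simp_all add: P_unit_def P_comp_def P_nat_def fun_eq_iff)
  moreover have "Comp (slice (co K) B) = Comp (slice K B)" for B
    by (simp add: slice_def)
  ultimately show ?thesis
    by (simp add: P_monad_def)
qed

text \<open>The comma object of \<open>f\<close> and the identity in \<open>K\<close> is the comma object of the identity and \<open>f\<close>
  after reversing the 2-cells.\<close>

lemma Psi_comma_monad:
  assumes cm: "chosen_commas K cm" and B: "B \<in> Obj K"
  shows "comma_monad (co K) B (Psi_ob K cm B) (Psi_p K cm B) (Psi_lam K cm B) (Psi_arr K cm B)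
    (\<lambda>f \<alpha> g. fst (snd (onC (Fun (Psi_monad K cm B)) (f, \<alpha>, g))))
    (\<lambda>f. fst (snd (Unit (Psi_monad K cm B) f))) (\<lambda>f. fst (snd (Mult (Psi_monad K cm B) f)))"
proof -
  interpret co: two_category "co K" by (rule two_category_co[OF two_category_axioms])
  let ?\<Psi> = "Psi_ob K cm B" and ?p = "Psi_p K cm B" and ?l = "Psi_lam K cm B"
  have eq: "cm f (Id1 K B) = (?p f, ?\<Psi> f, ?l f)" for f
    by (simp add: Psi_ob_def Psi_p_def Psi_lam_def)
  have c: "is_comma K f (Id1 K B) (?p f, ?\<Psi> f, ?l f)" if "f \<in> Arr K" "Cod K f = B" for f
    using cm that B by (simp add: chosen_commas_def flip: eq)
  note t = commaD[OF c]
  show ?thesis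
  proof (rule co.comma_monadI)
    show "is_comma (co K) (Id1 (co K) B) f (?\<Psi> f, ?p f, ?l f)" if "f \<in> Arr (co K)" "Cod (co K) f = B" for f
      using is_comma_co[OF c] that by simp
    show "Psi_arr K cm B f h g = cm_arr (co K) (?\<Psi> g, ?p g, ?l g) (?\<Psi> f) (h \<cdot>\<^bsub>co K\<^esub> ?p f) (?l f)"
      if "over (co K) B f h g" for f h g
      using that t[of f] t[of g] cm_arr_co[of K "?\<Psi> g" "?p g" "?\<Psi> f" "h \<cdot>\<^bsub>K\<^esub> ?p f"]
      by (simp add: Psi_arr_def eq over_def)
    show "fst (snd (onC (Fun (Psi_monad K cm B)) (f, \<alpha>, g))) =
        cm_cell (co K) (?\<Psi> g, ?p g, ?l g) (Psi_arr K cm B f (Src (co K) \<alpha>) g)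
          (Psi_arr K cm B f (Tgt (co K) \<alpha>) g) (Id2 (co K) (?\<Psi> f)) (\<alpha> \<lhd>\<^bsub>co K\<^esub> ?p f)" for f \<alpha> g
      by (simp add: Psi_monad_def cm_cell_co eq)
    show "fst (snd (Unit (Psi_monad K cm B) f)) =
        cm_arr (co K) (?\<Psi> f, ?p f, ?l f) f (Id1 (co K) (Dom (co K) f)) (Id2 (co K) f)"
      if "f \<in> Arr (co K)" "Cod (co K) f = B" for f
      using that t[of f] cm_arr_co[of K "?\<Psi> f" "?p f" f "Id1 K (Dom K f)"]
      by (simp add: Psi_monad_def eq)
    show "fst (snd (Mult (Psi_monad K cm B) f)) =
        cm_arr (co K) (?\<Psi> f, ?p f, ?l f) (?\<Psi> (?\<Psi> f)) (?p f \<cdot>\<^bsub>co K\<^esub> ?p (?\<Psi> f))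
          ((?l f \<lhd>\<^bsub>co K\<^esub> ?p (?\<Psi> f)) \<bullet>\<^bsub>co K\<^esub> ?l (?\<Psi> f))"
      if "f \<in> Arr (co K)" "Cod (co K) f = B" for f
      using that B t[of f] t[of "?\<Psi> f"] cm_arr_co[of K "?\<Psi> f" "?p f" "?\<Psi> (?\<Psi> f)" "?p f \<cdot>\<^bsub>K\<^esub> ?p (?\<Psi> f)"]
      by (simp add: Psi_monad_def Let_def eq)
  qed
qed

lemma Psi_monad_eq:
  assumes "chosen_commas K cm" "B \<in> Obj K"
  shows "comma_monad.monad (Psi_ob K cm B) (Psi_arr K cm B)
    (\<lambda>f \<alpha> g. fst (snd (onC (Fun (Psi_monad K cm B)) (f, \<alpha>, g))))
    (\<lambda>f. fst (snd (Unit (Psi_monad K cm B) f))) (\<lambda>f. fst (snd (Mult (Psi_monad K cm B) f)))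
    = Psi_monad K cm B"
  unfolding comma_monad.monad_def[OF Psi_comma_monad[OF assms]]
  by (simp add: Psi_monad_def Let_def)

end

lemma arrow_object_co:
  assumes "arrow_object K pb B E d1 d0 l"
  shows "arrow_object (co K) pb B E d0 d1 l"
proof -
  interpret arrow_object K pb B E d1 d0 l by (rule assms)
  interpret co: two_category "co K" by (rule two_category_co[OF two_category_axioms])
  show ?thesis
    using pb is_comma_co[OF comma] by unfold_locales (simp_all add: chosen_pullbacks_def is_arrow_cotensor_def)
qed

theorem proposition4p2p3:
  fixes K :: "('o, 'a, 'c) two_cat"
    and pb :: "'a \<Rightarrow> 'a \<Rightarrow> 'a \<times> 'a"
    and cm :: "'a \<Rightarrow> 'a \<Rightarrow> 'a \<times> 'a \<times> 'c"
    and B E :: 'o and d1 d0 :: 'a and l :: 'c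
  assumes "two_category K"
    and "chosen_pullbacks K pb"
    and "chosen_commas K cm"
    and "B \<in> Obj K"
    and "is_arrow_cotensor K B E d1 d0 l"
  shows "(\<exists>u m. is_poly_monad K pb B (Poly d0 (Id1 K E) d1) u m \<and>
            colax_idempotent K pb B (Poly d0 (Id1 K E) d1) u m \<and>
            two_monads_iso (slice K B)
              (P_monad K pb B (Poly d0 (Id1 K E) d1) u m) (Phi_monad K cm B)) \<and>
         (\<exists>u m. is_poly_monad K pb B (Poly d1 (Id1 K E) d0) u m \<and>
            lax_idempotent K pb B (Poly d1 (Id1 K E) d0) u m \<and>
            two_monads_iso (slice K B)
              (P_monad K pb B (Poly d1 (Id1 K E) d0) u m) (Psi_monad K cm B))"
proof -
  interpret two_category K by (rule assms(1))
  have ao: "arrow_object K pb B E d1 d0 l"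
    using assms two_category_axioms
    by (simp add: arrow_object_def arrow_object_axioms_def spans_def spans_axioms_def)
  interpret ao: arrow_object K pb B E d1 d0 l by (rule ao)
  interpret oa: arrow_object "co K" pb B E d0 d1 l by (rule arrow_object_co[OF ao])
  have "two_monads_iso (slice K B) (P_monad K pb B ao.M ao.u ao.m) (Phi_monad K cm B)"
    using ao.P_monad_iso[OF Phi_comma_monad[OF assms(3)]] Phi_monad_eq[OF assms(3)] by simp
  moreover have "two_monads_iso (slice (co K) B) (P_monad (co K) pb B oa.M oa.u oa.m) (Psi_monad K cm B)"
    using oa.P_monad_iso[OF Psi_comma_monad[OF assms(3,4)]] Psi_monad_eq[OF assms(3,4)] by simp
  then have "two_monads_iso (slice K B) (P_monad K pb B oa.M oa.u oa.m) (Psi_monad K cm B)"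
    unfolding two_monads_iso_co_dual[OF slice_co_dual[OF assms(1)]] P_monad_co .
  moreover have "oa.M = Poly d1 (Id1 K E) d0"
    by simp
  ultimately show ?thesis
    using ao.poly_monad ao.colax oa.poly_monad[unfolded is_poly_monad_co] colax_idempotent_co[OF oa.colax]
    by (metis (no_types))
qed

end
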